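(* Let a group $G$ act on a connected, locally finite graph $\Gamma$ of finite treewidth such that the quotient graph $G\backslash\Gamma$ is finite and each vertex stabilizer $G_v$, $v\in V(\Gamma)$, is finite. Then $G$ is the fundamental group of a finite graph of finite groups.
   Context: Graphs are undirected, without loops and multiple edges; a group acts on a graph by graph automorphisms. "Fundamental group of a graph of groups" is in the sense of Bass–Serre theory; a finite graph of finite groups is a graph of groups whose underlying graph is finite and connected and whose vertex groups (hence edge groups) are finite. A tree decomposition of $\Gamma$ is a tree $T$ with a map $t\mapsto X_t\subseteq V(\Gamma)$, $t\in V(T)$, such that (T1) every vertex of $\Gamma$ lies in some $X_t$; (T2) for every edge $uv\in E(\Gamma)$ there is $t$ with $u,v\in X_t$; (T3) if $v\in X_t\cap X_s$ then $v\in X_r$ for all $r$ on the geodesic path in $T$ from $s$ to $t$. $\Gamma$ has finite treewidth if for some $k\in\mathbb{N}$ there is a tree decomposition with $|X_t|\le k+1$ for all $t\in V(T)$. *)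

theory Defs
  imports
    "Graph_Theory.Digraph_Component"
    "HOL-Algebra.Group_Action"
begin

section \<open>Graphs, trees and tree decompositions\<close>

text \<open>
  An undirected graph without loops and multiple edges is a \<^locale>\<open>pair_bidirected_digraph\<close>:
  a symmetric irreflexive set of ordered pairs of vertices, where the edge \<open>{u, v}\<close> is represented
  by the two arcs \<open>(u, v)\<close> and \<open>(v, u)\<close>. Vertex sets may be infinite; \<^const>\<open>connected\<close> graphs are
  nonempty.
\<close>

definition locally_finite :: "'v pair_pre_digraph \<Rightarrow> bool" where
  "locally_finite \<Gamma> \<longleftrightarrow> (\<forall>v \<in> pverts \<Gamma>. finite {w. (v, w) \<in> parcs \<Gamma>})"

text \<open>
  The library's \<^const>\<open>tree\<close> forbids all directed cycles and hence also the cycles \<open>u, v, u\<close>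
  that every edge of a symmetric digraph gives rise to. In an undirected graph only cycles
  of length at least three count.
\<close>

definition undirected_tree :: "'t pair_pre_digraph \<Rightarrow> bool" where
  "undirected_tree T \<longleftrightarrow>
     pair_bidirected_digraph T \<and> connected (with_proj T) \<and>
     \<not> (\<exists>p. pre_digraph.cycle (with_proj T) p \<and> 3 \<le> length p)"

definition geodesic ::
  "'t pair_pre_digraph \<Rightarrow> 't \<Rightarrow> ('t \<times> 't) awalk \<Rightarrow> 't \<Rightarrow> bool" where
  "geodesic T s p t \<longleftrightarrow>
     pre_digraph.awalk (with_proj T) s p t \<and>
     (\<forall>q. pre_digraph.awalk (with_proj T) s q t \<longrightarrow> length p \<le> length q)"

definition tree_decomposition ::
  "'v pair_pre_digraph \<Rightarrow> 't pair_pre_digraph \<Rightarrow> ('t \<Rightarrow> 'v set) \<Rightarrow> bool" where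
  "tree_decomposition \<Gamma> T X \<longleftrightarrow>
     undirected_tree T \<and>
     (\<forall>t \<in> pverts T. X t \<subseteq> pverts \<Gamma>) \<and>
     (\<forall>v \<in> pverts \<Gamma>. \<exists>t \<in> pverts T. v \<in> X t) \<and>
     (\<forall>(u, v) \<in> parcs \<Gamma>. \<exists>t \<in> pverts T. u \<in> X t \<and> v \<in> X t) \<and>
     (\<forall>s \<in> pverts T. \<forall>t \<in> pverts T. \<forall>p. geodesic T s p t \<longrightarrow>
        (\<forall>r \<in> set (pre_digraph.awalk_verts (with_proj T) s p). X t \<inter> X s \<subseteq> X r))"

text \<open>
  The type argument is the type from which the nodes of the decomposition tree are drawn.
\<close>

definition finite_treewidth :: "'t itself \<Rightarrow> 'v pair_pre_digraph \<Rightarrow> bool" where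
  "finite_treewidth _ \<Gamma> \<longleftrightarrow>
     (\<exists>(k :: nat) (T :: 't pair_pre_digraph) X. tree_decomposition \<Gamma> T X \<and>
        (\<forall>t \<in> pverts T. finite (X t) \<and> card (X t) \<le> k + 1))"


section \<open>Group actions on graphs\<close>

locale graph_action =
  pair_bidirected_digraph \<Gamma> + group_action G "pverts \<Gamma>" \<phi>
  for G :: "('g, 'm) monoid_scheme" and \<Gamma> :: "'v pair_pre_digraph" and \<phi> +
  assumes adjacency_preserving:
    "\<lbrakk>g \<in> carrier G; u \<in> pverts \<Gamma>; v \<in> pverts \<Gamma>\<rbrakk>
       \<Longrightarrow> (\<phi> g u, \<phi> g v) \<in> parcs \<Gamma> \<longleftrightarrow> (u, v) \<in> parcs \<Gamma>"

text \<open>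
  The arcs of the quotient are the orbits of arcs. The sets of first and of second components of
  the orbit of \<open>(u, v)\<close> are the orbits of \<open>u\<close> and of \<open>v\<close>. The quotient may have loops and
  multiple arcs.
\<close>

definition quotient_graph ::
  "('g, 'm) monoid_scheme \<Rightarrow> 'v pair_pre_digraph \<Rightarrow> ('g \<Rightarrow> 'v \<Rightarrow> 'v)
     \<Rightarrow> ('v set, ('v \<times> 'v) set) pre_digraph" where
  "quotient_graph G \<Gamma> \<phi> =
     \<lparr> verts = orbits G (pverts \<Gamma>) \<phi>,
       arcs = orbits G (parcs \<Gamma>) (\<lambda>g. map_prod (\<phi> g) (\<phi> g)),
       tail = image fst,
       head = image snd \<rparr>"


section \<open>Graphs of groups and their fundamental groups\<close>

text \<open>
  We follow Serre. The underlying graph has arcs with a fixed-point free reversal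
  \<open>y \<mapsto> rev y\<close> (loops and multiple edges are allowed), the edge groups satisfy
  \<open>G\<^sub>y = G\<^bsub>rev y\<^esub>\<close>, and \<open>edge_emb y\<close> is the monomorphism \<open>a \<mapsto> a\<^sup>y\<close> from \<open>G\<^sub>y\<close> into the
  group at the head of \<open>y\<close>.
\<close>

record ('n, 'e, 'a, 'b) graph_of_groups =
  base :: "('n, 'e) pre_digraph"
  arc_rev :: "'e \<Rightarrow> 'e"
  vertex_group :: "'n \<Rightarrow> 'a monoid"
  edge_group :: "'e \<Rightarrow> 'b monoid"
  edge_emb :: "'e \<Rightarrow> 'b \<Rightarrow> 'a"

locale graph_of_groups =
  bidirected_digraph "base \<Y>" "arc_rev \<Y>"
  for \<Y> :: "('n, 'e, 'a, 'b) graph_of_groups" (structure) +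
  assumes connected_base: "connected (base \<Y>)"
    and group_vertex_group: "v \<in> verts (base \<Y>) \<Longrightarrow> group (vertex_group \<Y> v)"
    and group_edge_group: "y \<in> arcs (base \<Y>) \<Longrightarrow> group (edge_group \<Y> y)"
    and edge_group_rev: "y \<in> arcs (base \<Y>) \<Longrightarrow> edge_group \<Y> (arc_rev \<Y> y) = edge_group \<Y> y"
    and edge_emb_mon:
      "y \<in> arcs (base \<Y>)
         \<Longrightarrow> edge_emb \<Y> y \<in> mon (edge_group \<Y> y) (vertex_group \<Y> (head (base \<Y>) y))"

locale finite_graph_of_finite_groups = graph_of_groups +
  assumes finite_base: "fin_digraph (base \<Y>)"
    and finite_vertex_group: "v \<in> verts (base \<Y>) \<Longrightarrow> finite (carrier (vertex_group \<Y> v))"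

text \<open>
  The group \<open>F(\<Y>)\<close> is generated by the vertex groups and the arcs, subject to the relations
  \<open>rev y = y\<inverse>\<close> and \<open>y a\<^sup>y y\<inverse> = a\<^bsup>rev y\<^esup>\<close> for all arcs \<open>y\<close> and \<open>a \<in> G\<^sub>y\<close>. Every generator is
  inverted by another generator, so \<open>F(\<Y>)\<close> is the quotient of the monoid of words in
  the generators by the congruence generated by these relations and the multiplication
  tables of the vertex groups.
\<close>

datatype ('n, 'e, 'a) letter = Elem 'n 'a | Arc 'e

definition letters :: "('n, 'e, 'a, 'b) graph_of_groups \<Rightarrow> ('n, 'e, 'a) letter set" where
  "letters \<Y> =
     {Elem v a | v a. v \<in> verts (base \<Y>) \<and> a \<in> carrier (vertex_group \<Y> v)}
     \<union> Arc ` arcs (base \<Y>)"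

inductive word_eq ::
  "('n, 'e, 'a, 'b) graph_of_groups
     \<Rightarrow> ('n, 'e, 'a) letter list \<Rightarrow> ('n, 'e, 'a) letter list \<Rightarrow> bool"
  for \<Y> where
  refl: "word_eq \<Y> w w"
| sym: "word_eq \<Y> w w' \<Longrightarrow> word_eq \<Y> w' w"
| trans: "word_eq \<Y> w w' \<Longrightarrow> word_eq \<Y> w' w'' \<Longrightarrow> word_eq \<Y> w w''"
| append: "word_eq \<Y> w w' \<Longrightarrow> word_eq \<Y> x x' \<Longrightarrow> word_eq \<Y> (w @ x) (w' @ x')"
| vertex_one: "v \<in> verts (base \<Y>) \<Longrightarrow> word_eq \<Y> [Elem v \<one>\<^bsub>vertex_group \<Y> v\<^esub>] []"
| vertex_mult:
    "\<lbrakk>v \<in> verts (base \<Y>); a \<in> carrier (vertex_group \<Y> v); b \<in> carrier (vertex_group \<Y> v)\<rbrakk>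
       \<Longrightarrow> word_eq \<Y> [Elem v a, Elem v b] [Elem v (a \<otimes>\<^bsub>vertex_group \<Y> v\<^esub> b)]"
| arc_inverse: "y \<in> arcs (base \<Y>) \<Longrightarrow> word_eq \<Y> [Arc y, Arc (arc_rev \<Y> y)] []"
| arc_conj:
    "\<lbrakk>y \<in> arcs (base \<Y>); a \<in> carrier (edge_group \<Y> y)\<rbrakk>
       \<Longrightarrow> word_eq \<Y>
             [Arc y, Elem (head (base \<Y>) y) (edge_emb \<Y> y a), Arc (arc_rev \<Y> y)]
             [Elem (tail (base \<Y>) y) (edge_emb \<Y> (arc_rev \<Y> y) a)]"

definition word_class ::
  "('n, 'e, 'a, 'b) graph_of_groups
     \<Rightarrow> ('n, 'e, 'a) letter list \<Rightarrow> ('n, 'e, 'a) letter list set" where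
  "word_class \<Y> w = {w'. word_eq \<Y> w w'}"

definition word_group ::
  "('n, 'e, 'a, 'b) graph_of_groups \<Rightarrow> ('n, 'e, 'a) letter list set monoid" where
  "word_group \<Y> =
     \<lparr> carrier = word_class \<Y> ` lists (letters \<Y>),
       mult = (\<lambda>A B. \<Union>w \<in> A. \<Union>x \<in> B. word_class \<Y> (w @ x)),
       one = word_class \<Y> [] \<rparr>"

text \<open>
  The words \<open>r\<^sub>0 y\<^sub>1 r\<^sub>1 \<dots> y\<^sub>n r\<^sub>n\<close> whose arcs form a walk from \<open>u\<close> to \<open>v\<close> and where each \<open>r\<^sub>i\<close> lies
  in the group of the \<open>i\<close>-th vertex of this walk. The fundamental group at a vertex \<open>v\<close> is the
  subgroup of \<open>F(\<Y>)\<close> formed by the words along closed walks at \<open>v\<close>.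
\<close>

inductive walk_word ::
  "('n, 'e, 'a, 'b) graph_of_groups \<Rightarrow> 'n \<Rightarrow> ('n, 'e, 'a) letter list \<Rightarrow> 'n \<Rightarrow> bool"
  for \<Y> where
  Nil:
    "\<lbrakk>v \<in> verts (base \<Y>); r \<in> carrier (vertex_group \<Y> v)\<rbrakk> \<Longrightarrow> walk_word \<Y> v [Elem v r] v"
| Cons:
    "\<lbrakk>y \<in> arcs (base \<Y>); r \<in> carrier (vertex_group \<Y> (tail (base \<Y>) y));
      walk_word \<Y> (head (base \<Y>) y) w v\<rbrakk>
       \<Longrightarrow> walk_word \<Y> (tail (base \<Y>) y) (Elem (tail (base \<Y>) y) r # Arc y # w) v"

definition fundamental_group ::
  "('n, 'e, 'a, 'b) graph_of_groups \<Rightarrow> 'n \<Rightarrow> ('n, 'e, 'a) letter list set monoid" where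
  "fundamental_group \<Y> v =
     (word_group \<Y>)\<lparr>carrier := {word_class \<Y> w | w. walk_word \<Y> v w v}\<rparr>"

end

theory Submission
  imports Defs
begin

text \<open>
  Order the vertex sets with finite edge boundary by boundary size and, for equal size, by the
  number of connected small cuts they cross. The small cuts that are not Boolean combinations of
  smaller ones in this order (the essential cuts) are pairwise nested, by submodularity, and generate
  all small cuts. A nested family in which finitely many cuts separate any two vertices is
  the edge set of a tree whose nodes are the consistent orientations of the family, and \<open>G\<close> acts on
  this tree with finitely many orbits and finite edge stabilizers.

  Finite treewidth makes the node stabilizers finite as well. The stabilizer of an orientation acts
  cofinitely on a coarsely connected set \<open>K\<close> of vertices. If it were infinite, balanced bags would
  give small cuts with arbitrarily many points of \<open>K\<close> on both sides, and, up to translation, only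
  finitely many such cuts split \<open>K\<close>, so one of them would have infinitely many points of \<open>K\<close> on both
  sides. This is impossible for a Boolean combination of essential cuts, since almost all of \<open>K\<close> lies
  on the chosen side of each of them.

  Bass--Serre theory then identifies \<open>G\<close>: a word along a closed walk describes a walk in the
  tree, backtracking in this walk can be removed by the relations, and a closed walk without
  backtracking is trivial.
\<close>

section \<open>Cuts of a connected graph\<close>

text \<open>Splitting along one cut at a time would produce vertex groups that have to be split
  again, and termination of this process is an accessibility question. Here a bound \<open>k\<close>
  on the boundary size is fixed beforehand: if bags have at most \<open>w + 1\<close> vertices and
  \<open>d\<close> bounds the degrees, every bag has at most \<open>(w + 1) * d\<close> boundary
  edges. All cuts up to this size are treated at once, so one tree already has finite node
  stabilizers.

  Crossing cuts are the obstacle to a tree. Submodularity of the boundary size only shows that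
  opposite corners are together no worse than the two cuts; the crossing number is the tie-break
  that makes one comparison strict. Because the order is invariant and involves no choice, the group
  acts on the resulting family.

  A group element may exchange the two sides of a cut. Each tree edge is therefore subdivided by the
  node \<open>side C\<close>, which makes the tree bipartite and excludes inversions. The
  fundamental group is taken at a vertex, through closed walks, so no maximal subtree of the
  quotient has to be lifted.\<close>

lemma rtrancl_crossing:
  assumes "(u, v) \<in> L\<^sup>*" "u \<in> F" "v \<notin> F"
  shows "\<exists>x y. (x, y) \<in> L \<and> x \<in> F \<and> y \<notin> F"
  using assms by (induction rule: rtrancl_induct) auto

lemma rtrancl_finite_subrelation:
  assumes "(u, v) \<in> L\<^sup>*"
  shows "\<exists>M \<subseteq> L. finite M \<and> (u, v) \<in> M\<^sup>*"
  using assms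
proof (induction rule: rtrancl_induct)
  case base
  then show ?case by auto
next
  case (step y z)
  then obtain M where M: "M \<subseteq> L" "finite M" "(u, y) \<in> M\<^sup>*" by auto
  have "(u, y) \<in> (insert (y, z) M)\<^sup>*" using M(3) by (meson rtrancl_mono subsetD subset_insertI)
  then have "(u, z) \<in> (insert (y, z) M)\<^sup>*" by (simp add: rtrancl.rtrancl_into_rtrancl)
  then show ?case using M step(2) by (intro exI[of _ "insert (y, z) M"]) auto
qed

locale conn_graph =
  fixes V :: "'v set" and R :: "('v \<times> 'v) set"
  assumes arcs_subset: "R \<subseteq> V \<times> V"
    and arcs_sym: "sym R"
    and arcs_conn: "\<lbrakk>u \<in> V; v \<in> V\<rbrakk> \<Longrightarrow> (u, v) \<in> R\<^sup>*"
    and nonempty: "V \<noteq> {}"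
    and finite_nbrs: "v \<in> V \<Longrightarrow> finite (R `` {v})"
begin

definition bd :: "'v set \<Rightarrow> ('v \<times> 'v) set" where
  "bd C = {(u, v) \<in> R. u \<in> C \<and> v \<notin> C}"

definition ends :: "'v set \<Rightarrow> 'v set" where
  "ends C = fst ` bd C \<union> snd ` bd C"

definition conn :: "'v set \<Rightarrow> bool" where
  "conn A \<longleftrightarrow> (\<forall>x \<in> A. \<forall>y \<in> A. (x, y) \<in> (R \<inter> A \<times> A)\<^sup>*)"

definition cross :: "'v set \<Rightarrow> 'v set \<Rightarrow> bool" where
  "cross F X \<longleftrightarrow> F \<inter> X \<noteq> {} \<and> F - X \<noteq> {} \<and> X - F \<noteq> {} \<and> V - (F \<union> X) \<noteq> {}"

definition separates :: "'v set \<Rightarrow> 'v set \<Rightarrow> bool" where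
  "separates F S \<longleftrightarrow> S \<inter> F \<noteq> {} \<and> S - F \<noteq> {}"

text \<open>Connectedness of both sides makes these the tight cuts of bounded size; without it, one
  edge could lie on the boundary of infinitely many sets.\<close>

definition cuts :: "nat \<Rightarrow> 'v set set" where
  "cuts k = {F. F \<subseteq> V \<and> F \<noteq> {} \<and> F \<noteq> V \<and> conn F \<and> conn (V - F) \<and> finite (bd F) \<and> card (bd F) \<le> k}"

lemma arcs_symD: "(u, v) \<in> R \<Longrightarrow> (v, u) \<in> R"
  using arcs_sym by (meson symD)

lemma bd_compl: "bd (V - C) = (bd C)\<inverse>"
  using arcs_subset arcs_symD unfolding bd_def by blast

lemma finite_bd_compl [simp]: "finite (bd (V - C)) \<longleftrightarrow> finite (bd C)"
  by (simp add: bd_compl)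

lemma card_bd_compl [simp]: "card (bd (V - C)) = card (bd C)"
  by (simp add: bd_compl)

lemma bd_nonempty: "\<lbrakk>C \<subseteq> V; C \<noteq> {}; C \<noteq> V\<rbrakk> \<Longrightarrow> bd C \<noteq> {}"
proof -
  assume C: "C \<subseteq> V" "C \<noteq> {}" "C \<noteq> V"
  then obtain u v where "u \<in> C" "v \<in> V" "v \<notin> C" by blast
  then have "(u, v) \<in> R\<^sup>*" using arcs_conn C by blast
  from rtrancl_crossing[OF this \<open>u \<in> C\<close> \<open>v \<notin> C\<close>] show ?thesis by (auto simp: bd_def)
qed

lemma bd_crossing:
  assumes "conn A" "x \<in> A" "y \<in> A" "x \<in> C" "y \<notin> C"
  shows "\<exists>u v. (u, v) \<in> bd C \<and> u \<in> A \<and> v \<in> A"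
  using rtrancl_crossing[of x y "R \<inter> A \<times> A" C] assms by (auto simp: conn_def bd_def)

lemma finite_ends: "finite (bd C) \<Longrightarrow> finite (ends C)"
  by (simp add: ends_def)

lemma endsI: "(u, v) \<in> bd C \<Longrightarrow> u \<in> ends C" "(u, v) \<in> bd C \<Longrightarrow> v \<in> ends C"
  by (force simp: ends_def)+

lemma ends_subset: "ends C \<subseteq> V"
  using arcs_subset by (auto simp: ends_def bd_def)

section \<open>Finiteness of sets of tight cuts\<close>

lemma cut_compl: "F \<in> cuts k \<Longrightarrow> V - F \<in> cuts k"
  unfolding cuts_def by (auto simp: double_diff)

text \<open>If \<open>u\<close> and \<open>v\<close> are still joined after deletion of
  \<open>A\<close>, a fixed finite path between them meets the boundary again, so \<open>A\<close>
  can be enlarged in finitely many ways while \<open>j\<close> drops. If they are not joined,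
  connectedness of both sides forces the cut to be the component of \<open>u\<close>.\<close>

lemma finite_cuts_through:
  assumes "finite A" "A \<noteq> {}" "A \<subseteq> R"
  shows "finite {F \<in> cuts k. A \<subseteq> bd F \<and> card (bd F - A) \<le> j}"
  using assms
proof (induction j arbitrary: A rule: less_induct)
  case (less j)
  obtain u v where uv: "(u, v) \<in> A" using less.prems by auto
  let ?R = "R - A - A\<inverse>"
  let ?\<F> = "{F \<in> cuts k. A \<subseteq> bd F \<and> card (bd F - A) \<le> j}"
  show ?case
  proof (cases "(u, v) \<in> ?R\<^sup>*")
    case True
    obtain M where M: "M \<subseteq> ?R" "finite M" "(u, v) \<in> M\<^sup>*"
      using rtrancl_finite_subrelation[OF True] by blast
    \<comment> \<open>The clause \<open>j > 0\<close> empties the case \<open>j = 0\<close>, where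
      the truncated \<open>j - 1\<close> would not be smaller than \<open>j\<close>.\<close>
    have sub: "?\<F> \<subseteq> (\<Union>e\<in>M. {F \<in> cuts k. insert e A \<subseteq> bd F \<and> card (bd F - insert e A) \<le> j - 1 \<and> j > 0})"
    proof
      fix F assume F: "F \<in> ?\<F>"
      have "u \<in> F" "v \<notin> F" using F uv by (auto simp: bd_def)
      from rtrancl_crossing[OF M(3) this] obtain x y where xy: "(x, y) \<in> M" "x \<in> F" "y \<notin> F" by blast
      have mem: "(x, y) \<in> bd F - A" using xy M by (auto simp: bd_def)
      have fin: "finite (bd F)" using F by (auto simp: cuts_def)
      have "card (bd F - insert (x, y) A) < card (bd F - A)"
        using mem fin by (intro psubset_card_mono) auto
      then show "F \<in> (\<Union>e\<in>M. {F \<in> cuts k. insert e A \<subseteq> bd F \<and> card (bd F - insert e A) \<le> j - 1 \<and> j > 0})"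
        using F xy(1) mem by (intro UN_I[of "(x, y)"]) auto
    qed
    have "finite {F \<in> cuts k. insert e A \<subseteq> bd F \<and> card (bd F - insert e A) \<le> j - 1 \<and> j > 0}" if "e \<in> M" for e
    proof (cases "j > 0")
      case True
      then have "finite {F \<in> cuts k. insert e A \<subseteq> bd F \<and> card (bd F - insert e A) \<le> j - 1}"
        using less.IH[of "j - 1" "insert e A"] less.prems that M by auto
      then show ?thesis by (rule rev_finite_subset) auto
    qed simp
    then show ?thesis using sub M(2) by (meson finite_UN_I finite_subset)
  next
    case False
    have "F = {x. (u, x) \<in> ?R\<^sup>*}" if F: "F \<in> ?\<F>" for F
    proof -
      have AF: "A \<subseteq> bd F" and conn: "conn F" "conn (V - F)" and FV: "F \<subseteq> V" using F by (auto simp: cuts_def)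
      have uF: "u \<in> F" and vF: "v \<in> V - F" using AF uv arcs_subset by (auto simp: bd_def)
      \<comment> \<open>No edge inside \<open>F\<close> or inside its complement belongs to
        \<open>A\<close> or its converse, so both sides stay connected after the deletion.\<close>
      have R1: "R \<inter> F \<times> F \<subseteq> ?R" "R \<inter> (V - F) \<times> (V - F) \<subseteq> ?R" using AF by (auto simp: bd_def)
      have 1: "(u, x) \<in> ?R\<^sup>*" if "x \<in> F" for x
        using conn(1) uF that rtrancl_mono[OF R1(1)] by (auto simp: conn_def)
      have 2: "(x, v) \<in> ?R\<^sup>*" if "x \<in> V - F" for x
        using conn(2) vF that rtrancl_mono[OF R1(2)] by (auto simp: conn_def)
      have 3: "x \<in> V" if "(u, x) \<in> ?R\<^sup>*" for x
        using that by (induction rule: rtrancl_induct) (use uF FV arcs_subset in auto)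
      show ?thesis using 1 2 3 False by (auto intro: rtrancl_trans)
    qed
    then have "?\<F> \<subseteq> {{x. (u, x) \<in> ?R\<^sup>*}}" by blast
    then show ?thesis by (meson finite.simps finite_subset)
  qed
qed

lemma finite_cuts_separating:
  assumes "finite S" "S \<subseteq> V"
  shows "finite {F \<in> cuts k. separates F S}"
proof -
  have one: "finite {F \<in> cuts k. u \<in> F \<and> v \<notin> F}" if "u \<in> V" "v \<in> V" for u v
  proof -
    have "(u, v) \<in> R\<^sup>*" using arcs_conn that by blast
    from rtrancl_finite_subrelation[OF this]
    obtain M where M: "M \<subseteq> R" "finite M" "(u, v) \<in> M\<^sup>*" by blast
    have "{F \<in> cuts k. u \<in> F \<and> v \<notin> F} \<subseteq> (\<Union>e\<in>M. {F \<in> cuts k. {e} \<subseteq> bd F \<and> card (bd F - {e}) \<le> k})"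
    proof
      fix F assume F: "F \<in> {F \<in> cuts k. u \<in> F \<and> v \<notin> F}"
      then obtain x y where xy: "(x, y) \<in> M" "x \<in> F" "y \<notin> F" using rtrancl_crossing[OF M(3)] by blast
      moreover have "card (bd F - {(x, y)}) \<le> k"
        using F by (auto simp: cuts_def intro: le_trans[OF card_mono])
      ultimately show "F \<in> (\<Union>e\<in>M. {F \<in> cuts k. {e} \<subseteq> bd F \<and> card (bd F - {e}) \<le> k})"
        using F M by (intro UN_I[of "(x, y)"]) (auto simp: bd_def)
    qed
    moreover have "finite (\<Union>e\<in>M. {F \<in> cuts k. {e} \<subseteq> bd F \<and> card (bd F - {e}) \<le> k})"
      using M finite_cuts_through by (intro finite_UN_I) blast+
    ultimately show ?thesis by (rule finite_subset)
  qed
  have "{F \<in> cuts k. separates F S} \<subseteq> (\<Union>u\<in>S. \<Union>v\<in>S. {F \<in> cuts k. u \<in> F \<and> v \<notin> F})"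
    by (auto simp: separates_def)
  moreover have "finite (\<Union>u\<in>S. \<Union>v\<in>S. {F \<in> cuts k. u \<in> F \<and> v \<notin> F})"
    using assms one by (intro finite_UN_I) auto
  ultimately show ?thesis by (rule finite_subset)
qed

text \<open>The connected set \<open>F\<close> meets both \<open>X\<close> and its complement, so it
  contains a boundary edge of \<open>X\<close>, and the same holds for \<open>V - F\<close>. Thus
  crossing \<open>X\<close> means separating a set that is finite if \<open>bd X\<close> is; this
  makes crossing numbers finite.\<close>

lemma cross_separates_ends:
  assumes "F \<in> cuts k" "cross F X" "X \<subseteq> V"
  shows "separates F (ends X)"
proof -
  have "conn F" "conn (V - F)" using assms(1) by (auto simp: cuts_def)
  obtain a b where "a \<in> F" "a \<in> X" "b \<in> F" "b \<notin> X" using assms(2) by (auto simp: cross_def)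
  from bd_crossing[OF \<open>conn F\<close> this(1,3,2,4)] obtain x where "x \<in> F" "x \<in> ends X"
    using endsI by blast
  moreover obtain a b where "a \<in> V - F" "a \<in> X" "b \<in> V - F" "b \<notin> X"
    using assms(2,3) by (auto simp: cross_def)
  from bd_crossing[OF \<open>conn (V - F)\<close> this(1,3,2,4)] obtain y where "y \<in> V - F" "y \<in> ends X"
    using endsI by blast
  ultimately show ?thesis by (auto simp: separates_def)
qed

end

section \<open>Essential cuts\<close>

inductive_set bool_span :: "'v set \<Rightarrow> 'v set set \<Rightarrow> 'v set set" for V S where
  empty: "{} \<in> bool_span V S"
| gen: "X \<in> S \<Longrightarrow> X \<in> bool_span V S"
| compl: "X \<in> bool_span V S \<Longrightarrow> V - X \<in> bool_span V S"
| union: "X \<in> bool_span V S \<Longrightarrow> Y \<in> bool_span V S \<Longrightarrow> X \<union> Y \<in> bool_span V S"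

lemma bool_span_subsetI: "S \<subseteq> bool_span V T \<Longrightarrow> bool_span V S \<subseteq> bool_span V T"
proof
  fix X assume "S \<subseteq> bool_span V T" "X \<in> bool_span V S"
  from this(2,1) show "X \<in> bool_span V T"
    by (induction rule: bool_span.induct) (auto intro: bool_span.intros)
qed

lemma bool_span_compl_iff: "X \<subseteq> V \<Longrightarrow> V - X \<in> bool_span V S \<longleftrightarrow> X \<in> bool_span V S"
  by (metis bool_span.compl double_diff order_refl)

lemma bool_span_image:
  assumes "bij_betw f V V" "\<And>X. X \<in> S \<Longrightarrow> X \<subseteq> V \<and> f ` X \<in> T" "X \<in> bool_span V S"
  shows "X \<subseteq> V \<and> f ` X \<in> bool_span V T"
  using assms(3)
proof (induction rule: bool_span.induct)
  case (compl X)
  have "f ` (V - X) = V - f ` X"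
    using assms(1) compl.IH inj_on_image_set_diff[of f V V X] by (simp add: bij_betw_def)
  then show ?case using compl.IH bool_span.compl[of "f ` X" V T] by auto
next
  case (union X Y)
  then show ?case using bool_span.union[of "f ` X" V T "f ` Y"] by (simp add: image_Un)
next
  case (gen X)
  then show ?case using assms(2)[of X] by (simp add: bool_span.gen)
next
  case empty
  then show ?case by (simp add: bool_span.empty)
qed

text \<open>A Boolean expression uses finitely many generators and cannot distinguish points with
  the same membership pattern in them.\<close>

lemma bool_span_atoms:
  assumes "X \<in> bool_span V S"
  shows "\<exists>T \<subseteq> S. finite T \<and> (\<forall>u \<in> V. \<forall>v \<in> V. (\<forall>C \<in> T. u \<in> C \<longleftrightarrow> v \<in> C) \<longrightarrow> (u \<in> X \<longleftrightarrow> v \<in> X))"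
  using assms
proof (induction rule: bool_span.induct)
  case (union X Y)
  obtain T where T: "T \<subseteq> S" "finite T" "\<And>u v. u \<in> V \<Longrightarrow> v \<in> V \<Longrightarrow> \<forall>C \<in> T. u \<in> C \<longleftrightarrow> v \<in> C \<Longrightarrow> u \<in> X \<longleftrightarrow> v \<in> X"
    using union.IH(1) by metis
  obtain U where U: "U \<subseteq> S" "finite U" "\<And>u v. u \<in> V \<Longrightarrow> v \<in> V \<Longrightarrow> \<forall>C \<in> U. u \<in> C \<longleftrightarrow> v \<in> C \<Longrightarrow> u \<in> Y \<longleftrightarrow> v \<in> Y"
    using union.IH(2) by metis
  have "u \<in> X \<union> Y \<longleftrightarrow> v \<in> X \<union> Y" if "u \<in> V" "v \<in> V" "\<forall>C \<in> T \<union> U. u \<in> C \<longleftrightarrow> v \<in> C" for u v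
    using T(3)[OF that(1,2)] U(3)[OF that(1,2)] that(3) by blast
  then have "\<forall>u \<in> V. \<forall>v \<in> V. (\<forall>C \<in> T \<union> U. u \<in> C \<longleftrightarrow> v \<in> C) \<longrightarrow> (u \<in> X \<union> Y \<longleftrightarrow> v \<in> X \<union> Y)"
    by (intro ballI impI)
  moreover have "T \<union> U \<subseteq> S" "finite (T \<union> U)" using T(1,2) U(1,2) by auto
  ultimately show ?case by (intro exI[of _ "T \<union> U"] conjI)
next
  case (gen X)
  then show ?case by (intro exI[of _ "{X}"] conjI) auto
next
  case (compl X)
  then show ?case by (elim exE) (rule exI, blast)
next
  case empty
  then show ?case by blast
qed

text \<open>The counting form of submodularity: by the two inclusions no element is counted more
  often on the left than on the right. It serves both edge boundaries and sets of crossing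
  cuts.\<close>

lemma card_add_le:
  assumes "finite P" "finite Q" "X \<union> Y \<subseteq> P \<union> Q" "X \<inter> Y \<subseteq> P \<inter> Q"
  shows "card X + card Y \<le> card P + card Q"
proof -
  have "finite X" "finite Y" using assms by (auto intro: finite_subset)
  then have "card X + card Y = card (X \<union> Y) + card (X \<inter> Y)" by (rule card_Un_Int)
  also have "\<dots> \<le> card (P \<union> Q) + card (P \<inter> Q)" using assms by (intro add_mono card_mono) auto
  also have "\<dots> = card P + card Q" using assms card_Un_Int by metis
  finally show ?thesis .
qed

section \<open>Submodularity of boundaries and crossings, and nestedness\<close>

context conn_graph
begin

lemma bd_Un_Int:
  "bd (C \<inter> D) \<union> bd (C \<union> D) \<subseteq> bd C \<union> bd D" "bd (C \<inter> D) \<inter> bd (C \<union> D) \<subseteq> bd C \<inter> bd D"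
  by (auto simp: bd_def)

definition crossing :: "nat \<Rightarrow> 'v set \<Rightarrow> 'v set set" where
  "crossing k X = {F \<in> cuts k. cross F X}"

lemma finite_crossing:
  assumes "X \<subseteq> V" "finite (bd X)"
  shows "finite (crossing k X)"
proof (rule finite_subset)
  show "crossing k X \<subseteq> {F \<in> cuts k. separates F (ends X)}"
    using cross_separates_ends assms(1) unfolding crossing_def by blast
  show "finite {F \<in> cuts k. separates F (ends X)}"
    using finite_cuts_separating[OF finite_ends[OF assms(2)] ends_subset] .
qed

lemma cross_compl:
  assumes "F \<subseteq> V" "X \<subseteq> V"
  shows "cross F (V - X) \<longleftrightarrow> cross F X"
proof -
  have eq: "F \<inter> (V - X) = F - X" "F - (V - X) = F \<inter> X" "(V - X) - F = V - (F \<union> X)" "V - (F \<union> (V - X)) = X - F"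
    using assms by auto
  show ?thesis unfolding cross_def eq by blast
qed

lemma crossing_compl:
  assumes "X \<subseteq> V"
  shows "crossing k (V - X) = crossing k X"
proof -
  have "cross F (V - X) \<longleftrightarrow> cross F X" if "F \<in> cuts k" for F
    using cross_compl assms that by (simp add: cuts_def)
  then show ?thesis unfolding crossing_def by blast
qed

text \<open>A cut crossing neither \<open>C\<close> nor \<open>D\<close>, although it crosses their
  intersection, is contained in each of them or covers \<open>V\<close> together with it. Equal
  alternatives carry over to \<open>C \<inter> D\<close>; mixed ones give
  \<open>C \<union> D = V\<close>, which the nonempty outer corner excludes.\<close>

lemma cross_inter:
  assumes "F \<subseteq> V" "V - (C \<union> D) \<noteq> {}" "cross F (C \<inter> D)"
  shows "cross F C \<or> cross F D"
proof (rule ccontr)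
  assume "\<not> ?thesis"
  moreover have "F \<inter> C \<noteq> {}" "F \<inter> D \<noteq> {}" "C - F \<noteq> {}" "D - F \<noteq> {}" using assms(3) by (auto simp: cross_def)
  ultimately have C: "F \<subseteq> C \<or> V \<subseteq> F \<union> C" and D: "F \<subseteq> D \<or> V \<subseteq> F \<union> D" by (auto simp: cross_def)
  have "\<not> F \<subseteq> C \<inter> D" "\<not> V \<subseteq> F \<union> (C \<inter> D)" using assms(3) by (auto simp: cross_def)
  then show False using C D assms(1,2) by blast
qed

lemma cross_union:
  assumes "F \<subseteq> V" "C \<inter> D \<noteq> {}" "cross F (C \<union> D)"
  shows "cross F C \<or> cross F D"
proof (rule ccontr)
  assume "\<not> ?thesis"
  moreover have "F - C \<noteq> {}" "F - D \<noteq> {}" "V - (F \<union> C) \<noteq> {}" "V - (F \<union> D) \<noteq> {}" using assms(3) by (auto simp: cross_def)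
  ultimately have C: "F \<inter> C = {} \<or> C \<subseteq> F" and D: "F \<inter> D = {} \<or> D \<subseteq> F" by (auto simp: cross_def)
  have "F \<inter> (C \<union> D) \<noteq> {}" "\<not> C \<union> D \<subseteq> F" using assms(3) by (auto simp: cross_def)
  then show False using C D assms(2) by blast
qed

text \<open>Together with \<open>cross_inter\<close> and \<open>cross_union\<close> this makes
  crossing numbers submodular: a cut counted for both opposite corners is counted for both
  \<open>C\<close> and \<open>D\<close>.\<close>

lemma cross_inter_union:
  assumes "cross F (C \<inter> D)" "cross F (C \<union> D)"
  shows "cross F C \<and> cross F D"
proof -
  have "F \<inter> C \<noteq> {}" "F \<inter> D \<noteq> {}" "C - F \<noteq> {}" "D - F \<noteq> {}" using assms(1) by (auto simp: cross_def)
  moreover have "F - C \<noteq> {}" "F - D \<noteq> {}" "V - (F \<union> C) \<noteq> {}" "V - (F \<union> D) \<noteq> {}" using assms(2) by (auto simp: cross_def)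
  ultimately show ?thesis by (simp add: cross_def)
qed

definition lower :: "nat \<Rightarrow> 'v set \<Rightarrow> 'v set \<Rightarrow> bool" where
  "lower k X Y \<longleftrightarrow> finite (bd X) \<and> X \<subseteq> V \<and> (card (bd X) < card (bd Y) \<or>
     card (bd X) = card (bd Y) \<and> card (crossing k X) < card (crossing k Y))"

definition essential :: "nat \<Rightarrow> 'v set set" where
  "essential k = {C. C \<subseteq> V \<and> finite (bd C) \<and> card (bd C) \<le> k \<and> C \<notin> bool_span V {X. lower k X C}}"

lemma lower_compl_left: "X \<subseteq> V \<Longrightarrow> lower k (V - X) Y \<longleftrightarrow> lower k X Y"
  by (auto simp: lower_def crossing_compl)

lemma lower_compl_right: "Y \<subseteq> V \<Longrightarrow> lower k X (V - Y) \<longleftrightarrow> lower k X Y"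
  by (auto simp: lower_def crossing_compl)

lemma essential_compl: "C \<in> essential k \<Longrightarrow> V - C \<in> essential k"
  by (auto simp: essential_def lower_compl_right bool_span_compl_iff)

text \<open>The order behind \<open>lower\<close> is lexicographic on pairs of natural numbers, so
  replacing inessential sets by simpler ones terminates.\<close>

lemma essential_generate:
  assumes "X \<subseteq> V" "finite (bd X)" "card (bd X) \<le> k"
  shows "X \<in> bool_span V (essential k)"
proof -
  let ?r = "inv_image (less_than <*lex*> less_than) (\<lambda>X. (card (bd X), card (crossing k X)))"
  have "wf ?r" by (intro wf_inv_image wf_lex_prod wf_less_than)
  then show ?thesis using assms
  proof (induction X rule: wf_induct_rule)
    case (less X)
    show ?case
    proof (cases "X \<in> essential k")
      case False
      then have "X \<in> bool_span V {Y. lower k Y X}" using less.prems by (auto simp: essential_def)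
      moreover have "{Y. lower k Y X} \<subseteq> bool_span V (essential k)"
        using less.IH less.prems by (auto simp: lower_def)
      ultimately show ?thesis using bool_span_subsetI by blast
    qed (auto intro: bool_span.gen)
  qed
qed

text \<open>The boundary edges of a disconnected set are divided between a component and the rest,
  and neither share is empty. Both parts then have a smaller boundary, and \<open>C\<close> is their
  union.\<close>

lemma essential_conn:
  assumes "C \<in> essential k"
  shows "conn C"
proof (rule ccontr)
  assume "\<not> conn C"
  then obtain x y where xy: "x \<in> C" "y \<in> C" "(x, y) \<notin> (R \<inter> C \<times> C)\<^sup>*" by (auto simp: conn_def)
  have C: "C \<subseteq> V" "finite (bd C)" using assms by (auto simp: essential_def)
  define C1 where "C1 = {z \<in> C. (x, z) \<in> (R \<inter> C \<times> C)\<^sup>*}"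
  define C2 where "C2 = C - C1"
  have closed: "(u \<in> C1) = (v \<in> C1)" if "(u, v) \<in> R" "u \<in> C" "v \<in> C" for u v
    using that arcs_symD[OF that(1)] unfolding C1_def
    by (auto intro: rtrancl_into_rtrancl)
  have sub: "bd C1 \<union> bd C2 \<subseteq> bd C" "bd C1 \<inter> bd C2 = {}"
    using closed unfolding bd_def C2_def by (auto simp: C1_def)
  have "x \<in> C1" "y \<in> C2" using xy by (auto simp: C1_def C2_def)
  moreover have "C1 \<subseteq> C" "C2 \<subseteq> C" "x \<notin> C2" "y \<notin> C1" using xy \<open>x \<in> C1\<close> \<open>y \<in> C2\<close> unfolding C2_def by (auto simp: C1_def)
  ultimately have ne: "bd C1 \<noteq> {}" "bd C2 \<noteq> {}" using C(1) xy(1,2) bd_nonempty[of C1] bd_nonempty[of C2] by blast+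
  have "bd C1 \<subset> bd C" "bd C2 \<subset> bd C" using sub ne by auto
  then have "lower k C1 C" "lower k C2 C"
    using C by (auto simp: lower_def C1_def C2_def intro: psubset_card_mono finite_subset)
  then have "C1 \<union> C2 \<in> bool_span V {X. lower k X C}"
    by (auto intro: bool_span.intros)
  moreover have "C1 \<union> C2 = C" by (auto simp: C1_def C2_def)
  ultimately show False using assms by (auto simp: essential_def)
qed

lemma essential_cuts: "essential k \<subseteq> cuts k"
proof
  fix C assume C: "C \<in> essential k"
  have "V \<in> bool_span V S" for S using bool_span.compl[OF bool_span.empty, of V S] by simp
  then have "C \<noteq> {}" "C \<noteq> V" using C bool_span.empty by (auto simp: essential_def)
  moreover have "conn C" "conn (V - C)" using C essential_conn essential_compl by blast+
  ultimately show "C \<in> cuts k"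
    using C by (simp add: cuts_def essential_def)
qed

text \<open>Boundary sizes and crossing numbers are both submodular on opposite corners, and the
  crossing numbers strictly: \<open>C\<close> crosses \<open>D\<close>, but neither
  \<open>C \<inter> D\<close> nor \<open>C \<union> D\<close>. What one corner fails to gain against
  \<open>D\<close>, the other therefore gains against \<open>C\<close>.\<close>

lemma lower_corner_aux:
  assumes "C \<in> cuts k" "D \<in> cuts k" "cross C D"
    and "\<not> lower k (C \<inter> D) D"
  shows "lower k (C \<union> D) C"
proof -
  have fin: "finite (bd C)" "finite (bd D)" "C \<subseteq> V" "D \<subseteq> V" using assms by (auto simp: cuts_def)
  have w: "card (bd (C \<inter> D)) + card (bd (C \<union> D)) \<le> card (bd C) + card (bd D)"
    using card_add_le[OF fin(1,2) bd_Un_Int] .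
  have fin': "finite (bd (C \<inter> D))" "finite (bd (C \<union> D))"
    using bd_Un_Int(1)[of C D] fin by (auto intro: finite_subset)
  have nc: "\<not> cross C (C \<inter> D)" "\<not> cross C (C \<union> D)" by (auto simp: cross_def)
  have x: "V - (C \<union> D) \<noteq> {}" "C \<inter> D \<noteq> {}" using assms(3) by (auto simp: cross_def)
  have subV: "F \<subseteq> V" if "F \<in> cuts k" for F using that by (auto simp: cuts_def)
  \<comment> \<open>Leaving out \<open>C\<close> on the right is possible because \<open>C\<close>
    crosses neither corner; this is the source of strictness.\<close>
  have "card (crossing k (C \<inter> D)) + card (crossing k (C \<union> D)) \<le> card (crossing k C) + card (crossing k D - {C})"
  proof (rule card_add_le)
    show "crossing k (C \<inter> D) \<union> crossing k (C \<union> D) \<subseteq> crossing k C \<union> (crossing k D - {C})"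
      using cross_inter[OF subV x(1)] cross_union[OF subV x(2)] nc unfolding crossing_def by blast
    show "crossing k (C \<inter> D) \<inter> crossing k (C \<union> D) \<subseteq> crossing k C \<inter> (crossing k D - {C})"
      using cross_inter_union nc unfolding crossing_def by blast
  qed (use fin finite_crossing in auto)
  moreover have "card (crossing k D - {C}) < card (crossing k D)"
    using assms fin finite_crossing by (intro psubset_card_mono) (auto simp: crossing_def)
  ultimately show ?thesis using w assms(4) fin fin' by (auto simp: lower_def)
qed

lemma cross_sym: "cross F X \<Longrightarrow> cross X F"
  by (auto simp: cross_def)

lemma lower_trans: "lower k X Y \<Longrightarrow> \<not> lower k Z Y \<Longrightarrow> finite (bd Z) \<Longrightarrow> Z \<subseteq> V \<Longrightarrow> lower k X Z"
  by (auto simp: lower_def)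

text \<open>
  For crossing \<open>C\<close> and \<open>D\<close>, two opposite corners together have smaller complexity than \<open>C\<close> and \<open>D\<close>
  together. Hence two neighbouring corners are both simpler than the one of \<open>C\<close>, \<open>D\<close> that is
  their union or the complement of their union.
\<close>

lemma essential_nested_aux:
  assumes "C \<in> essential k" "D \<in> essential k" "cross C D" "\<not> lower k C D"
  shows False
proof -
  have C: "C \<in> cuts k" "V - C \<in> cuts k" "C \<subseteq> V" "finite (bd C)"
    and D: "D \<in> cuts k" "V - D \<in> cuts k" "D \<subseteq> V" "finite (bd D)"
    using assms essential_cuts cut_compl by (auto simp: essential_def)
  define a b c d where abcd: "a = C \<inter> D" "b = C - D" "c = D - C" "d = V - (C \<union> D)"
  have V: "a \<subseteq> V" "b \<subseteq> V" "c \<subseteq> V" "d \<subseteq> V" using C D by (auto simp: abcd)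
  \<comment> \<open>\<open>C\<close> is not simpler than \<open>D\<close>, so whatever is simpler
    than \<open>D\<close> is simpler than \<open>C\<close>.\<close>
  have l: "lower k x C" if "lower k x D" for x
    using lower_trans[OF that assms(4)] C by blast
  have ad: "lower k a D \<or> lower k d C" "lower k a C \<or> lower k d D"
  proof -
    have eq: "d = V - (C \<union> D)" "a = D \<inter> C" "d = V - (D \<union> C)" by (auto simp: abcd)
    have "lower k d C \<longleftrightarrow> lower k (C \<union> D) C" "lower k d D \<longleftrightarrow> lower k (D \<union> C) D"
      unfolding eq using C D lower_compl_left by (auto simp: Un_commute)
    then show "lower k a D \<or> lower k d C" "lower k a C \<or> lower k d D"
      using lower_corner_aux[OF C(1) D(1) assms(3)] lower_corner_aux[OF D(1) C(1) cross_sym[OF assms(3)]]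
      unfolding abcd by (auto simp: Int_commute)
  qed
  have bc: "lower k b D \<or> lower k c C" "lower k b C \<or> lower k c D"
  proof -
    have eq: "b = C \<inter> (V - D)" "c = V - (C \<union> (V - D))" using C D by (auto simp: abcd)
    have x: "cross C (V - D)" using C D assms(3) cross_compl by blast
    have "lower k c Z \<longleftrightarrow> lower k (C \<union> (V - D)) Z" for Z
      unfolding eq using C D lower_compl_left by auto
    then show "lower k b D \<or> lower k c C" "lower k b C \<or> lower k c D"
      using lower_corner_aux[OF C(1) D(2) x] lower_corner_aux[OF D(2) C(1) cross_sym[OF x]] D
      unfolding eq(1) by (auto simp: Int_commute Un_commute lower_compl_right)
  qed
  have "\<not> (lower k x Z \<and> lower k y Z)" if "Z \<in> essential k" "x \<union> y = Z \<or> V - (x \<union> y) = Z" for x y Z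
    using that bool_span.union[OF bool_span.gen bool_span.gen, of x "{X. lower k X Z}" y V]
    by (auto simp: essential_def dest: bool_span.compl)
  moreover have "a \<union> b = C" "V - (c \<union> d) = C" "a \<union> c = D" "V - (b \<union> d) = D"
    using C D by (auto simp: abcd)
  ultimately have "\<not> (lower k a C \<and> lower k b C)" "\<not> (lower k c C \<and> lower k d C)"
    "\<not> (lower k a D \<and> lower k c D)" "\<not> (lower k b D \<and> lower k d D)"
    using assms(1,2) by blast+
  \<comment> \<open>If \<open>a\<close> is simpler than \<open>C\<close>, then \<open>b\<close> is
    not, so \<open>c\<close> is simpler than both \<open>C\<close> and \<open>D\<close>; this rules
    out \<open>d\<close>, hence \<open>a\<close> is simpler than \<open>D\<close> as well, against
    \<open>a \<union> c = D\<close>. Otherwise \<open>d\<close> is simpler than both,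
    \<open>c\<close> is ruled out, and \<open>b\<close> and \<open>d\<close> are simpler than
    \<open>D\<close>.\<close>
  then show False using ad bc l by blast
qed

lemma essential_nested:
  assumes "C \<in> essential k" "D \<in> essential k"
  shows "\<not> cross C D"
proof
  assume x: "cross C D"
  show False
  proof (cases "lower k C D")
    case True
    then have "\<not> lower k D C" by (auto simp: lower_def)
    then show False using essential_nested_aux[OF assms(2,1) cross_sym[OF x]] by simp
  next
    case False
    then show False using essential_nested_aux[OF assms x] by simp
  qed
qed

end

section \<open>The tree of a nested family of cuts\<close>

fun nonbacktracking :: "'a list \<Rightarrow> bool" where
  "nonbacktracking (x # y # z # xs) \<longleftrightarrow> x \<noteq> z \<and> nonbacktracking (y # z # xs)"
| "nonbacktracking _ \<longleftrightarrow> True"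

locale nested_cuts = conn_graph V R
  for V :: "'v set" and R +
  fixes k :: nat and E :: "'v set set"
  assumes E_cuts: "E \<subseteq> cuts k"
    and E_compl: "C \<in> E \<Longrightarrow> V - C \<in> E"
    and E_nested: "\<lbrakk>C \<in> E; D \<in> E\<rbrakk> \<Longrightarrow> \<not> cross C D"
begin

text \<open>A node is described by the side of each cut on which it lies. An orientation that
  violates the finiteness clause differs from every node in infinitely many cuts, so it could not be
  joined to the rest of the tree; such orientations converge to ends of the graph.\<close>

definition orientation :: "'v set set \<Rightarrow> bool" where
  "orientation \<sigma> \<longleftrightarrow> \<sigma> \<subseteq> E \<and> (\<forall>C \<in> E. C \<in> \<sigma> \<longleftrightarrow> V - C \<notin> \<sigma>) \<and>
     (\<forall>C \<in> \<sigma>. \<forall>D \<in> E. C \<subseteq> D \<longrightarrow> D \<in> \<sigma>) \<and> (\<forall>v \<in> V. finite {C \<in> \<sigma>. v \<notin> C})"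

text \<open>The node on the \<open>C\<close> side of the tree edge given by \<open>C\<close>; the
  strict inclusion keeps \<open>V - C\<close> itself out.\<close>

definition tip :: "'v set \<Rightarrow> 'v set set" where
  "tip C = {D \<in> E. C \<subseteq> D \<or> V - C \<subset> D}"

text \<open>The midpoint of the tree edge, an unordered pair so that \<open>C\<close> and
  \<open>V - C\<close> name the same node.\<close>

definition side :: "'v set \<Rightarrow> 'v set set" where
  "side C = {C, V - C}"

definition tree_nodes :: "'v set set set" where
  "tree_nodes = Collect orientation \<union> side ` E"

definition tree_arcs :: "('v set set \<times> 'v set set) set" where
  "tree_arcs = (\<lambda>C. (tip C, side C)) ` E"

abbreviation tree_adj :: "('v set set \<times> 'v set set) set" where
  "tree_adj \<equiv> tree_arcs \<union> tree_arcs\<inverse>"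

section \<open>Orientations and their minimal cuts\<close>

lemma E_sub: "C \<in> E \<Longrightarrow> C \<subseteq> V" and E_ne: "C \<in> E \<Longrightarrow> C \<noteq> {}" "C \<in> E \<Longrightarrow> C \<noteq> V"
  using E_cuts by (auto simp: cuts_def)

lemma E_double: "C \<in> E \<Longrightarrow> V - (V - C) = C"
  using E_sub by (simp add: double_diff)

lemma nested_cases:
  assumes "C \<in> E" "D \<in> E"
  shows "C \<subseteq> D \<or> C \<subseteq> V - D \<or> V - C \<subseteq> D \<or> D \<subseteq> C"
  using E_nested[OF assms] E_sub[OF assms(1)] E_sub[OF assms(2)] unfolding cross_def by blast

lemma finite_E_separating: "finite S \<Longrightarrow> S \<subseteq> V \<Longrightarrow> finite {C \<in> E. separates C S}"
  using finite_cuts_separating[of S k] E_cuts by (auto elim: rev_finite_subset)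

lemma tip_self: "C \<in> E \<Longrightarrow> C \<in> tip C"
  by (simp add: tip_def)

lemma compl_notin_tip: "C \<in> E \<Longrightarrow> V - C \<notin> tip C"
  using E_ne E_sub unfolding tip_def by blast

lemma tip_minimal: "C \<in> E \<Longrightarrow> D \<in> tip C \<Longrightarrow> \<not> D \<subset> C"
  using E_ne E_sub unfolding tip_def by blast

lemma side_compl: "C \<in> E \<Longrightarrow> side (V - C) = side C"
  using E_double by (auto simp: side_def)

text \<open>The two ends of a tree edge disagree only about the cut of this edge.\<close>

lemma tip_compl: "C \<in> E \<Longrightarrow> tip (V - C) = insert (V - C) (tip C - {C})"
proof -
  assume C: "C \<in> E"
  have "C \<noteq> V - C" using E_ne(1)[OF C] by blast
  have "D \<in> tip (V - C) \<longleftrightarrow> D \<in> insert (V - C) (tip C - {C})" for D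
    using C E_compl[OF C] E_sub[OF C] E_ne(1)[OF C] E_ne(2)[OF C] unfolding tip_def mem_Collect_eq insert_iff Diff_iff E_double[OF C]
    by (cases "D = C"; cases "D = V - C") blast+
  then show ?thesis by blast
qed

text \<open>Nestedness decides which side of \<open>D\<close> is chosen. For the finiteness clause,
  a member avoiding \<open>v\<close> contains \<open>C\<close> or \<open>V - C\<close>, hence
  separates \<open>v\<close> from one of two fixed points.\<close>

lemma orientation_tip:
  assumes C: "C \<in> E"
  shows "orientation (tip C)"
  unfolding orientation_def
proof (intro conjI ballI impI)
  show "tip C \<subseteq> E" by (auto simp: tip_def)
next
  fix D assume D: "D \<in> E"
  have 1: "V - D \<in> tip C \<longleftrightarrow> C \<subseteq> V - D \<or> D \<subset> C"
    using E_compl[OF D] E_sub[OF C] E_sub[OF D] unfolding tip_def by blast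
  have 2: "D \<in> tip C \<longleftrightarrow> C \<subseteq> D \<or> V - C \<subset> D" using D by (simp add: tip_def)
  have *: "C \<subseteq> D \<or> C \<subseteq> V - D \<or> V - C \<subset> D \<or> D \<subset> C"
    using nested_cases[OF C D] E_sub[OF C] by blast
  have "\<not> (C \<subseteq> D \<and> C \<subseteq> V - D)" "\<not> (V - C \<subset> D \<and> C \<subseteq> V - D)" "\<not> (V - C \<subset> D \<and> D \<subset> C)"
    using E_ne[OF C] E_sub[OF C] E_sub[OF D] by blast+
  then show "D \<in> tip C \<longleftrightarrow> V - D \<notin> tip C"
    unfolding 1 2 using * by blast
next
  fix A D assume "A \<in> tip C" "D \<in> E" "A \<subseteq> D"
  then show "D \<in> tip C" unfolding tip_def by blast
next
  fix v assume v: "v \<in> V"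
  obtain a b where ab: "a \<in> C" "b \<in> V - C" using E_ne[OF C] E_sub[OF C] by blast
  have "{D \<in> tip C. v \<notin> D} \<subseteq> {D \<in> E. separates D {v, a}} \<union> {D \<in> E. separates D {v, b}}"
    using ab unfolding tip_def separates_def by blast
  moreover have "finite {D \<in> E. separates D {v, x}}" if "x \<in> V" for x
    using v that by (intro finite_E_separating) auto
  ultimately show "finite {D \<in> tip C. v \<notin> D}"
    using ab E_sub[OF C] by (meson DiffD1 finite_UnI finite_subset subsetD)
qed

lemma orientationD:
  assumes "orientation \<sigma>"
  shows "C \<in> \<sigma> \<Longrightarrow> C \<in> E" "C \<in> E \<Longrightarrow> C \<in> \<sigma> \<longleftrightarrow> V - C \<notin> \<sigma>"
    "C \<in> \<sigma> \<Longrightarrow> D \<in> E \<Longrightarrow> C \<subseteq> D \<Longrightarrow> D \<in> \<sigma>" "v \<in> V \<Longrightarrow> finite {C \<in> \<sigma>. v \<notin> C}"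
  using assms unfolding orientation_def by blast+

lemma orientation_subset_eq:
  assumes "orientation \<sigma>" "orientation \<tau>" "\<sigma> \<subseteq> \<tau>"
  shows "\<sigma> = \<tau>"
  using assms orientationD(1,2)[OF assms(1)] orientationD(1,2)[OF assms(2)] by blast

text \<open>Upward closure forces the sets above \<open>C\<close>. If \<open>V - C\<close> lies
  properly inside \<open>D\<close>, then \<open>V - D\<close> lies properly inside \<open>C\<close>,
  and minimality of \<open>C\<close> forbids choosing it.\<close>

lemma orientation_eq_tip:
  assumes \<sigma>: "orientation \<sigma>" and C: "C \<in> \<sigma>" "\<And>D. D \<in> \<sigma> \<Longrightarrow> \<not> D \<subset> C"
  shows "\<sigma> = tip C"
proof -
  have CE: "C \<in> E" using orientationD(1)[OF \<sigma> C(1)] .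
  have "tip C \<subseteq> \<sigma>"
  proof
    fix D assume D: "D \<in> tip C"
    then have DE: "D \<in> E" by (simp add: tip_def)
    consider "C \<subseteq> D" | "V - C \<subset> D" using D by (auto simp: tip_def)
    then show "D \<in> \<sigma>"
    proof cases
      case 1
      then show ?thesis using orientationD(3)[OF \<sigma> C(1) DE] by simp
    next
      case 2
      then have "V - D \<subset> C" using E_sub[OF CE] E_sub[OF DE] by blast
      then show ?thesis using C(2) orientationD(2)[OF \<sigma> DE] by blast
    qed
  qed
  then show ?thesis using orientation_subset_eq[OF orientation_tip[OF CE] \<sigma>] by simp
qed

text \<open>One vertex \<open>v\<close> suffices: a cut in the difference either misses
  \<open>v\<close> or has a complement in \<open>\<tau>\<close> that misses
  \<open>v\<close>.\<close>

lemma finite_orientation_diff: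
  assumes "orientation \<sigma>" "orientation \<tau>"
  shows "finite (\<sigma> - \<tau>)"
proof -
  obtain v where v: "v \<in> V" using nonempty by blast
  have "\<sigma> - \<tau> \<subseteq> {C \<in> \<sigma>. v \<notin> C} \<union> (\<lambda>D. V - D) ` {D \<in> \<tau>. v \<notin> D}"
  proof
    fix C assume C: "C \<in> \<sigma> - \<tau>"
    then have CE: "C \<in> E" using orientationD(1)[OF assms(1)] by blast
    then have "V - C \<in> \<tau>" using C orientationD(2)[OF assms(2)] by blast
    then show "C \<in> {C \<in> \<sigma>. v \<notin> C} \<union> (\<lambda>D. V - D) ` {D \<in> \<tau>. v \<notin> D}"
      using C E_double[OF CE, symmetric] by blast
  qed
  then show ?thesis using orientationD(4)[OF assms(1) v] orientationD(4)[OF assms(2) v]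
    by (meson finite_UnI finite_imageI finite_subset)
qed

text \<open>A minimal element of \<open>\<sigma> - \<tau>\<close> below \<open>C\<close> is minimal
  in all of \<open>\<sigma>\<close>: a smaller member of \<open>\<sigma>\<close> would lie in
  \<open>\<tau>\<close>, and then so would the element, by upward closure. It is a tree edge at
  \<open>\<sigma>\<close> leading towards \<open>\<tau>\<close>.\<close>

lemma exists_flippable:
  assumes \<sigma>: "orientation \<sigma>" and \<tau>: "orientation \<tau>" and "C \<in> \<sigma>" "C \<notin> \<tau>"
  shows "\<exists>D \<in> \<sigma> - \<tau>. D \<subseteq> C \<and> \<sigma> = tip D"
proof -
  have "finite {D \<in> \<sigma> - \<tau>. D \<subseteq> C}" "C \<in> {D \<in> \<sigma> - \<tau>. D \<subseteq> C}"
    using finite_subset[OF _ finite_orientation_diff[OF \<sigma> \<tau>], of "{D \<in> \<sigma> - \<tau>. D \<subseteq> C}"] assms by auto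
  then obtain D where D: "D \<in> \<sigma> - \<tau>" "D \<subseteq> C" "\<And>A. A \<in> \<sigma> - \<tau> \<Longrightarrow> A \<subseteq> C \<Longrightarrow> A \<subseteq> D \<Longrightarrow> A = D"
    by (metis (no_types, lifting) finite_has_minimal empty_iff mem_Collect_eq)
  have "\<not> A \<subset> D" if "A \<in> \<sigma>" for A
  proof
    assume "A \<subset> D"
    then have "A \<in> \<tau>" using D that by blast
    then show False using orientationD(3)[OF \<tau>, of A D] orientationD(1)[OF \<sigma>, of D] D(1) \<open>A \<subset> D\<close> by blast
  qed
  then show ?thesis using orientation_eq_tip[OF \<sigma>, of D] D by blast
qed

lemma tree_arcI: "C \<in> E \<Longrightarrow> (tip C, side C) \<in> tree_arcs"
  by (simp add: tree_arcs_def)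

lemma tip_step: "C \<in> E \<Longrightarrow> (tip C, tip (V - C)) \<in> tree_adj\<^sup>*"
  using tree_arcI[of C] tree_arcI[OF E_compl, of C] side_compl[of C]
  by (metis UnI1 UnI2 converse.intros converse_rtrancl_into_rtrancl r_into_rtrancl)

text \<open>Flipping a minimal disagreement crosses one tree edge and lowers the finite number of
  disagreements.\<close>

lemma orientations_connected:
  assumes "orientation \<sigma>" "orientation \<tau>"
  shows "(\<sigma>, \<tau>) \<in> tree_adj\<^sup>*"
  using assms
proof (induction "card (\<sigma> - \<tau>)" arbitrary: \<sigma> rule: less_induct)
  case less
  show ?case
  proof (cases "\<sigma> \<subseteq> \<tau>")
    case True
    then show ?thesis using orientation_subset_eq less.prems by blast
  next
    case False
    then obtain C where C: "C \<in> \<sigma> - \<tau>" "\<sigma> = tip C" using exists_flippable[OF less.prems] by blast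
    have CE: "C \<in> E" using C(1) orientationD(1)[OF less.prems(1)] by blast
    have "V - C \<in> \<tau>" using C(1) orientationD(2)[OF less.prems(2) CE] by blast
    then have "tip (V - C) - \<tau> = (\<sigma> - \<tau>) - {C}" using tip_compl[OF CE] C(2) by auto
    then have "tip (V - C) - \<tau> \<subset> \<sigma> - \<tau>" using C(1) by auto
    then have "card (tip (V - C) - \<tau>) < card (\<sigma> - \<tau>)"
      using finite_orientation_diff[OF less.prems] by (intro psubset_card_mono)
    then have "(tip (V - C), \<tau>) \<in> tree_adj\<^sup>*"
      using less.hyps orientation_tip[OF E_compl[OF CE]] less.prems(2) by blast
    then show ?thesis using tip_step[OF CE] C(2) by (metis rtrancl_trans)
  qed
qed

lemma tree_connected:
  assumes "x \<in> tree_nodes" "y \<in> tree_nodes"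
  shows "(x, y) \<in> tree_adj\<^sup>*"
proof -
  have *: "\<exists>\<sigma>. orientation \<sigma> \<and> (x, \<sigma>) \<in> tree_adj\<^sup>* \<and> (\<sigma>, x) \<in> tree_adj\<^sup>*" if x: "x \<in> tree_nodes" for x
  proof (cases "orientation x")
    case False
    then obtain C where "C \<in> E" "x = side C" using x by (auto simp: tree_nodes_def)
    then show ?thesis using orientation_tip[of C] tree_arcI[of C] by blast
  qed auto
  obtain \<sigma> \<tau> where "orientation \<sigma>" "(x, \<sigma>) \<in> tree_adj\<^sup>*" "orientation \<tau>" "(\<tau>, y) \<in> tree_adj\<^sup>*"
    using *[OF assms(1)] *[OF assms(2)] by blast
  then show ?thesis using orientations_connected by (meson rtrancl_trans)
qed

section \<open>Walks in the tree\<close>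

lemma side_not_orientation: "C \<in> E \<Longrightarrow> \<not> orientation (side C)"
  using orientationD(2)[of "side C" C] by (auto simp: side_def)

lemma side_eqD: "side C = side D \<Longrightarrow> D = C \<or> D = V - C"
  by (auto simp: side_def doubleton_eq_iff)

lemma adj_side:
  assumes "(side C, y) \<in> tree_adj" "C \<in> E"
  shows "y = tip C \<or> y = tip (V - C)"
proof -
  obtain D where D: "D \<in> E" "(side C, y) = (tip D, side D) \<or> (side C, y) = (side D, tip D)"
    using assms by (auto simp: tree_arcs_def)
  moreover have "side C \<noteq> tip D" using orientation_tip[OF D(1)] side_not_orientation[OF assms(2)] by metis
  ultimately show ?thesis using side_eqD[of C D] by auto
qed

lemma adj_orientation:
  assumes "(\<sigma>, y) \<in> tree_adj" "orientation \<sigma>"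
  obtains D where "D \<in> E" "\<sigma> = tip D" "y = side D"
proof -
  obtain D where D: "D \<in> E" "(\<sigma>, y) = (tip D, side D) \<or> (\<sigma>, y) = (side D, tip D)"
    using assms by (auto simp: tree_arcs_def)
  then show thesis using side_not_orientation[of D] assms that by auto
qed

text \<open>Both \<open>D\<close> and \<open>V - C\<close> are minimal in the common orientation. Of
  the two ways in which \<open>D\<close> can belong to \<open>tip (V - C)\<close>, this leaves only
  \<open>C\<close> properly inside \<open>D\<close>: consecutive tree edges of a walk give
  increasing cuts.\<close>

lemma tip_eq_subset:
  assumes "C \<in> E" "D \<in> E" "tip D = tip (V - C)" "side D \<noteq> side C"
  shows "C \<subset> D"
proof -
  have "D \<in> tip (V - C)" using tip_self assms by metis
  then have "V - C \<subseteq> D \<or> C \<subset> D" using E_double[OF assms(1)] by (auto simp: tip_def)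
  moreover have "V - C \<in> tip D" using tip_self[OF E_compl] assms by metis
  then have "\<not> V - C \<subset> D" using tip_minimal[OF assms(2)] by blast
  moreover have "D \<noteq> V - C" using assms side_compl by metis
  ultimately show ?thesis by blast
qed

text \<open>A walk that never backtracks crosses a strictly monotone sequence of cuts.\<close>

lemma walk_monotone:
  assumes "C \<in> E" "successively (\<lambda>x y. (x, y) \<in> tree_adj) (tip C # side C # xs)"
    "nonbacktracking (tip C # side C # xs)"
  shows "(orientation (last (side C # xs)) \<and> V - C \<in> last (side C # xs)) \<or>
    (\<exists>D \<in> E. last (side C # xs) = side D \<and> C \<subseteq> D)"
  using assms
proof (induction "length xs" arbitrary: C xs rule: less_induct)
  case less
  show ?case
  proof (cases xs)
    case Nil
    then show ?thesis using less.prems by auto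
  next
    case (Cons y ys)
    have y: "y = tip (V - C)"
      using less.prems Cons adj_side[of C y] by auto
    have oy: "orientation y" using y orientation_tip[OF E_compl] less.prems by simp
    show ?thesis
    proof (cases ys)
      case Nil
      then show ?thesis using Cons y oy tip_self[OF E_compl] less.prems by auto
    next
      case (Cons z zs)
      have xs: "xs = y # z # zs" using Cons \<open>xs = y # ys\<close> by simp
      obtain D where D: "D \<in> E" "y = tip D" "z = side D"
        using less.prems(2) adj_orientation[OF _ oy, of z] xs by auto
      have CD: "C \<subset> D" using tip_eq_subset[OF less.prems(1) D(1)] y D less.prems(3) xs by auto
      have "(orientation (last (side D # zs)) \<and> V - D \<in> last (side D # zs)) \<or>
        (\<exists>A \<in> E. last (side D # zs) = side A \<and> D \<subseteq> A)"
        using less.hyps[of zs D] less.prems xs D by (cases zs) auto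
      moreover have "last (side C # xs) = last (side D # zs)" using xs D by simp
      moreover have "V - C \<in> \<sigma>" if "orientation \<sigma>" "V - D \<in> \<sigma>" for \<sigma>
        using orientationD(3)[OF that E_compl[OF less.prems(1)]] CD by blast
      ultimately show ?thesis using CD by (metis order_trans psubset_imp_subset)
    qed
  qed
qed

lemma tree_acyclic:
  assumes "successively (\<lambda>x y. (x, y) \<in> tree_adj) xs" "nonbacktracking xs" "length xs \<ge> 2"
  shows "hd xs \<noteq> last xs"
proof -
  obtain x y ys where xs: "xs = x # y # ys" using assms(3) by (metis Suc_le_length_iff numeral_2_eq_2)
  then have adj: "(x, y) \<in> tree_adj" using assms(1) by simp
  show ?thesis
  proof (cases "orientation x")
    case True
    then obtain C where C: "C \<in> E" "x = tip C" "y = side C" using adj_orientation[OF adj] by blast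
    then have "(orientation (last (side C # ys)) \<and> V - C \<in> last (side C # ys)) \<or>
      (\<exists>D \<in> E. last (side C # ys) = side D \<and> C \<subseteq> D)"
      using walk_monotone[of C ys] assms xs by simp
    then show ?thesis using C xs compl_notin_tip[OF C(1)] side_not_orientation True by auto
  next
    case False
    then obtain C where C: "C \<in> E" "x = side C" "y = tip C"
      using adj orientation_tip by (auto simp: tree_arcs_def)
    have oy: "orientation y" using C orientation_tip by simp
    show ?thesis
    proof (cases ys)
      case Nil
      then show ?thesis using xs False oy by auto
    next
      case (Cons z zs)
      then obtain D where D: "D \<in> E" "y = tip D" "z = side D"
        using assms(1) xs adj_orientation[OF _ oy, of z] by auto
      \<comment> \<open>For a walk that starts at a midpoint, monotonicity applies from its second
        node on; the edge it comes from is then read as \<open>V - C\<close>.\<close>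
      have "V - C \<subset> D"
        using tip_eq_subset[OF E_compl[OF C(1)] D(1)] C D E_double side_compl[OF C(1)] assms(2) xs Cons by auto
      moreover have "(orientation (last (side D # zs)) \<and> V - D \<in> last (side D # zs)) \<or>
        (\<exists>A \<in> E. last (side D # zs) = side A \<and> D \<subseteq> A)"
        using walk_monotone[OF D(1), of zs] assms xs Cons D by (cases zs) auto
      moreover have "last xs = last (side D # zs)" using xs Cons D by simp
      moreover have False if A: "A \<in> E" "side C = side A" "V - C \<subset> A" for A
        using side_eqD[OF A(2)] A(3) E_ne[OF C(1)] E_sub[OF C(1)] by blast
      moreover have "hd xs = side C" using xs C by simp
      ultimately show ?thesis using False C(2) psubset_subset_trans by metis
    qed
  qed
qed

end

section \<open>Group actions\<close>

locale proper_action = conn_graph V R + group_action G V \<phi>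
  for V :: "'v set" and R and G :: "('g, 'm) monoid_scheme" (structure) and \<phi> +
  fixes k :: nat
  assumes arcs_inv: "\<lbrakk>g \<in> carrier G; u \<in> V; v \<in> V\<rbrakk> \<Longrightarrow> (\<phi> g u, \<phi> g v) \<in> R \<longleftrightarrow> (u, v) \<in> R"
    and cofinite: "\<exists>P \<subseteq> V. finite P \<and> (\<forall>v \<in> V. \<exists>p \<in> P. \<exists>g \<in> carrier G. \<phi> g p = v)"
    and finite_stabilizer: "v \<in> V \<Longrightarrow> finite (stabilizer G \<phi> v)"
begin

sublocale group G
  using group_hom group_hom.axioms(1) by blast

abbreviation act_set :: "'g \<Rightarrow> 'v set \<Rightarrow> 'v set" where
  "act_set g C \<equiv> \<phi> g ` C"

abbreviation act_node :: "'g \<Rightarrow> 'v set set \<Rightarrow> 'v set set" where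
  "act_node g \<sigma> \<equiv> act_set g ` \<sigma>"

lemma act_closed: "g \<in> carrier G \<Longrightarrow> v \<in> V \<Longrightarrow> \<phi> g v \<in> V"
  using element_image by blast

lemma act_inv [simp]: "g \<in> carrier G \<Longrightarrow> v \<in> V \<Longrightarrow> \<phi> (inv g) (\<phi> g v) = v"
  "g \<in> carrier G \<Longrightarrow> v \<in> V \<Longrightarrow> \<phi> g (\<phi> (inv g) v) = v"
  using orbit_sym_aux[of g v] orbit_sym_aux[of "inv g" v] by auto

lemma act_eq_iff: "g \<in> carrier G \<Longrightarrow> u \<in> V \<Longrightarrow> v \<in> V \<Longrightarrow> \<phi> g u = \<phi> g v \<longleftrightarrow> u = v"
  using inj_prop by (meson inj_onD)

lemma act_set_sub: "g \<in> carrier G \<Longrightarrow> C \<subseteq> V \<Longrightarrow> act_set g C \<subseteq> V"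
  using act_closed by blast

lemma act_set_inv: "g \<in> carrier G \<Longrightarrow> C \<subseteq> V \<Longrightarrow> act_set (inv g) (act_set g C) = C"
  "g \<in> carrier G \<Longrightarrow> C \<subseteq> V \<Longrightarrow> act_set g (act_set (inv g) C) = C"
  by (force simp: image_iff subset_iff)+

lemma act_set_mult: "g \<in> carrier G \<Longrightarrow> h \<in> carrier G \<Longrightarrow> C \<subseteq> V \<Longrightarrow> act_set (g \<otimes> h) C = act_set g (act_set h C)"
  unfolding image_image by (rule image_cong) (auto simp: composition_rule)

lemma act_one: "v \<in> V \<Longrightarrow> \<phi> \<one> v = v"
  using id_eq_one by (metis restrict_apply')

lemma act_set_one: "C \<subseteq> V \<Longrightarrow> act_set \<one> C = C"
  using act_one by (force simp: image_iff subset_iff)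

lemma mem_act_set:
  assumes "g \<in> carrier G" "C \<subseteq> V" "v \<in> V"
  shows "v \<in> act_set g C \<longleftrightarrow> \<phi> (inv g) v \<in> C"
proof
  assume "v \<in> act_set g C"
  then show "\<phi> (inv g) v \<in> C" using assms by auto
next
  assume "\<phi> (inv g) v \<in> C"
  then have "\<phi> g (\<phi> (inv g) v) \<in> act_set g C" by blast
  then show "v \<in> act_set g C" using assms by simp
qed

lemma act_set_mono:
  assumes "g \<in> carrier G" "C \<subseteq> V" "D \<subseteq> V"
  shows "act_set g C \<subseteq> act_set g D \<longleftrightarrow> C \<subseteq> D"
  using assms image_mono[of "act_set g C" "act_set g D" "\<phi> (inv g)"] act_set_inv(1) by auto

lemma act_set_eq: "g \<in> carrier G \<Longrightarrow> C \<subseteq> V \<Longrightarrow> D \<subseteq> V \<Longrightarrow> act_set g C = act_set g D \<longleftrightarrow> C = D"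
  using inj_prop by (meson inj_on_image_eq_iff)

lemma act_set_V: "g \<in> carrier G \<Longrightarrow> act_set g V = V"
  using surj_prop by blast

lemma act_set_diff: "g \<in> carrier G \<Longrightarrow> C \<subseteq> V \<Longrightarrow> D \<subseteq> V \<Longrightarrow> act_set g (C - D) = act_set g C - act_set g D"
  using inj_on_image_set_diff[OF inj_prop, of g C D] by blast

lemma act_set_compl: "g \<in> carrier G \<Longrightarrow> C \<subseteq> V \<Longrightarrow> act_set g (V - C) = V - act_set g C"
  by (simp add: act_set_diff act_set_V)

lemma act_set_Int: "g \<in> carrier G \<Longrightarrow> C \<subseteq> V \<Longrightarrow> D \<subseteq> V \<Longrightarrow> act_set g (C \<inter> D) = act_set g C \<inter> act_set g D"
  using inj_on_image_Int[OF inj_prop, of g C D] by blast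

section \<open>Invariance of boundaries, crossings and essential cuts\<close>

lemma bd_act:
  assumes g: "g \<in> carrier G" and C: "C \<subseteq> V"
  shows "bd (act_set g C) = map_prod (\<phi> g) (\<phi> g) ` bd C"
proof (rule equalityI; rule subrelI)
  fix u v assume uv: "(u, v) \<in> bd (act_set g C)"
  then have V: "u \<in> V" "v \<in> V" using arcs_subset by (auto simp: bd_def)
  have "(\<phi> (inv g) u, \<phi> (inv g) v) \<in> bd C"
    using uv V g C mem_act_set arcs_inv[of "inv g" u v] by (auto simp: bd_def)
  moreover have "(u, v) = map_prod (\<phi> g) (\<phi> g) (\<phi> (inv g) u, \<phi> (inv g) v)" using V g by simp
  ultimately show "(u, v) \<in> map_prod (\<phi> g) (\<phi> g) ` bd C" by (rule rev_image_eqI)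
next
  fix u v assume "(u, v) \<in> map_prod (\<phi> g) (\<phi> g) ` bd C"
  then obtain x y where xy: "(x, y) \<in> bd C" "u = \<phi> g x" "v = \<phi> g y" by auto
  then have "x \<in> V" "y \<in> V" using arcs_subset by (auto simp: bd_def)
  then show "(u, v) \<in> bd (act_set g C)"
    using xy g C arcs_inv act_eq_iff by (auto simp: bd_def image_iff subset_iff)
qed

lemma inj_on_map_prod: "g \<in> carrier G \<Longrightarrow> inj_on (map_prod (\<phi> g) (\<phi> g)) (bd C)"
proof (rule inj_onI)
  fix x y assume "g \<in> carrier G" "x \<in> bd C" "y \<in> bd C" "map_prod (\<phi> g) (\<phi> g) x = map_prod (\<phi> g) (\<phi> g) y"
  moreover have "bd C \<subseteq> V \<times> V" using arcs_subset by (auto simp: bd_def)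
  ultimately show "x = y" using act_eq_iff[of g "fst x" "fst y"] act_eq_iff[of g "snd x" "snd y"]
    by (auto simp: map_prod_def split: prod.splits)
qed

lemma finite_bd_act: "g \<in> carrier G \<Longrightarrow> C \<subseteq> V \<Longrightarrow> finite (bd (act_set g C)) \<longleftrightarrow> finite (bd C)"
  using inj_on_map_prod by (simp add: bd_act finite_image_iff)

lemma card_bd_act: "g \<in> carrier G \<Longrightarrow> C \<subseteq> V \<Longrightarrow> card (bd (act_set g C)) = card (bd C)"
  using inj_on_map_prod by (simp add: bd_act card_image)

lemma ends_act: "g \<in> carrier G \<Longrightarrow> C \<subseteq> V \<Longrightarrow> ends (act_set g C) = act_set g (ends C)"
  by (simp add: ends_def bd_act image_Un image_image)

lemma conn_act:
  assumes g: "g \<in> carrier G" and A: "A \<subseteq> V" "conn A"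
  shows "conn (act_set g A)"
  unfolding conn_def
proof (intro ballI)
  fix x y assume "x \<in> act_set g A" "y \<in> act_set g A"
  then obtain a b where ab: "a \<in> A" "b \<in> A" "x = \<phi> g a" "y = \<phi> g b" by blast
  have "(a, b) \<in> (R \<inter> A \<times> A)\<^sup>*" using A ab by (auto simp: conn_def)
  then have "(\<phi> g a, \<phi> g b) \<in> (R \<inter> act_set g A \<times> act_set g A)\<^sup>*"
  proof (induction rule: rtrancl_induct)
    case (step u v)
    then have "(\<phi> g u, \<phi> g v) \<in> R \<inter> act_set g A \<times> act_set g A"
      using arcs_inv[OF g, of u v] A by auto
    then show ?case using step.IH by (simp add: rtrancl.rtrancl_into_rtrancl)
  qed simp
  then show "(x, y) \<in> (R \<inter> act_set g A \<times> act_set g A)\<^sup>*" using ab by simp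
qed

lemma cuts_act:
  assumes g: "g \<in> carrier G" and F: "F \<in> cuts k"
  shows "act_set g F \<in> cuts k"
proof -
  have FV: "F \<subseteq> V" using F by (simp add: cuts_def)
  then have "act_set g F \<noteq> V" using F act_set_eq[OF g FV order_refl] act_set_V[OF g] by (auto simp: cuts_def)
  moreover have "conn (V - act_set g F)"
    using conn_act[OF g, of "V - F"] F act_set_compl[OF g FV] by (auto simp: cuts_def)
  ultimately show ?thesis
    using F g FV conn_act act_set_sub finite_bd_act card_bd_act by (simp add: cuts_def)
qed

lemma cross_act:
  assumes g: "g \<in> carrier G" and F: "F \<subseteq> V" and X: "X \<subseteq> V"
  shows "cross (act_set g F) (act_set g X) \<longleftrightarrow> cross F X"
proof -
  have "act_set g F \<union> act_set g X = act_set g (F \<union> X)" by blast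
  then show ?thesis
    unfolding cross_def
    using act_set_Int[OF g F X] act_set_diff[OF g F X] act_set_diff[OF g X F] act_set_compl[OF g, of "F \<union> X"] F X
    by (metis Un_least image_is_empty)
qed

lemma card_crossing_act_le:
  assumes g: "g \<in> carrier G" and X: "X \<subseteq> V" "finite (bd X)"
  shows "card (crossing k X) \<le> card (crossing k (act_set g X))"
proof (rule card_inj_on_le)
  show "inj_on (act_set g) (crossing k X)"
    using act_set_eq[OF g] unfolding inj_on_def crossing_def cuts_def by blast
  show "act_set g ` crossing k X \<subseteq> crossing k (act_set g X)"
  proof
    fix Z assume "Z \<in> act_set g ` crossing k X"
    then obtain F where F: "F \<in> cuts k" "cross F X" "Z = act_set g F" by (auto simp: crossing_def)
    then have "F \<subseteq> V" by (simp add: cuts_def)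
    then show "Z \<in> crossing k (act_set g X)"
      using F cross_act[OF g _ X(1)] cuts_act[OF g] by (simp add: crossing_def)
  qed
  show "finite (crossing k (act_set g X))"
    using finite_crossing[OF act_set_sub[OF g X(1)]] finite_bd_act[OF g X(1)] X(2) by simp
qed

lemma card_crossing_act:
  assumes g: "g \<in> carrier G" and X: "X \<subseteq> V" "finite (bd X)"
  shows "card (crossing k (act_set g X)) = card (crossing k X)"
  using card_crossing_act_le[OF assms] card_crossing_act_le[of "inv g" "act_set g X"] assms
    act_set_sub act_set_inv finite_bd_act by (simp add: le_antisym)

lemma lower_act: "g \<in> carrier G \<Longrightarrow> Y \<subseteq> V \<Longrightarrow> finite (bd Y) \<Longrightarrow> lower k X Y \<Longrightarrow> lower k (act_set g X) (act_set g Y)"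
  using act_set_sub[of g X] by (auto simp: lower_def card_crossing_act card_bd_act finite_bd_act)

text \<open>The order of cuts refers only to invariant numbers, so an expression of the translate by
  simpler cuts could be moved back with \<open>inv g\<close>.\<close>

lemma essential_act:
  assumes g: "g \<in> carrier G" and C: "C \<in> essential k"
  shows "act_set g C \<in> essential k"
proof -
  have CV: "C \<subseteq> V" "finite (bd C)" using C by (auto simp: essential_def)
  have "C \<in> bool_span V {X. lower k X C}" if "act_set g C \<in> bool_span V {X. lower k X (act_set g C)}"
  proof -
    have "bij_betw (\<phi> (inv g)) V V" using bij_prop0[of "inv g"] g by (simp add: Bij_def)
    moreover have "X \<subseteq> V \<and> act_set (inv g) X \<in> {X. lower k X C}" if "X \<in> {X. lower k X (act_set g C)}" for X
      using lower_act[of "inv g" "act_set g C" X] that g CV act_set_sub act_set_inv finite_bd_act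
      by (auto simp: lower_def)
    ultimately have "act_set (inv g) (act_set g C) \<in> bool_span V {X. lower k X C}"
      using bool_span_image[OF _ _ that, of "\<phi> (inv g)"] by blast
    then show ?thesis using act_set_inv g CV by simp
  qed
  then show ?thesis using C g act_set_sub card_bd_act finite_bd_act by (auto simp: essential_def)
qed

section \<open>Finiteness of the action on cuts\<close>

sublocale nested_cuts V R k "essential k"
  by unfold_locales (use essential_cuts essential_compl essential_nested in auto)

text \<open>The elements sending \<open>u\<close> to a given vertex are empty or a coset of the
  finite stabilizer of \<open>u\<close>.\<close>

lemma finite_movers:
  assumes "u \<in> V" "finite S"
  shows "finite {g \<in> carrier G. \<phi> g u \<in> S}"
proof -
  have "finite {g \<in> carrier G. \<phi> g u = w}" for w
  proof (cases "\<exists>h \<in> carrier G. \<phi> h u = w")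
    case True
    then obtain h where h: "h \<in> carrier G" "\<phi> h u = w" by blast
    have "{g \<in> carrier G. \<phi> g u = w} \<subseteq> (\<lambda>s. h \<otimes> s) ` stabilizer G \<phi> u"
    proof
      fix g assume g: "g \<in> {g \<in> carrier G. \<phi> g u = w}"
      then have "inv h \<otimes> g \<in> stabilizer G \<phi> u"
        using h assms(1) act_inv(1)[OF h(1) assms(1)] by (auto simp: stabilizer_def composition_rule)
      moreover have "g = h \<otimes> (inv h \<otimes> g)" using g h by (simp add: m_assoc[symmetric])
      ultimately show "g \<in> (\<lambda>s. h \<otimes> s) ` stabilizer G \<phi> u" by blast
    qed
    then show ?thesis using finite_stabilizer[OF assms(1)] by (meson finite_imageI finite_subset)
  next
    case False
    then have "{g \<in> carrier G. \<phi> g u = w} = {}" by blast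
    then show ?thesis by (metis finite.emptyI)
  qed
  then have "finite (\<Union>w\<in>S. {g \<in> carrier G. \<phi> g u = w})" using assms(2) by blast
  then show ?thesis by (rule rev_finite_subset) blast
qed

text \<open>An element taking \<open>C\<close> to \<open>D\<close> sends a fixed endpoint of a
  boundary edge of \<open>C\<close> into the finite set \<open>ends D\<close>. For
  \<open>D = C\<close> and \<open>D = V - C\<close> this bounds the stabilizer of a
  midpoint.\<close>

lemma finite_cut_movers:
  assumes "C \<in> cuts k" "D \<in> cuts k"
  shows "finite {g \<in> carrier G. act_set g C = D}"
proof -
  have C: "C \<subseteq> V" "bd C \<noteq> {}" using assms bd_nonempty by (auto simp: cuts_def)
  then obtain u where u: "u \<in> ends C" using endsI(1) by fastforce
  have "{g \<in> carrier G. act_set g C = D} \<subseteq> {g \<in> carrier G. \<phi> g u \<in> ends D}"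
    using ends_act C(1) u by blast
  moreover have "finite (ends D)" using assms finite_ends by (auto simp: cuts_def)
  ultimately show ?thesis using finite_movers[of u "ends D"] u ends_subset by (meson finite_subset subsetD)
qed

text \<open>A boundary edge of \<open>C\<close> can be moved so that it starts in the finite set
  \<open>P\<close>; the moved cut then separates the finite set formed by \<open>P\<close> and its
  neighbours.\<close>

lemma cuts_cofinite:
  "\<exists>E0 \<subseteq> essential k. finite E0 \<and> (\<forall>C \<in> essential k. \<exists>D \<in> E0. \<exists>g \<in> carrier G. act_set g D = C)"
proof -
  obtain P where P: "P \<subseteq> V" "finite P" "\<And>v. v \<in> V \<Longrightarrow> \<exists>p \<in> P. \<exists>g \<in> carrier G. \<phi> g p = v"
    using cofinite by blast
  define S where "S = P \<union> R `` P"
  have S: "finite S" "S \<subseteq> V" using P finite_nbrs arcs_subset by (auto simp: S_def Image_def intro: finite_subset) 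
  have "\<exists>D \<in> {D \<in> essential k. separates D S}. \<exists>g \<in> carrier G. act_set g D = C" if C: "C \<in> essential k" for C
  proof -
    have CV: "C \<subseteq> V" "bd C \<noteq> {}" using C E_sub E_ne bd_nonempty by auto
    then obtain u v where uv: "(u, v) \<in> bd C" by auto
    then have V: "u \<in> V" "v \<in> V" using arcs_subset by (auto simp: bd_def)
    obtain p g where p: "p \<in> P" "g \<in> carrier G" "\<phi> g p = u" using P(3) V by blast
    have "(p, \<phi> (inv g) v) \<in> bd (act_set (inv g) C)"
      using bd_act[of "inv g" C] CV uv p P(1) by (force simp: subset_iff)
    then have "separates (act_set (inv g) C) S"
      using p(1) by (auto simp: separates_def S_def bd_def)
    then show ?thesis
      using C p essential_act[of "inv g" C] act_set_inv CV by (intro bexI[of _ "act_set (inv g) C"] bexI[of _ g]) auto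
  qed
  then show ?thesis using finite_E_separating[OF S]
    by (intro exI[of _ "{D \<in> essential k. separates D S}"]) blast
qed

end

section \<open>Components and balanced cuts\<close>

context conn_graph
begin

definition component :: "'v set \<Rightarrow> 'v \<Rightarrow> 'v set" where
  "component B x = {z \<in> B. (x, z) \<in> (R \<inter> B \<times> B)\<^sup>*}"

lemma restr_sym: "(x, y) \<in> (R \<inter> B \<times> B)\<^sup>* \<Longrightarrow> (y, x) \<in> (R \<inter> B \<times> B)\<^sup>*"
proof -
  have "sym (R \<inter> B \<times> B)" using arcs_symD by (auto simp: sym_def)
  then show "(x, y) \<in> (R \<inter> B \<times> B)\<^sup>* \<Longrightarrow> (y, x) \<in> (R \<inter> B \<times> B)\<^sup>*" by (meson sym_rtrancl symD)
qed

lemma component_subset: "component B x \<subseteq> B"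
  by (auto simp: component_def)

lemma component_self: "x \<in> B \<Longrightarrow> x \<in> component B x"
  by (simp add: component_def)

lemma component_eq: "y \<in> component B x \<Longrightarrow> component B y = component B x"
  unfolding component_def using restr_sym by (auto intro: rtrancl_trans)

lemma component_step: "y \<in> component B x \<Longrightarrow> (y, z) \<in> R \<Longrightarrow> z \<in> B \<Longrightarrow> z \<in> component B x"
  unfolding component_def by (auto intro: rtrancl_into_rtrancl)

lemma bd_component: "bd (component B x) \<subseteq> bd B"
  using component_step component_subset unfolding bd_def by blast

lemma conn_component:
  assumes "x \<in> B"
  shows "conn (component B x)"
proof -
  have *: "(x, y) \<in> (R \<inter> component B x \<times> component B x)\<^sup>*" if "(x, y) \<in> (R \<inter> B \<times> B)\<^sup>*" for y
    using that
  proof (induction rule: rtrancl_induct)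
    case (step y z)
    then have "y \<in> component B x" by (auto simp: component_def)
    then have "(y, z) \<in> R \<inter> component B x \<times> component B x"
      using step.hyps(2) component_step[of y B x z] by auto
    then show ?case using step.IH by (simp add: rtrancl.rtrancl_into_rtrancl)
  qed simp
  show ?thesis unfolding conn_def
  proof (intro ballI)
    fix y z assume "y \<in> component B x" "z \<in> component B x"
    then have "(x, y) \<in> (R \<inter> component B x \<times> component B x)\<^sup>*" "(x, z) \<in> (R \<inter> component B x \<times> component B x)\<^sup>*"
      using * by (auto simp: component_def)
    then show "(y, z) \<in> (R \<inter> component B x \<times> component B x)\<^sup>*" using restr_sym by (meson rtrancl_trans)
  qed
qed

text \<open>A vertex outside both \<open>A\<close> and the component has no neighbour in the
  component, so a path from it to \<open>A\<close> cannot enter the component before it reaches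
  \<open>A\<close>.\<close>

lemma conn_compl_component:
  assumes A: "A \<subseteq> V" "A \<noteq> {}" "conn A"
  shows "conn (V - component (V - A) x)"
proof -
  let ?Q = "component (V - A) x"
  let ?R = "R \<inter> (V - ?Q) \<times> (V - ?Q)"
  obtain a where a: "a \<in> A" using A by blast
  have AQ: "A \<subseteq> V - ?Q" using A component_subset by blast
  have "(z, a) \<in> R\<^sup>* \<Longrightarrow> z \<in> V - ?Q \<longrightarrow> (z, a) \<in> ?R\<^sup>*" for z
  proof (induction rule: converse_rtrancl_induct)
    case (step z y)
    show ?case
    proof
      assume z: "z \<in> V - ?Q"
      show "(z, a) \<in> ?R\<^sup>*"
      proof (cases "z \<in> A")
        case True
        then show ?thesis using A(3) a rtrancl_mono[of "R \<inter> A \<times> A" ?R] AQ by (auto simp: conn_def)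
      next
        case False
        have "y \<notin> ?Q"
        proof
          assume "y \<in> ?Q"
          then have "z \<in> ?Q" using component_step[of y "V - A" x z] arcs_symD[OF step(1)] z False by blast
          then show False using z by blast
        qed
        then have "(z, y) \<in> ?R" "(y, a) \<in> ?R\<^sup>*" using step z arcs_subset by auto
        then show ?thesis by (rule converse_rtrancl_into_rtrancl)
      qed
    qed
  qed simp
  then have "(z, a) \<in> ?R\<^sup>*" if "z \<in> V - ?Q" for z
    using arcs_conn[of z a] that a A(1) by blast
  then show ?thesis unfolding conn_def using restr_sym by (meson rtrancl_trans)
qed

text \<open>Pigeonhole: in a connected graph each component of \<open>B\<close> has a boundary edge,
  and distinct components use distinct edges of \<open>bd B\<close>. So at most
  \<open>card (bd B)\<close> components share the points of \<open>W\<close>.\<close>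

lemma large_component:
  assumes B: "B \<subseteq> V" "B \<noteq> V" "finite (bd B)" and W: "finite W" "W \<inter> B \<noteq> {}"
  shows "\<exists>x \<in> B. card (W \<inter> B) \<le> card (bd B) * card (W \<inter> component B x)"
proof (rule ccontr)
  assume not: "\<not> ?thesis"
  let ?S = "component B ` (W \<inter> B)"
  have ne: "bd c \<noteq> {}" if c: "c \<in> ?S" for c
  proof -
    obtain x where x: "x \<in> B" "c = component B x" using c by blast
    then have "c \<subseteq> V" "c \<noteq> {}" "c \<noteq> V" using component_subset[of B x] component_self[of x B] B by blast+
    then show ?thesis by (rule bd_nonempty)
  qed
  \<comment> \<open>The first endpoint of the selected edge determines the component, which makes
    the selection injective.\<close>
  define f where "f c = (SOME e. e \<in> bd c)" for c
  have f: "f c \<in> bd c" if "c \<in> ?S" for c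
    unfolding f_def by (rule someI_ex) (use ne[OF that] in blast)
  have f_eq: "component B (fst (f c)) = c" if "c \<in> ?S" for c
  proof -
    have "fst (f c) \<in> c" using f[OF that] by (auto simp: bd_def)
    then show ?thesis using that component_eq by blast
  qed
  have "card ?S \<le> card (bd B)"
  proof (rule card_inj_on_le[of f])
    show "inj_on f ?S" using f_eq by (metis inj_onI)
    show "f ` ?S \<subseteq> bd B"
    proof
      fix e assume "e \<in> f ` ?S"
      then obtain c where c: "c \<in> ?S" "e = f c" by blast
      then obtain x where "c = component B x" by blast
      then show "e \<in> bd B" using f[OF c(1)] c(2) bd_component[of B x] by blast
    qed
  qed (use B in auto)
  have m: "card (bd B) * card (W \<inter> c) \<le> card (W \<inter> B) - 1" if c: "c \<in> ?S" for c
  proof -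
    obtain x where "x \<in> B" "c = component B x" using c by blast
    then have "\<not> card (W \<inter> B) \<le> card (bd B) * card (W \<inter> c)" using not by blast
    then show ?thesis by linarith
  qed
  have "W \<inter> B \<subseteq> (\<Union>c\<in>?S. W \<inter> c)" using component_self by blast
  then have "card (W \<inter> B) \<le> card (\<Union>c\<in>?S. W \<inter> c)" using W by (intro card_mono) auto
  also have "\<dots> \<le> (\<Sum>c\<in>?S. card (W \<inter> c))" using W by (intro card_UN_le) auto
  finally have "card (bd B) * card (W \<inter> B) \<le> (\<Sum>c\<in>?S. card (bd B) * card (W \<inter> c))"
    by (simp add: sum_distrib_left[symmetric])
  also have "\<dots> \<le> card ?S * (card (W \<inter> B) - 1)"
    using sum_bounded_above[of ?S "\<lambda>c. card (bd B) * card (W \<inter> c)" "card (W \<inter> B) - 1"] m by simp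
  also have "\<dots> \<le> card (bd B) * (card (W \<inter> B) - 1)" using \<open>card ?S \<le> card (bd B)\<close> by simp
  finally have "card (bd B) = 0 \<or> card (W \<inter> B) = 0" by (cases "card (W \<inter> B)") auto
  moreover have "card (W \<inter> B) \<noteq> 0" using W by simp
  moreover have "bd B \<noteq> {}" using bd_nonempty B W(2) by blast
  then have "card (bd B) \<noteq> 0" using B by simp
  ultimately show False by simp
qed

text \<open>\<open>A1\<close> is a component of the complement of \<open>X\<close> rich in
  \<open>W\<close>. By balance its complement still holds half of \<open>W\<close>, and a rich
  component \<open>A2\<close> of that complement has a connected complement containing
  \<open>A1\<close>. In \<open>card W\<close>, the summand \<open>m\<close> pays for points lost in
  \<open>X\<close>, the factor \<open>2\<close> for the halving, and \<open>k\<close> for the number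
  of components.\<close>

lemma balanced_cut:
  assumes X: "X \<subseteq> V" "finite X" "card X \<le> m" "finite (bd X)" "card (bd X) \<le> k"
    and bal: "\<And>A. A \<subseteq> V - X \<Longrightarrow> conn A \<Longrightarrow> 2 * card (A \<inter> W) \<le> card W"
    and W: "finite W" "W \<subseteq> V" "card W = 2 * k * n + m + 1"
  shows "\<exists>A \<in> cuts k. n \<le> card (W \<inter> A) \<and> n \<le> card (W - A)"
proof -
  let ?B = "V - X"
  have "card (W \<inter> ?B) \<ge> card W - card (W \<inter> X)"
    using W X by (metis Int_Diff card_Diff_subset_Int finite_Int inf.absorb_iff1 order_refl)
  moreover have "card (W \<inter> X) \<le> card X" using X by (intro card_mono) auto
  ultimately have WB: "card (W \<inter> ?B) \<ge> 2 * k * n + 1" using X W by linarith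
  then have ne: "W \<inter> ?B \<noteq> {}" by auto
  \<comment> \<open>If \<open>X\<close> were empty, the connected set \<open>V\<close> would be
    admissible for \<open>A\<close> and contain all of \<open>W\<close>.\<close>
  have "X \<noteq> {}"
  proof
    assume "X = {}"
    then have "2 * card (V \<inter> W) \<le> card W" using bal[of V] arcs_conn arcs_subset
      by (auto simp: conn_def Int_absorb2)
    then show False using W by (simp add: Int_absorb1)
  qed
  then have "?B \<noteq> V" using X by blast
  then obtain x where x: "x \<in> ?B" "card (W \<inter> ?B) \<le> card (bd ?B) * card (W \<inter> component ?B x)"
    using large_component[of ?B W] X ne W by auto
  define A1 where "A1 = component ?B x"
  have A1: "A1 \<subseteq> V" "A1 \<noteq> {}" "conn A1" "A1 \<subseteq> V - X" "bd A1 \<subseteq> bd ?B"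
    unfolding A1_def using conn_component[OF x(1)] component_subset[of ?B x] component_self[OF x(1)] bd_component by blast+
  have fin1: "finite (bd A1)" "card (bd A1) \<le> k"
    using X finite_subset[OF A1(5)] card_mono[OF _ A1(5)] by auto
  have "2 * k * n + 1 \<le> card (bd ?B) * card (W \<inter> A1)" using WB x by (simp add: A1_def)
  also have "\<dots> \<le> k * card (W \<inter> A1)" using X by simp
  finally have 1: "k * n < k * card (W \<inter> A1)" by linarith
  have 2: "2 * card (W \<inter> A1) \<le> card W" using bal[OF A1(4,3)] by (simp add: Int_commute)
  have "W \<inter> (V - A1) = W - A1" using W by blast
  then have "card (W \<inter> (V - A1)) + card (W \<inter> A1) = card W"
    using W card_Int_Diff[of W A1] by simp
  then have 3: "2 * k * n + 1 \<le> 2 * card (W \<inter> (V - A1))" using 2 W by linarith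
  then have "W \<inter> (V - A1) \<noteq> {}" by auto
  then obtain y where y: "y \<in> V - A1" "card (W \<inter> (V - A1)) \<le> card (bd (V - A1)) * card (W \<inter> component (V - A1) y)"
    using large_component[of "V - A1" W] A1 fin1 W by auto
  define A2 where "A2 = component (V - A1) y"
  have A2: "A2 \<subseteq> V - A1" "A2 \<noteq> {}" "conn A2" "conn (V - A2)" "bd A2 \<subseteq> bd (V - A1)"
    unfolding A2_def using conn_component[OF y(1)] component_subset component_self[OF y(1)] bd_component
      conn_compl_component[OF A1(1-3)] by blast+
  have fin2: "finite (bd A2)" "card (bd A2) \<le> k"
    using A2(5) fin1 finite_subset[OF A2(5)] card_mono[OF _ A2(5)] by auto
  have "card (W \<inter> (V - A1)) \<le> k * card (W \<inter> A2)"
    using y(2) fin1 unfolding A2_def[symmetric] by (metis card_bd_compl le_trans mult_le_mono1)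
  then have 4: "k * n < k * card (W \<inter> A2)" using 3 by linarith
  have "card (W \<inter> A1) \<le> card (W - A2)" using A2 W A1 by (intro card_mono) auto
  then have "n \<le> card (W \<inter> A2)" "n \<le> card (W - A2)" using 1 4 by auto
  moreover have "A2 \<in> cuts k" using A2 A1 fin2 by (auto simp: cuts_def)
  ultimately show ?thesis by blast
qed

end

section \<open>Node stabilizers\<close>

context proper_action
begin

lemma essential_sub: "C \<in> essential k \<Longrightarrow> C \<subseteq> V"
  by (rule E_sub)

lemma act_node_inv:
  assumes g: "g \<in> carrier G" and \<sigma>: "\<sigma> \<subseteq> Pow V"
  shows "act_node (inv g) (act_node g \<sigma>) = \<sigma>" "act_node g (act_node (inv g) \<sigma>) = \<sigma>"
proof -
  have C: "C \<subseteq> V" if "C \<in> \<sigma>" for C using that \<sigma> by blast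
  have "(\<lambda>C. act_set (inv g) (act_set g C)) ` \<sigma> = (\<lambda>C. C) ` \<sigma>"
    using act_set_inv(1)[OF g C] by (intro image_cong HOL.refl)
  then show "act_node (inv g) (act_node g \<sigma>) = \<sigma>" unfolding image_image[of "act_set (inv g)"] by simp
  have "(\<lambda>C. act_set g (act_set (inv g) C)) ` \<sigma> = (\<lambda>C. C) ` \<sigma>"
    using act_set_inv(2)[OF g C] by (intro image_cong HOL.refl)
  then show "act_node g (act_node (inv g) \<sigma>) = \<sigma>" unfolding image_image[of "act_set g"] by simp
qed

lemma act_node_mult:
  assumes "g \<in> carrier G" "h \<in> carrier G" and \<sigma>: "\<sigma> \<subseteq> Pow V"
  shows "act_node (g \<otimes> h) \<sigma> = act_node g (act_node h \<sigma>)"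
proof -
  have C: "C \<subseteq> V" if "C \<in> \<sigma>" for C using that \<sigma> by blast
  have "act_set (g \<otimes> h) ` \<sigma> = (\<lambda>C. act_set g (act_set h C)) ` \<sigma>"
    by (rule image_cong[OF HOL.refl]) (rule act_set_mult[OF assms(1,2) C])
  then show ?thesis unfolding image_image[of "act_set g"] .
qed

lemma act_node_one:
  assumes \<sigma>: "\<sigma> \<subseteq> Pow V"
  shows "act_node \<one> \<sigma> = \<sigma>"
proof -
  have "act_set \<one> C = C" if "C \<in> \<sigma>" for C using act_set_one[of C] that \<sigma> by auto
  then have "act_set \<one> ` \<sigma> = (\<lambda>C. C) ` \<sigma>" by (rule image_cong[OF HOL.refl])
  then show ?thesis by simp
qed

lemma orientation_Pow: "orientation \<sigma> \<Longrightarrow> \<sigma> \<subseteq> Pow V"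
  using orientationD(1) essential_sub by blast

lemma mem_act_node:
  assumes "g \<in> carrier G" "\<sigma> \<subseteq> Pow V" "C \<subseteq> V"
  shows "C \<in> act_node g \<sigma> \<longleftrightarrow> act_set (inv g) C \<in> \<sigma>"
proof
  assume "C \<in> act_node g \<sigma>"
  then show "act_set (inv g) C \<in> \<sigma>" using assms act_set_inv(1) by auto
next
  assume "act_set (inv g) C \<in> \<sigma>"
  then have "act_set g (act_set (inv g) C) \<in> act_node g \<sigma>" by blast
  then show "C \<in> act_node g \<sigma>" using assms act_set_inv(2) by simp
qed

lemma orientation_act:
  assumes g: "g \<in> carrier G" and \<sigma>: "orientation \<sigma>"
  shows "orientation (act_node g \<sigma>)"
  unfolding orientation_def
proof (intro conjI ballI impI)
  show "act_node g \<sigma> \<subseteq> essential k" using orientationD(1)[OF \<sigma>] essential_act[OF g] by blast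
next
  fix C assume C: "C \<in> essential k"
  have "act_set (inv g) C \<in> essential k" using essential_act[of "inv g"] g C by simp
  then show "C \<in> act_node g \<sigma> \<longleftrightarrow> V - C \<notin> act_node g \<sigma>"
    using orientationD(2)[OF \<sigma>] mem_act_node[OF g orientation_Pow[OF \<sigma>]] essential_sub[OF C] act_set_compl[of "inv g" C] g
    by simp
next
  fix C D assume "C \<in> act_node g \<sigma>" and D: "D \<in> essential k" and CD: "C \<subseteq> D"
  then obtain A where A: "A \<in> \<sigma>" "C = act_set g A" by blast
  have D': "act_set (inv g) D \<in> essential k" using essential_act[of "inv g"] g D by simp
  have "A \<subseteq> act_set (inv g) D"
    using CD A act_set_inv(1)[OF g, of A] orientation_Pow[OF \<sigma>] image_mono[OF CD, of "\<phi> (inv g)"] by auto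
  then have "act_set (inv g) D \<in> \<sigma>" using orientationD(3)[OF \<sigma> A(1) D'] by blast
  then show "D \<in> act_node g \<sigma>" using mem_act_node[OF g orientation_Pow[OF \<sigma>]] essential_sub[OF D] by blast
next
  fix v assume v: "v \<in> V"
  have "{C \<in> act_node g \<sigma>. v \<notin> C} \<subseteq> act_set g ` {C \<in> \<sigma>. \<phi> (inv g) v \<notin> C}"
    using mem_act_set[OF g _ v] orientation_Pow[OF \<sigma>] by blast
  moreover have "\<phi> (inv g) v \<in> V" using act_closed g v by simp
  ultimately show "finite {C \<in> act_node g \<sigma>. v \<notin> C}"
    using orientationD(4)[OF \<sigma>] by (meson finite_imageI finite_subset)
qed

lemma tip_act:
  assumes g: "g \<in> carrier G" and C: "C \<in> essential k"
  shows "tip (act_set g C) = act_node g (tip C)"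
proof -
  have sub: "act_node h (tip D) \<subseteq> tip (act_set h D)" if h: "h \<in> carrier G" and D: "D \<in> essential k" for h D
  proof
    fix Z assume "Z \<in> act_node h (tip D)"
    then obtain A where A: "A \<in> essential k" "D \<subseteq> A \<or> V - D \<subset> A" "Z = act_set h A" by (auto simp: tip_def)
    have "V - D \<subset> A \<longleftrightarrow> V - act_set h D \<subset> act_set h A"
      using act_set_mono[OF h, of "V - D" A] act_set_eq[OF h, of "V - D" A] act_set_compl[OF h, of D]
        essential_sub[OF A(1)] essential_sub[OF D] by (auto simp: psubset_eq)
    then show "Z \<in> tip (act_set h D)"
      using A essential_act[OF h A(1)] image_mono[of D A "\<phi> h"] by (auto simp: tip_def)
  qed
  have gC: "act_set g C \<in> essential k" using essential_act[OF g C] .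
  have "act_node g (tip C) = tip (act_set g C)"
    using orientation_subset_eq[OF orientation_act[OF g orientation_tip[OF C]] orientation_tip[OF gC] sub[OF g C]] .
  then show ?thesis by simp
qed

lemma side_act: "g \<in> carrier G \<Longrightarrow> C \<in> essential k \<Longrightarrow> side (act_set g C) = act_node g (side C)"
  using act_set_compl[OF _ essential_sub] by (simp add: side_def)

text \<open>The node of the tree at which a vertex of the graph is located.\<close>

definition point :: "'v \<Rightarrow> 'v set set" where
  "point v = {C \<in> essential k. v \<in> C}"

lemma orientation_point:
  assumes v: "v \<in> V"
  shows "orientation (point v)"
proof -
  have "finite {C \<in> point v. w \<notin> C}" if "w \<in> V" for w
    using finite_E_separating[of "{v, w}"] v that
    by (rule_tac finite_subset[of _ "{C \<in> essential k. separates C {v, w}}"]) (auto simp: point_def separates_def)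
  then show ?thesis using v essential_compl essential_sub unfolding orientation_def point_def by blast
qed

lemma point_act:
  assumes g: "g \<in> carrier G" and v: "v \<in> V"
  shows "point (\<phi> g v) = act_node g (point v)"
proof -
  have "C \<in> point (\<phi> g v) \<longleftrightarrow> C \<in> act_node g (point v)" for C
  proof (cases "C \<in> essential k")
    case True
    have "act_set (inv g) C \<in> essential k" using essential_act[of "inv g"] g True by simp
    then show ?thesis
      using True mem_act_node[OF g orientation_Pow[OF orientation_point[OF v]] essential_sub[OF True]]
        mem_act_set[of "inv g" C v] g v essential_sub[OF True] by (simp add: point_def)
  next
    case False
    then show ?thesis using orientationD(1)[OF orientation_act[OF g orientation_point[OF v]], of C] by (auto simp: point_def)
  qed
  then show ?thesis by blast
qed

end

section \<open>The region of the graph belonging to a node\<close>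

locale node_stabilizer = proper_action V R G \<phi> k
  for V :: "'v set" and R and G :: "('g, 'm) monoid_scheme" (structure) and \<phi> k +
  fixes \<sigma> :: "'v set set"
  assumes orientation_node: "orientation \<sigma>"
begin

definition "H = {g \<in> carrier G. act_node g \<sigma> = \<sigma>}"

definition "M = {C \<in> \<sigma>. \<forall>D \<in> \<sigma>. \<not> D \<subset> C}"

text \<open>\<open>M\<close> lists the tree edges at the node. No vertex need lie on the chosen side
  of all of them, so \<open>K\<close> also admits endpoints of their boundary edges; this makes it
  nonempty and coarsely connected.\<close>

definition "K = {v \<in> V. \<forall>C \<in> M. v \<in> C \<or> v \<in> ends C}"

lemma node_Pow: "\<sigma> \<subseteq> Pow V"
  using orientation_Pow[OF orientation_node] .

lemma H_carrier: "h \<in> H \<Longrightarrow> h \<in> carrier G"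
  by (simp add: H_def)

lemma H_inv: "h \<in> H \<Longrightarrow> inv h \<in> H"
  using act_node_inv(1)[OF _ node_Pow, of h] by (auto simp: H_def)

lemma M_E: "C \<in> M \<Longrightarrow> C \<in> essential k"
  using orientationD(1)[OF orientation_node] by (simp add: M_def)

lemma finite_ends_M:
  assumes "C \<in> M"
  shows "finite (ends C)"
proof -
  have "C \<in> cuts k" using M_E[OF assms] essential_cuts by blast
  then show ?thesis using finite_ends by (simp add: cuts_def)
qed

lemma M_tip: "C \<in> M \<Longrightarrow> \<sigma> = tip C"
  using orientation_eq_tip[OF orientation_node] by (simp add: M_def)

lemma MI: "C \<in> essential k \<Longrightarrow> \<sigma> = tip C \<Longrightarrow> C \<in> M"
  unfolding M_def using tip_minimal tip_self by simp

lemma M_disjoint: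
  assumes "C \<in> M" "D \<in> M" "C \<noteq> D"
  shows "V - D \<subseteq> C"
proof -
  have "D \<in> tip C" using assms M_tip tip_self M_E by metis
  then have "C \<subseteq> D \<or> V - C \<subset> D" by (auto simp: tip_def)
  moreover have "\<not> C \<subset> D" using assms(1,2) by (auto simp: M_def)
  ultimately show ?thesis using assms(3) by blast
qed

text \<open>If \<open>point v\<close> differed from the node, some cut of \<open>M\<close> on the
  way to it would miss \<open>v\<close>.\<close>

lemma point_eq_node:
  assumes v: "v \<in> V" "\<And>C. C \<in> M \<Longrightarrow> v \<in> C"
  shows "point v = \<sigma>"
proof -
  have "C \<in> point v" if C: "C \<in> \<sigma>" for C
  proof (rule ccontr)
    assume "C \<notin> point v"
    then obtain D where D: "D \<in> \<sigma> - point v" "\<sigma> = tip D"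
      using exists_flippable[OF orientation_node orientation_point[OF v(1)] C] by blast
    then have "D \<in> essential k" using orientationD(1)[OF orientation_node] by blast
    then show False using MI D v(2) by (auto simp: point_def)
  qed
  then show ?thesis using orientation_subset_eq[OF orientation_node orientation_point[OF v(1)]] by blast
qed

text \<open>For another \<open>D\<close> in \<open>M\<close> missing \<open>v\<close>, the
  complements of \<open>C\<close> and \<open>D\<close> are disjoint. So \<open>v\<close> lies in
  \<open>C\<close>, its neighbour across \<open>bd C\<close> lies in \<open>D\<close>, and the same
  edge is a boundary edge of \<open>D\<close>.\<close>

lemma ends_K:
  assumes "C \<in> M"
  shows "ends C \<subseteq> K"
proof
  fix v assume v: "v \<in> ends C"
  have "v \<in> ends D" if D: "D \<in> M" "v \<notin> D" for D
  proof (cases "D = C")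
    case False
    have "v \<in> V" using v ends_subset by blast
    then have "v \<in> C" using M_disjoint[OF assms D(1)] False D(2) by blast
    then obtain z where z: "(v, z) \<in> bd C" using v by (auto simp: ends_def bd_def)
    then have "z \<in> V" "z \<notin> C" using arcs_subset by (auto simp: bd_def)
    then have "z \<in> D" using M_disjoint[OF assms D(1)] False by blast
    then have "(z, v) \<in> bd D" using z D(2) arcs_symD by (auto simp: bd_def)
    then show ?thesis by (rule endsI(2))
  qed (use v in simp)
  then show "v \<in> K" using v ends_subset by (auto simp: K_def)
qed

text \<open>A path leaves \<open>K\<close> only by passing behind some \<open>C\<close> in
  \<open>M\<close>, and it enters and returns through \<open>ends C\<close>. If \<open>A\<close>
  separates none of these sets and cuts no edge inside \<open>K\<close>, membership in
  \<open>A\<close> is carried along the path.\<close>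

lemma K_split:
  assumes u: "u \<in> K" "u \<in> A" and v: "v \<in> K" "v \<notin> A"
  shows "(\<exists>C \<in> M. separates A (ends C)) \<or> (\<exists>(x, y) \<in> R. x \<in> K \<and> y \<in> K \<and> x \<in> A \<and> y \<notin> A)"
proof (rule ccontr)
  assume "\<not> ?thesis"
  then have ends: "\<And>C. C \<in> M \<Longrightarrow> ends C \<subseteq> A \<or> ends C \<inter> A = {}"
    and edge: "\<And>x y. (x, y) \<in> R \<Longrightarrow> x \<in> K \<Longrightarrow> y \<in> K \<Longrightarrow> x \<in> A \<Longrightarrow> y \<in> A"
    by (auto simp: separates_def)
  \<comment> \<open>Membership in \<open>A\<close>, continued beyond \<open>K\<close>: behind
    \<open>C\<close> it is inherited from \<open>ends C\<close>.\<close>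
  define f where "f y \<longleftrightarrow> (y \<in> K \<and> y \<in> A) \<or> (\<exists>C \<in> M. y \<notin> C \<and> y \<notin> ends C \<and> ends C \<subseteq> A)" for y
  have outside: "y' \<notin> C \<longleftrightarrow> y \<notin> C" if "(y, y') \<in> R" "y \<notin> ends C \<or> y' \<notin> ends C" for y y' C
    using that endsI[of y y' C] endsI[of y' y C] arcs_symD[of y y'] by (auto simp: bd_def)
  have step: "f y'" if yy: "(y, y') \<in> R" "f y" for y y'
    using \<open>f y\<close> unfolding f_def
  proof (elim disjE bexE conjE)
    assume y: "y \<in> K" "y \<in> A"
    show "(y' \<in> K \<and> y' \<in> A) \<or> (\<exists>C \<in> M. y' \<notin> C \<and> y' \<notin> ends C \<and> ends C \<subseteq> A)"
    proof (cases "y' \<in> K")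
      case False
      then obtain C where C: "C \<in> M" "y' \<notin> C" "y' \<notin> ends C" using yy(1) arcs_subset by (auto simp: K_def)
      then have "y \<notin> C" using outside[OF yy(1)] by blast
      then have "y \<in> ends C" using y(1) C(1) by (auto simp: K_def)
      then show ?thesis using C ends y(2) by blast
    qed (use edge yy y in blast)
  next
    fix C assume C: "C \<in> M" "y \<notin> C" "y \<notin> ends C" "ends C \<subseteq> A"
    then show "(y' \<in> K \<and> y' \<in> A) \<or> (\<exists>C \<in> M. y' \<notin> C \<and> y' \<notin> ends C \<and> ends C \<subseteq> A)"
      using outside[OF yy(1)] ends_K[OF C(1)] by blast
  qed
  have "(u, v) \<in> R\<^sup>*" using arcs_conn u v by (auto simp: K_def)
  then have "f v" by (induction rule: rtrancl_induct) (use u step in \<open>auto simp: f_def\<close>)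
  then show False using v by (auto simp: f_def K_def)
qed

lemma M_act: "h \<in> H \<Longrightarrow> C \<in> M \<Longrightarrow> act_set h C \<in> M"
  using tip_act[OF H_carrier M_E] M_tip essential_act[OF H_carrier M_E] by (intro MI) (auto simp: H_def)

lemma K_act:
  assumes "h \<in> H" "v \<in> K"
  shows "\<phi> h v \<in> K"
proof -
  have v: "v \<in> V" and h: "h \<in> carrier G" using assms by (auto simp: K_def H_carrier)
  have "\<phi> h v \<in> C \<or> \<phi> h v \<in> ends C" if C: "C \<in> M" for C
  proof -
    have "act_set (inv h) C \<in> M" using M_act[OF H_inv[OF assms(1)] C] .
    then have "v \<in> act_set (inv h) C \<or> v \<in> act_set (inv h) (ends C)"
      using assms(2) ends_act[of "inv h" C] h essential_sub[OF M_E[OF C]] by (auto simp: K_def)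
    then show ?thesis
      using mem_act_set[of "inv h" C v] mem_act_set[of "inv h" "ends C" v] h v essential_sub[OF M_E[OF C]] ends_subset by simp
  qed
  then show ?thesis using act_closed[OF h v] by (simp add: K_def)
qed

text \<open>An element taking one member of \<open>M\<close> to another takes the tip of the first
  to the tip of the second, and both tips are the node; so it lies in \<open>H\<close>. Hence one
  member of \<open>M\<close> from each \<open>G\<close>-orbit suffices.\<close>

lemma M_cofinite: "\<exists>M0 \<subseteq> M. finite M0 \<and> (\<forall>C \<in> M. \<exists>D \<in> M0. \<exists>h \<in> H. act_set h D = C)"
proof -
  obtain E0 where E0: "E0 \<subseteq> essential k" "finite E0" "\<forall>C \<in> essential k. \<exists>D \<in> E0. \<exists>g \<in> carrier G. act_set g D = C"
    using cuts_cofinite by blast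
  define r where "r D = (SOME g. g \<in> carrier G \<and> act_set g D \<in> M)" for D
  have r: "r D \<in> carrier G" "act_set (r D) D \<in> M" if "g \<in> carrier G" "act_set g D \<in> M" for g D
    using someI[of "\<lambda>g. g \<in> carrier G \<and> act_set g D \<in> M" g] that by (auto simp: r_def)
  define M0 where "M0 = (\<lambda>D. act_set (r D) D) ` E0 \<inter> M"
  have "\<exists>D \<in> M0. \<exists>h \<in> H. act_set h D = C" if C: "C \<in> M" for C
  proof -
    obtain D g where D: "D \<in> E0" "g \<in> carrier G" "act_set g D = C" using bspec[OF E0(3) M_E[OF C]] by blast
    have rD: "r D \<in> carrier G" "act_set (r D) D \<in> M" using r[OF D(2)] D(3) C by auto
    have DV: "D \<subseteq> V" "act_set (r D) D \<subseteq> V" using D E0(1) essential_sub M_E rD by blast+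
    let ?h = "g \<otimes> inv (r D)"
    have h: "act_set ?h (act_set (r D) D) = C"
      using act_set_mult[OF D(2) _ DV(2), of "inv (r D)"] act_set_inv(1)[OF rD(1) DV(1)] rD D by simp
    have "act_node ?h \<sigma> = \<sigma>"
      using tip_act[of ?h "act_set (r D) D"] h D(2) rD M_E[OF rD(2)] M_tip[OF C] M_tip[OF rD(2)] by simp
    then have "?h \<in> H" using D rD by (simp add: H_def)
    moreover have "act_set (r D) D \<in> M0" using rD D by (auto simp: M0_def)
    ultimately show ?thesis using h by blast
  qed
  moreover have "finite M0" using E0(2) by (simp add: M0_def)
  ultimately show ?thesis by (intro exI[of _ M0]) (auto simp: M0_def)
qed

text \<open>Vertices inside all cuts of \<open>M\<close> have the node as their
  \<open>point\<close>, so the argument for \<open>M\<close> applies to them. The remaining ones are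
  endpoints of boundary edges, which come from finitely many cuts up to \<open>H\<close>.\<close>

lemma K_cofinite: "\<exists>P \<subseteq> K. finite P \<and> (\<forall>v \<in> K. \<exists>p \<in> P. \<exists>h \<in> H. \<phi> h p = v)"
proof -
  obtain P where P: "P \<subseteq> V" "finite P" "\<forall>v \<in> V. \<exists>p \<in> P. \<exists>g \<in> carrier G. \<phi> g p = v"
    using cofinite by blast
  obtain M0 where M0: "M0 \<subseteq> M" "finite M0" "\<forall>C \<in> M. \<exists>D \<in> M0. \<exists>h \<in> H. act_set h D = C"
    using M_cofinite by blast
  define r where "r p = (SOME g. g \<in> carrier G \<and> point (\<phi> g p) = \<sigma>)" for p
  have r: "r p \<in> carrier G" "point (\<phi> (r p) p) = \<sigma>" if "g \<in> carrier G" "point (\<phi> g p) = \<sigma>" for g p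
    using someI[of "\<lambda>g. g \<in> carrier G \<and> point (\<phi> g p) = \<sigma>" g] that by (auto simp: r_def)
  define P0 where "P0 = ((\<lambda>p. \<phi> (r p) p) ` P \<inter> K) \<union> (\<Union>C \<in> M0. ends C)"
  have "\<exists>p \<in> P0. \<exists>h \<in> H. \<phi> h p = v" if v: "v \<in> K" for v
  proof (cases "\<forall>C \<in> M. v \<in> C")
    case True
    have vV: "v \<in> V" using v by (simp add: K_def)
    obtain p g where p: "p \<in> P" "g \<in> carrier G" "\<phi> g p = v" using bspec[OF P(3) vV] by blast
    have pV: "p \<in> V" using p P by blast
    have pt: "point v = \<sigma>" using point_eq_node[OF vV] True by blast
    have rp: "r p \<in> carrier G" "point (\<phi> (r p) p) = \<sigma>" using r[OF p(2)] pt p(3) by auto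
    define w where "w = \<phi> (r p) p"
    have w: "w \<in> V" "point w = \<sigma>" using act_closed rp pV by (auto simp: w_def)
    let ?h = "g \<otimes> inv (r p)"
    have h: "\<phi> ?h w = v" using composition_rule[OF w(1) p(2), of "inv (r p)"] rp p pV by (simp add: w_def)
    have "act_node ?h \<sigma> = \<sigma>" using point_act[of ?h w] h w pt p rp by simp
    then have "?h \<in> H" using p rp by (simp add: H_def)
    moreover have "w \<in> K" using w orientationD(1)[OF orientation_node] by (auto simp: K_def M_def point_def)
    then have "w \<in> P0" using p by (auto simp: P0_def w_def)
    ultimately show ?thesis using h by blast
  next
    case False
    then obtain C where C: "C \<in> M" "v \<notin> C" by blast
    then have vC: "v \<in> ends C" using v by (auto simp: K_def)
    obtain D h where D: "D \<in> M0" "h \<in> H" "act_set h D = C" using bspec[OF M0(3) C(1)] by blast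
    have "D \<in> M" using D(1) M0(1) by blast
    then have "v \<in> act_set h (ends D)"
      using ends_act[OF H_carrier[OF D(2)] essential_sub[OF M_E[OF \<open>D \<in> M\<close>]]] vC unfolding D(3) by blast
    then show ?thesis using D by (auto simp: P0_def)
  qed
  moreover have "finite (ends C)" if "C \<in> M0" for C
    using that M0(1) finite_ends_M by blast
  then have "finite P0" using P M0(2) by (simp add: P0_def)
  moreover have "P0 \<subseteq> K" using ends_K M0(1) by (auto simp: P0_def)
  ultimately show ?thesis by (intro exI[of _ P0]) simp
qed

text \<open>Write \<open>v\<close> as \<open>\<phi> h p\<close> with \<open>p\<close> from a finite
  set. Then \<open>p\<close> lies outside \<open>act_set (inv h) C\<close>, a member of the node;
  this leaves finitely many sets, and finitely many \<open>h\<close> move such a set to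
  \<open>C\<close>.\<close>

lemma finite_K_outside:
  assumes C: "C \<in> \<sigma>"
  shows "finite {v \<in> K. v \<notin> C}"
proof -
  obtain P where P: "P \<subseteq> K" "finite P" "\<forall>v \<in> K. \<exists>p \<in> P. \<exists>h \<in> H. \<phi> h p = v"
    using K_cofinite by blast
  have CE: "C \<in> essential k" using orientationD(1)[OF orientation_node C] .
  have fin: "finite {g \<in> carrier G. act_set g D = C}" if "D \<in> \<sigma>" for D
    using finite_cut_movers[of D C] that CE orientationD(1)[OF orientation_node] essential_cuts by blast
  have "{v \<in> K. v \<notin> C} \<subseteq> (\<Union>p\<in>P. \<Union>D \<in> {D \<in> \<sigma>. p \<notin> D}. (\<lambda>g. \<phi> g p) ` {g \<in> carrier G. act_set g D = C})"
  proof
    fix v assume v: "v \<in> {v \<in> K. v \<notin> C}"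
    then obtain p h where p: "p \<in> P" "h \<in> H" "\<phi> h p = v" using P(3) by blast
    then have h: "h \<in> carrier G" "p \<in> V" using H_carrier P(1) by (auto simp: K_def)
    have "act_set (inv h) C \<in> \<sigma>" using H_inv[OF p(2)] C unfolding H_def by blast
    moreover have "p \<notin> act_set (inv h) C"
      using mem_act_set[of "inv h" C p] h essential_sub[OF CE] p(3) v by auto
    moreover have "act_set h (act_set (inv h) C) = C" using act_set_inv(2) h essential_sub[OF CE] by blast
    ultimately show "v \<in> (\<Union>p\<in>P. \<Union>D \<in> {D \<in> \<sigma>. p \<notin> D}. (\<lambda>g. \<phi> g p) ` {g \<in> carrier G. act_set g D = C})"
      using p h by blast
  qed
  moreover have "finite {D \<in> \<sigma>. p \<notin> D}" if "p \<in> P" for p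
    using orientationD(4)[OF orientation_node] that P(1) by (auto simp: K_def)
  then have "finite (\<Union>p\<in>P. \<Union>D \<in> {D \<in> \<sigma>. p \<notin> D}. (\<lambda>g. \<phi> g p) ` {g \<in> carrier G. act_set g D = C})"
    using P(2) fin by (intro finite_UN_I finite_imageI) auto
  ultimately show ?thesis by (rule finite_subset)
qed

lemma cut_almost_contains_K:
  assumes A: "A \<in> cuts k"
  shows "finite (K \<inter> A) \<or> finite (K - A)"
proof -
  have "A \<in> bool_span V (essential k)" using essential_generate A by (auto simp: cuts_def)
  from bool_span_atoms[OF this] obtain T where T: "T \<subseteq> essential k" "finite T"
    "\<forall>u \<in> V. \<forall>v \<in> V. (\<forall>C \<in> T. u \<in> C \<longleftrightarrow> v \<in> C) \<longrightarrow> (u \<in> A \<longleftrightarrow> v \<in> A)" by blast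
  \<comment> \<open>The points of \<open>K\<close> off the chosen side of one of the finitely many
    cuts that determine \<open>A\<close>.\<close>
  define Bad where "Bad = (\<Union>C\<in>T. {v \<in> K. (v \<in> C) \<noteq> (C \<in> \<sigma>)})"
  have "finite {v \<in> K. (v \<in> C) \<noteq> (C \<in> \<sigma>)}" if "C \<in> T" for C
  proof (cases "C \<in> \<sigma>")
    case True
    then show ?thesis using finite_K_outside[OF True] by simp
  next
    case False
    then have "V - C \<in> \<sigma>" using orientationD(2)[OF orientation_node] that T(1) by blast
    then have "finite {v \<in> K. v \<notin> V - C}" by (rule finite_K_outside)
    then show ?thesis by (rule rev_finite_subset) (use False in auto)
  qed
  then have Bad: "finite Bad" using T(2) by (simp add: Bad_def)
  have same: "u \<in> A \<longleftrightarrow> v \<in> A" if "u \<in> K - Bad" "v \<in> K - Bad" for u v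
  proof -
    have "\<forall>C \<in> T. u \<in> C \<longleftrightarrow> v \<in> C" using that by (auto simp: Bad_def)
    moreover have "u \<in> V" "v \<in> V" using that by (auto simp: K_def)
    ultimately show ?thesis using T(3) by blast
  qed
  show ?thesis
  proof (cases "\<exists>u \<in> K - Bad. u \<in> A")
    case True
    then have "K - A \<subseteq> Bad" using same by blast
    then show ?thesis using Bad finite_subset by blast
  next
    case False
    then have "K \<inter> A \<subseteq> Bad" by blast
    then show ?thesis using Bad finite_subset by blast
  qed
qed

text \<open>All of \<open>H\<close> moves a point of \<open>K\<close> within \<open>K\<close>, and
  only finitely many elements move it into a given finite set.\<close>

lemma infinite_K:
  assumes "infinite H"
  shows "infinite K"
proof
  assume fin: "finite K"
  obtain v where v: "v \<in> V" using nonempty by blast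
  have "K \<noteq> {}"
  proof (cases "v \<in> K")
    case False
    then obtain C where C: "C \<in> M" using v by (auto simp: K_def)
    then have "bd C \<noteq> {}"
      using bd_nonempty[OF essential_sub[OF M_E] E_ne(1)[OF M_E] E_ne(2)[OF M_E]] by blast
    then show ?thesis using ends_K[OF C] by (auto simp: ends_def)
  qed auto
  then obtain p where p: "p \<in> K" by blast
  have "H \<subseteq> {g \<in> carrier G. \<phi> g p \<in> K}" using K_act p H_carrier by blast
  moreover have "finite {g \<in> carrier G. \<phi> g p \<in> K}" using finite_movers[OF _ fin] p by (auto simp: K_def)
  ultimately show False using assms finite_subset by blast
qed

lemma finite_H:
  assumes bal: "\<And>W. finite W \<Longrightarrow> W \<subseteq> V \<Longrightarrow> W \<noteq> {} \<Longrightarrow>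
      \<exists>X \<subseteq> V. finite X \<and> card X \<le> m \<and> finite (bd X) \<and> card (bd X) \<le> k \<and>
        (\<forall>A. A \<subseteq> V - X \<longrightarrow> conn A \<longrightarrow> 2 * card (A \<inter> W) \<le> card W)"
  shows "finite H"
proof (rule ccontr)
  assume "infinite H"
  then have K: "infinite K" by (rule infinite_K)
  obtain P where P: "P \<subseteq> K" "finite P" "\<forall>v \<in> K. \<exists>p \<in> P. \<exists>h \<in> H. \<phi> h p = v"
    using K_cofinite by blast
  obtain M0 where M0: "M0 \<subseteq> M" "finite M0" "\<forall>C \<in> M. \<exists>D \<in> M0. \<exists>h \<in> H. act_set h D = C"
    using M_cofinite by blast
  have KV: "K \<subseteq> V" by (auto simp: K_def)
  \<comment> \<open>Chosen so that every cut in \<open>cuts k\<close> splitting \<open>K\<close>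
    separates \<open>S\<close> after translation by an element of \<open>H\<close>: \<open>P\<close>
    and its neighbours catch the cut edges inside \<open>K\<close>, the last part catches the
    separated sets \<open>ends C\<close>.\<close>
  define S where "S = P \<union> R `` P \<union> (\<Union>C \<in> M0. ends C)"
  have "finite (ends C)" if "C \<in> M0" for C
    using that M0(1) finite_ends_M by blast
  moreover have "R `` P = (\<Union>p\<in>P. R `` {p})" by blast
  then have "finite (R `` P)" using P KV finite_nbrs by auto
  ultimately have "finite S"
    using P(2) M0(2) unfolding S_def by simp
  moreover have "R `` P \<subseteq> V" using arcs_subset by blast
  then have "S \<subseteq> V" unfolding S_def using P(1) KV ends_subset by (intro Un_least UN_least) blast+
  ultimately have S: "finite S" "S \<subseteq> V" by simp_all
  define \<C> where "\<C> = {A \<in> cuts k. separates A S}"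
  have \<C>: "finite \<C>" unfolding \<C>_def using finite_cuts_separating[OF S] .
  \<comment> \<open>The implications are needed because \<open>card\<close> is \<open>0\<close> on
    infinite sets.\<close>
  have big: "\<exists>A \<in> \<C>. (finite (K \<inter> A) \<longrightarrow> n \<le> card (K \<inter> A)) \<and> (finite (K - A) \<longrightarrow> n \<le> card (K - A))" if "n > 0" for n
  proof -
    obtain W where W: "W \<subseteq> K" "finite W" "card W = 2 * k * n + m + 1"
      using infinite_arbitrarily_large[OF K] by blast
    then have "W \<noteq> {}" by auto
    then obtain X where X: "X \<subseteq> V" "finite X" "card X \<le> m" "finite (bd X)" "card (bd X) \<le> k"
      "\<And>A. A \<subseteq> V - X \<Longrightarrow> conn A \<Longrightarrow> 2 * card (A \<inter> W) \<le> card W"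
      using bal[of W] W KV by blast
    obtain A where A: "A \<in> cuts k" "n \<le> card (W \<inter> A)" "n \<le> card (W - A)"
      using balanced_cut[OF X W(2) _ W(3)] W(1) KV by blast
    have AV: "A \<subseteq> V" using A by (simp add: cuts_def)
    have "W \<inter> A \<noteq> {}" "W - A \<noteq> {}" using A(2,3) that by (metis card.empty not_le)+
    then obtain u v where "u \<in> K" "u \<in> A" "v \<in> K" "v \<notin> A" using W(1) by blast
    from K_split[OF this] have "\<exists>h \<in> H. separates (act_set (inv h) A) S"
    proof
      assume "\<exists>C \<in> M. separates A (ends C)"
      then obtain C where C: "C \<in> M" "separates A (ends C)" by blast
      obtain D h where D: "D \<in> M0" "h \<in> H" "act_set h D = C" using bspec[OF M0(3) C(1)] by blast
      have h: "h \<in> carrier G" using D H_carrier by blast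
      have "D \<in> M" using D(1) M0(1) by blast
      then have "ends C = act_set h (ends D)" using ends_act[OF h essential_sub[OF M_E[OF \<open>D \<in> M\<close>]]] unfolding D(3) by simp
      then obtain x y where xy: "x \<in> ends D" "\<phi> h x \<in> A" "y \<in> ends D" "\<phi> h y \<notin> A"
        using C(2) by (auto simp: separates_def)
      then have V: "x \<in> V" "y \<in> V" using ends_subset by auto
      have "x \<in> act_set (inv h) A" "y \<notin> act_set (inv h) A"
        using mem_act_set[of "inv h" A] h AV V xy by auto
      then have "separates (act_set (inv h) A) S"
        using xy D(1) unfolding separates_def S_def by blast
      then show ?thesis using D by blast
    next
      assume "\<exists>(x, y) \<in> R. x \<in> K \<and> y \<in> K \<and> x \<in> A \<and> y \<notin> A"
      then obtain x y where xy: "(x, y) \<in> R" "x \<in> K" "x \<in> A" "y \<notin> A" "y \<in> V" using arcs_subset by blast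
      obtain p h where p: "p \<in> P" "h \<in> H" "\<phi> h p = x" using P(3) xy by blast
      have h: "h \<in> carrier G" "p \<in> V" using p H_carrier P KV by blast+
      define q where "q = \<phi> (inv h) y"
      have q: "q \<in> V" "\<phi> h q = y" using h xy act_closed by (auto simp: q_def)
      have "(p, q) \<in> R" using arcs_inv[OF h(1,2) q(1)] xy p q by simp
      then have "p \<in> S" "q \<in> S" using p by (auto simp: S_def)
      moreover have "p \<in> act_set (inv h) A" "q \<notin> act_set (inv h) A"
        using mem_act_set[of "inv h" A] h AV q xy p by auto
      ultimately have "separates (act_set (inv h) A) S" unfolding separates_def by blast
      then show ?thesis using p by blast
    qed
    then obtain h where h: "h \<in> H" "separates (act_set (inv h) A) S" by blast
    have hG: "h \<in> carrier G" "inv h \<in> carrier G" using h H_carrier by auto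
    let ?B = "act_set (inv h) A"
    have Kh: "act_set (inv h) K = K"
    proof
      show "act_set (inv h) K \<subseteq> K" using K_act[OF H_inv[OF h(1)]] by blast
      have "act_set (inv h) (act_set h K) \<subseteq> act_set (inv h) K" using K_act[OF h(1)] by blast
      then show "K \<subseteq> act_set (inv h) K" using act_set_inv(1)[OF hG(1) KV] by simp
    qed
    have eq: "K \<inter> ?B = act_set (inv h) (K \<inter> A)" "K - ?B = act_set (inv h) (K - A)"
      using act_set_Int[OF hG(2) KV AV] act_set_diff[OF hG(2) KV AV] Kh by auto
    have inj: "inj_on (\<phi> (inv h)) (K \<inter> A)" "inj_on (\<phi> (inv h)) (K - A)"
      using inj_prop[OF hG(2)] KV by (auto elim: inj_on_subset)
    have "finite (K \<inter> ?B) \<longrightarrow> n \<le> card (K \<inter> ?B)"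
      unfolding eq card_image[OF inj(1)] finite_image_iff[OF inj(1)]
      using A(2) W(1) by (meson Int_mono card_mono le_trans order_refl)
    moreover have "finite (K - ?B) \<longrightarrow> n \<le> card (K - ?B)"
      unfolding eq card_image[OF inj(2)] finite_image_iff[OF inj(2)]
      using A(3) W(1) by (meson Diff_mono card_mono le_trans order_refl)
    moreover have "?B \<in> \<C>" using h cuts_act[OF hG(2) A(1)] by (simp add: \<C>_def)
    ultimately show ?thesis by blast
  qed
  \<comment> \<open>The size of a finite side of \<open>A\<close>, if there is one. The sum over
    \<open>\<C>\<close> bounds all of these, so \<open>n\<close> one larger leaves a cut with no
    finite side.\<close>
  define s where "s A = (if finite (K \<inter> A) then card (K \<inter> A) else card (K - A))" for A
  obtain A where A: "A \<in> \<C>" "finite (K \<inter> A) \<longrightarrow> Suc (sum s \<C>) \<le> card (K \<inter> A)" "finite (K - A) \<longrightarrow> Suc (sum s \<C>) \<le> card (K - A)"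
    using big[of "Suc (sum s \<C>)"] by blast
  have "s A \<le> sum s \<C>" using A(1) \<C> by (simp add: member_le_sum)
  moreover have "finite (K \<inter> A) \<or> finite (K - A)" using cut_almost_contains_K A(1) by (simp add: \<C>_def)
  ultimately show False using A(2,3) by (auto simp: s_def split: if_splits)
qed

end

section \<open>Groups acting on trees\<close>

lemma nonbacktracking_Cons: "nonbacktracking (x # xs) \<Longrightarrow> nonbacktracking xs"
  by (cases xs rule: nonbacktracking.cases) auto

lemma nonbacktracking_map:
  "inj_on f (set xs) \<Longrightarrow> nonbacktracking (map f xs) \<longleftrightarrow> nonbacktracking xs"
  by (induction xs rule: nonbacktracking.induct) (auto simp: inj_on_def)

text \<open>\<open>lift\<close> selects a node over each vertex and \<open>dec\<close> identifies
  vertex groups with stabilizers. The selected nodes need not form a subtree; \<open>t y\<close>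
  closes the gap, as \<open>y\<close> lifts to an arc whose end is the translate by
  \<open>t y\<close> of a selected node. That \<open>A\<close> is a tree enters as connectedness and
  the absence of closed walks without backtracking.\<close>

locale bass_serre = graph_of_groups \<Y> + group G
  for \<Y> :: "('n, 'e, 'a, 'b) graph_of_groups" and G :: "('g, 'm) monoid_scheme" (structure) +
  fixes N :: "'x set" and A :: "('x \<times> 'x) set" and act :: "'g \<Rightarrow> 'x \<Rightarrow> 'x"
    and lift :: "'n \<Rightarrow> 'x" and dec :: "'n \<Rightarrow> 'a \<Rightarrow> 'g" and t :: "'e \<Rightarrow> 'g"
  assumes act_closed: "\<lbrakk>g \<in> carrier G; x \<in> N\<rbrakk> \<Longrightarrow> act g x \<in> N"
    and act_one: "x \<in> N \<Longrightarrow> act \<one> x = x"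
    and act_mult: "\<lbrakk>g \<in> carrier G; h \<in> carrier G; x \<in> N\<rbrakk> \<Longrightarrow> act (g \<otimes> h) x = act g (act h x)"
    and adj_sub: "A \<subseteq> N \<times> N"
    and adj_act: "\<lbrakk>g \<in> carrier G; (x, z) \<in> A\<rbrakk> \<Longrightarrow> (act g x, act g z) \<in> A"
    and adj_conn: "\<lbrakk>x \<in> N; z \<in> N\<rbrakk> \<Longrightarrow> (x, z) \<in> A\<^sup>*"
    and adj_acyclic: "\<lbrakk>successively (\<lambda>x y. (x, y) \<in> A) xs; nonbacktracking xs; length xs \<ge> 2\<rbrakk> \<Longrightarrow> hd xs \<noteq> last xs"
    and lift_in: "v \<in> verts (base \<Y>) \<Longrightarrow> lift v \<in> N"
    and lift_inj: "\<lbrakk>v \<in> verts (base \<Y>); w \<in> verts (base \<Y>); g \<in> carrier G; act g (lift v) = lift w\<rbrakk> \<Longrightarrow> v = w"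
    and dec_hom: "v \<in> verts (base \<Y>) \<Longrightarrow> dec v \<in> hom (vertex_group \<Y> v) G"
    and dec_inj: "v \<in> verts (base \<Y>) \<Longrightarrow> inj_on (dec v) (carrier (vertex_group \<Y> v))"
    and dec_image: "v \<in> verts (base \<Y>) \<Longrightarrow> dec v ` carrier (vertex_group \<Y> v) = {g \<in> carrier G. act g (lift v) = lift v}"
    and t_closed: "y \<in> arcs (base \<Y>) \<Longrightarrow> t y \<in> carrier G"
    and t_rev: "y \<in> arcs (base \<Y>) \<Longrightarrow> t (arc_rev \<Y> y) = inv (t y)"
    and t_adj: "y \<in> arcs (base \<Y>) \<Longrightarrow> (lift (tail (base \<Y>) y), act (t y) (lift (head (base \<Y>) y))) \<in> A"
    and t_conj: "\<lbrakk>y \<in> arcs (base \<Y>); c \<in> carrier (edge_group \<Y> y)\<rbrakk> \<Longrightarrow>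
      t y \<otimes> dec (head (base \<Y>) y) (edge_emb \<Y> y c) \<otimes> inv (t y) = dec (tail (base \<Y>) y) (edge_emb \<Y> (arc_rev \<Y> y) c)"
    and edge_stab: "\<lbrakk>y \<in> arcs (base \<Y>); s \<in> carrier (vertex_group \<Y> (head (base \<Y>) y));
        act (dec (head (base \<Y>) y) s) (act (inv (t y)) (lift (tail (base \<Y>) y))) = act (inv (t y)) (lift (tail (base \<Y>) y))\<rbrakk>
      \<Longrightarrow> \<exists>a \<in> carrier (edge_group \<Y> y). s = edge_emb \<Y> y a"
    and arc_ex: "\<lbrakk>v \<in> verts (base \<Y>); (lift v, x) \<in> A\<rbrakk> \<Longrightarrow> \<exists>y \<in> arcs (base \<Y>). \<exists>a \<in> carrier (vertex_group \<Y> v).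
        tail (base \<Y>) y = v \<and> x = act (dec v a) (act (t y) (lift (head (base \<Y>) y)))"
    and arc_unique: "\<lbrakk>y \<in> arcs (base \<Y>); y' \<in> arcs (base \<Y>); tail (base \<Y>) y = tail (base \<Y>) y';
        a \<in> carrier (vertex_group \<Y> (tail (base \<Y>) y));
        act (dec (tail (base \<Y>) y) a) (act (t y) (lift (head (base \<Y>) y))) = act (t y') (lift (head (base \<Y>) y'))\<rbrakk> \<Longrightarrow> y = y'"
begin

abbreviation tl_of :: "'e \<Rightarrow> 'n" where "tl_of \<equiv> tail (base \<Y>)"
abbreviation hd_of :: "'e \<Rightarrow> 'n" where "hd_of \<equiv> head (base \<Y>)"
abbreviation VG :: "'n \<Rightarrow> 'a monoid" where "VG \<equiv> vertex_group \<Y>"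
abbreviation weq :: "('n, 'e, 'a) letter list \<Rightarrow> ('n, 'e, 'a) letter list \<Rightarrow> bool" (infix "\<sim>" 50) where
  "w \<sim> w' \<equiv> word_eq \<Y> w w'"

lemma weq_refl: "w \<sim> w"
  by (rule word_eq.refl)

lemma weq_cong: "w \<sim> w' \<Longrightarrow> x @ w @ z \<sim> x @ w' @ z"
  by (intro word_eq.append word_eq.refl)

lemmas weq_trans [trans] = word_eq.trans

lemma dec_closed: "v \<in> verts (base \<Y>) \<Longrightarrow> a \<in> carrier (VG v) \<Longrightarrow> dec v a \<in> carrier G"
  using dec_hom by (auto simp: hom_def)

lemma dec_mult: "v \<in> verts (base \<Y>) \<Longrightarrow> a \<in> carrier (VG v) \<Longrightarrow> b \<in> carrier (VG v) \<Longrightarrow>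
    dec v (a \<otimes>\<^bsub>VG v\<^esub> b) = dec v a \<otimes> dec v b"
  using dec_hom by (auto simp: hom_def)

lemma dec_one: "v \<in> verts (base \<Y>) \<Longrightarrow> dec v \<one>\<^bsub>VG v\<^esub> = \<one>"
  using group_vertex_group dec_hom by (metis group_hom.hom_one group_hom.intro group_hom_axioms.intro is_group)

lemma dec_fixes: "v \<in> verts (base \<Y>) \<Longrightarrow> a \<in> carrier (VG v) \<Longrightarrow> act (dec v a) (lift v) = lift v"
  using dec_image by blast

lemma act_inv: "g \<in> carrier G \<Longrightarrow> x \<in> N \<Longrightarrow> act (inv g) (act g x) = x"
  "g \<in> carrier G \<Longrightarrow> x \<in> N \<Longrightarrow> act g (act (inv g) x) = x"
  using act_mult[of "inv g" g x] act_mult[of g "inv g" x] act_one by auto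

lemma act_inj: "g \<in> carrier G \<Longrightarrow> inj_on (act g) N"
  using act_inv(1) by (metis inj_on_inverseI)

lemma emb_closed: "y \<in> arcs (base \<Y>) \<Longrightarrow> a \<in> carrier (edge_group \<Y> y) \<Longrightarrow> edge_emb \<Y> y a \<in> carrier (VG (hd_of y))"
  using edge_emb_mon by (auto simp: mon_def hom_def)

lemma emb_rev_closed: "y \<in> arcs (base \<Y>) \<Longrightarrow> a \<in> carrier (edge_group \<Y> y) \<Longrightarrow> edge_emb \<Y> (arc_rev \<Y> y) a \<in> carrier (VG (tl_of y))"
  using emb_closed[of "arc_rev \<Y> y" a] edge_group_rev by simp

section \<open>Evaluation of words in the acting group\<close>

primrec val :: "('n, 'e, 'a) letter \<Rightarrow> 'g" where
  "val (Elem v a) = dec v a"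
| "val (Arc y) = t y"

primrec ev :: "('n, 'e, 'a) letter list \<Rightarrow> 'g" where
  "ev [] = \<one>"
| "ev (l # w) = val l \<otimes> ev w"

lemma val_closed: "l \<in> letters \<Y> \<Longrightarrow> val l \<in> carrier G"
  using dec_closed t_closed by (auto simp: letters_def)

lemma ev_closed: "w \<in> lists (letters \<Y>) \<Longrightarrow> ev w \<in> carrier G"
  by (induction w) (auto simp: val_closed)

lemma ev_append: "w \<in> lists (letters \<Y>) \<Longrightarrow> w' \<in> lists (letters \<Y>) \<Longrightarrow> ev (w @ w') = ev w \<otimes> ev w'"
  by (induction w) (auto simp: val_closed ev_closed m_assoc)

lemma Elem_letters [simp]: "Elem v a \<in> letters \<Y> \<longleftrightarrow> v \<in> verts (base \<Y>) \<and> a \<in> carrier (VG v)"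
  by (auto simp: letters_def)

lemma Arc_letters [simp]: "Arc y \<in> letters \<Y> \<longleftrightarrow> y \<in> arcs (base \<Y>)"
  by (auto simp: letters_def)

lemma VG_group: "v \<in> verts (base \<Y>) \<Longrightarrow> group (VG v)"
  by (rule group_vertex_group)

text \<open>The congruence lives on arbitrary lists, while \<open>ev\<close> is known to be
  multiplicative on lists of legal letters; so invariance of legality is proved in the same
  induction.\<close>

lemma word_eq_ev:
  assumes "w \<sim> w'"
  shows "(w \<in> lists (letters \<Y>) \<longleftrightarrow> w' \<in> lists (letters \<Y>)) \<and> (w \<in> lists (letters \<Y>) \<longrightarrow> ev w = ev w')"
  using assms
proof (induction rule: word_eq.induct)
  case (append w w' x x')
  then show ?case by (auto simp: ev_append simp del: in_lists_conv_set)
next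
  case (vertex_one v)
  then show ?case using group.is_monoid[OF VG_group, THEN monoid.one_closed] by (simp add: dec_one)
next
  case (vertex_mult v a b)
  then show ?case using group.is_monoid[OF VG_group, THEN monoid.m_closed]
    by (simp add: dec_mult dec_closed)
next
  case (arc_inverse y)
  then show ?case by (simp add: t_rev t_closed)
next
  case (arc_conj y a)
  then have "ev [Arc y, Elem (hd_of y) (edge_emb \<Y> y a), Arc (arc_rev \<Y> y)] = t y \<otimes> dec (hd_of y) (edge_emb \<Y> y a) \<otimes> inv (t y)"
    using emb_closed by (simp add: t_rev t_closed dec_closed m_assoc)
  then show ?case
    using arc_conj t_conj[of y a] emb_closed[of y a] emb_rev_closed[of y a] by (simp add: dec_closed)
qed auto

section \<open>Composition and inversion of walk words\<close>

lemma walk_word_props: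
  assumes "walk_word \<Y> u w v"
  shows "u \<in> verts (base \<Y>)" "v \<in> verts (base \<Y>)" "w \<in> lists (letters \<Y>)"
  using assms by (induction rule: walk_word.induct) auto

lemma walk_word_head: 
  assumes "walk_word \<Y> u w v"
  obtains a w' where "w = Elem u a # w'" "a \<in> carrier (VG u)"
  using assms by (cases rule: walk_word.cases) auto

text \<open>Walk words begin and end with a group letter, so composing them puts two letters of the
  same vertex side by side; merging them restores the alternating form.\<close>

lemma walk_word_absorb:
  assumes "walk_word \<Y> u (Elem u a # w) v" "b \<in> carrier (VG u)"
  shows "walk_word \<Y> u (Elem u (b \<otimes>\<^bsub>VG u\<^esub> a) # w) v" "Elem u b # Elem u a # w \<sim> Elem u (b \<otimes>\<^bsub>VG u\<^esub> a) # w"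
proof -
  have u: "u \<in> verts (base \<Y>)" using walk_word_props[OF assms(1)] by simp
  have a: "a \<in> carrier (VG u)" using walk_word_head[OF assms(1)] by blast
  have ba: "b \<otimes>\<^bsub>VG u\<^esub> a \<in> carrier (VG u)" 
    using group.is_monoid[OF VG_group[OF u], THEN monoid.m_closed] a assms(2) by blast
  show "walk_word \<Y> u (Elem u (b \<otimes>\<^bsub>VG u\<^esub> a) # w) v"
    using assms(1)
  proof (cases rule: walk_word.cases)
    case Nil
    then show ?thesis using u ba walk_word.Nil by auto
  next
    case (Cons y w')
    then show ?thesis using ba walk_word.Cons by auto
  qed
  show "Elem u b # Elem u a # w \<sim> Elem u (b \<otimes>\<^bsub>VG u\<^esub> a) # w"
    using weq_cong[OF word_eq.vertex_mult[OF u assms(2) a], of "[]" w] by simp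
qed

lemma walk_word_append:
  assumes "walk_word \<Y> u w v" "walk_word \<Y> v x z"
  shows "\<exists>w'. walk_word \<Y> u w' z \<and> w @ x \<sim> w'"
  using assms
proof (induction rule: walk_word.induct)
  case (Nil v r)
  obtain a x' where "x = Elem v a # x'" using walk_word_head[OF Nil(3)] by blast
  then show ?case using walk_word_absorb[of v a x' z r] Nil by auto
next
  case (Cons y r w v)
  then obtain w' where w': "walk_word \<Y> (hd_of y) w' z" "w @ x \<sim> w'" by blast
  have "(Elem (tl_of y) r # Arc y # w) @ x \<sim> Elem (tl_of y) r # Arc y # w'"
    using word_eq.append[OF weq_refl w'(2), of "[Elem (tl_of y) r, Arc y]"] by simp
  then show ?case using walk_word.Cons[OF Cons(1,2) w'(1)] by blast
qed

lemma walk_word_inverse: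
  assumes "walk_word \<Y> u w v"
  shows "\<exists>w'. walk_word \<Y> v w' u \<and> w @ w' \<sim> []"
  using assms
proof (induction rule: walk_word.induct)
  case (Nil v r)
  interpret VG: group "VG v" using VG_group Nil by simp
  have "[Elem v r, Elem v (inv\<^bsub>VG v\<^esub> r)] \<sim> [Elem v \<one>\<^bsub>VG v\<^esub>]"
    using word_eq.vertex_mult[of v \<Y> r "inv\<^bsub>VG v\<^esub> r"] Nil by simp
  also have "\<dots> \<sim> []" using Nil by (rule_tac word_eq.vertex_one)
  finally show ?case using walk_word.Nil[of v \<Y> "inv\<^bsub>VG v\<^esub> r"] Nil by (intro exI[of _ "[Elem v (inv\<^bsub>VG v\<^esub> r)]"]) simp
next
  case (Cons y r w v)
  let ?u = "tl_of y" and ?v = "hd_of y" and ?y = "arc_rev \<Y> y"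
  have uv: "?u \<in> verts (base \<Y>)" "?v \<in> verts (base \<Y>)" using Cons(1) by auto
  interpret VG: group "VG ?u" using VG_group uv by simp
  interpret VGv: group "VG ?v" using VG_group uv by simp
  obtain w' where w': "walk_word \<Y> v w' ?v" "w @ w' \<sim> []" using Cons by blast
  \<comment> \<open>The first step \<open>r\<close>, \<open>y\<close> reversed; the trivial letter
    keeps the alternating form.\<close>
  let ?x = "[Elem ?v \<one>\<^bsub>VG ?v\<^esub>, Arc ?y, Elem ?u (inv\<^bsub>VG ?u\<^esub> r)]"
  have "walk_word \<Y> ?v ?x ?u"
    using walk_word.Cons[of ?y \<Y> "\<one>\<^bsub>VG ?v\<^esub>" "[Elem ?u (inv\<^bsub>VG ?u\<^esub> r)]" ?u] walk_word.Nil[of ?u \<Y> "inv\<^bsub>VG ?u\<^esub> r"] Cons(1,2) uv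
    by simp
  from walk_word_append[OF w'(1) this] obtain w'' where w'': "walk_word \<Y> v w'' ?u" "w' @ ?x \<sim> w''" by blast
  have "(Elem ?u r # Arc y # w) @ w'' \<sim> (Elem ?u r # Arc y # w) @ w' @ ?x"
    using word_eq.append[OF weq_refl word_eq.sym[OF w''(2)]] .
  also have "(Elem ?u r # Arc y # w) @ w' @ ?x \<sim> [Elem ?u r, Arc y] @ ?x"
    using weq_cong[OF w'(2), of "[Elem ?u r, Arc y]" ?x] by simp
  also have "[Elem ?u r, Arc y] @ ?x \<sim> [Elem ?u r, Arc y] @ [Arc ?y, Elem ?u (inv\<^bsub>VG ?u\<^esub> r)]"
    using weq_cong[OF word_eq.vertex_one[OF uv(2)], of "[Elem ?u r, Arc y]" "[Arc ?y, Elem ?u (inv\<^bsub>VG ?u\<^esub> r)]"] by simp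
  also have "[Elem ?u r, Arc y] @ [Arc ?y, Elem ?u (inv\<^bsub>VG ?u\<^esub> r)] \<sim> [Elem ?u r, Elem ?u (inv\<^bsub>VG ?u\<^esub> r)]"
    using weq_cong[OF word_eq.arc_inverse[OF Cons(1)], of "[Elem ?u r]" "[Elem ?u (inv\<^bsub>VG ?u\<^esub> r)]"] by simp
  also have "[Elem ?u r, Elem ?u (inv\<^bsub>VG ?u\<^esub> r)] \<sim> [Elem ?u \<one>\<^bsub>VG ?u\<^esub>]"
    using word_eq.vertex_mult[of ?u \<Y> r "inv\<^bsub>VG ?u\<^esub> r"] uv Cons(2) by simp
  also have "\<dots> \<sim> []" using uv by (rule_tac word_eq.vertex_one)
  finally show ?case using w''(1) by blast
qed

text \<open>The walk in the tree described by a word: the path of each remainder is translated by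
  the value of the step before it. The last group letter leaves no trace, as it fixes its
  node.\<close>

fun node_path :: "('n, 'e, 'a) letter list \<Rightarrow> 'x list" where
  "node_path (Elem v r # Arc y # w) = lift v # map (act (dec v r \<otimes> t y)) (node_path w)"
| "node_path [Elem v r] = [lift v]"
| "node_path _ = []"

lemma node_path_props:
  assumes "walk_word \<Y> u w v"
  shows "node_path w \<noteq> [] \<and> hd (node_path w) = lift u \<and> last (node_path w) = act (ev w) (lift v) \<and>
    set (node_path w) \<subseteq> N \<and> successively (\<lambda>x y. (x, y) \<in> A) (node_path w)"
  using assms
proof (induction rule: walk_word.induct)
  case (Nil v r)
  then show ?case using lift_in dec_fixes dec_closed by simp
next
  case (Cons y r w v)
  let ?g = "dec (tl_of y) r \<otimes> t y"
  have uv: "tl_of y \<in> verts (base \<Y>)" "hd_of y \<in> verts (base \<Y>)" using Cons(1) by auto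
  have dr: "dec (tl_of y) r \<in> carrier G" using dec_closed uv Cons by simp
  have g: "?g \<in> carrier G" using dr t_closed[OF Cons(1)] by simp
  have w: "ev w \<in> carrier G" using ev_closed walk_word_props[OF Cons(3)] by blast
  obtain p ps where p: "node_path w = p # ps" "p = lift (hd_of y)" using Cons.IH by (cases "node_path w") auto
  have "act ?g p = act (dec (tl_of y) r) (act (t y) (lift (hd_of y)))"
    using p act_mult[OF dr t_closed[OF Cons(1)] lift_in[OF uv(2)]] by simp
  then have "(lift (tl_of y), act ?g p) \<in> A"
    using adj_act[OF dr t_adj[OF Cons(1)]] dec_fixes[OF uv(1) Cons(2)] by simp
  moreover have "successively (\<lambda>x y. (x, y) \<in> A) (map (act ?g) (node_path w))"
    using Cons.IH adj_act[OF g] by (auto simp: successively_map elim: successively_mono)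
  moreover have "last (map (act ?g) (node_path w)) = act (?g \<otimes> ev w) (lift v)"
    using Cons.IH act_mult[OF g w lift_in[OF walk_word_props(2)[OF Cons(3)]]] by (simp add: last_map)
  moreover have "ev (Elem (tl_of y) r # Arc y # w) = ?g \<otimes> ev w"
    using dr t_closed[OF Cons(1)] w by (simp add: m_assoc)
  moreover have "set (node_path (Elem (tl_of y) r # Arc y # w)) \<subseteq> N"
    using Cons.IH act_closed[OF g] lift_in[OF uv(1)] by auto
  ultimately show ?case using p by simp
qed

text \<open>Multiplying the first letter by \<open>b\<close> translates the whole path by an element
  that fixes its first node.\<close>

lemma node_path_absorb:
  assumes "walk_word \<Y> u (Elem u a # w) v" "b \<in> carrier (VG u)"
  shows "nonbacktracking (node_path (Elem u (b \<otimes>\<^bsub>VG u\<^esub> a) # w)) \<longleftrightarrow> nonbacktracking (node_path (Elem u a # w))"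
  using assms(1)
proof (cases rule: walk_word.cases)
  case (Cons y w')
  have y: "y \<in> arcs (base \<Y>)" "tl_of y = u" "walk_word \<Y> (hd_of y) w' v" "w = Arc y # w'" "a \<in> carrier (VG u)" using Cons by auto
  have u: "u \<in> verts (base \<Y>)" using y by auto
  have g: "dec u b \<in> carrier G" "dec u a \<otimes> t y \<in> carrier G" using dec_closed u y assms(2) t_closed by auto
  have N: "set (node_path w') \<subseteq> N" using node_path_props[OF y(3)] by blast
  have "dec u (b \<otimes>\<^bsub>VG u\<^esub> a) \<otimes> t y = dec u b \<otimes> (dec u a \<otimes> t y)"
    using dec_mult[OF u assms(2) y(5)] dec_closed u y assms(2) t_closed by (simp add: m_assoc)
  then have "node_path (Elem u (b \<otimes>\<^bsub>VG u\<^esub> a) # w) = lift u # map (\<lambda>x. act (dec u b) (act (dec u a \<otimes> t y) x)) (node_path w')"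
    using y(4) N act_mult[OF g] by auto
  also have "\<dots> = map (act (dec u b)) (node_path (Elem u a # w))"
    using y(4) dec_fixes[OF u assms(2)] by simp
  finally show ?thesis
    using nonbacktracking_map[OF inj_on_subset[OF act_inj[OF g(1)]]] node_path_props[OF assms(1)] by simp
qed auto

text \<open>Built from the right, a reduced word can acquire a backtrack only at its front. There
  the next arc must be the reverse of \<open>y\<close> and the letter in between must come from the
  edge group, so \<open>arc_conj\<close> removes both arcs.\<close>

lemma walk_word_reduce:
  assumes "walk_word \<Y> u w v"
  shows "\<exists>w'. walk_word \<Y> u w' v \<and> w \<sim> w' \<and> nonbacktracking (node_path w')"
  using assms
proof (induction rule: walk_word.induct)
  case (Nil v r)
  then show ?case using walk_word.Nil[OF Nil] weq_refl by (intro exI[of _ "[Elem v r]"]) simp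
next
  case (Cons y r w v)
  let ?u = "tl_of y" and ?v = "hd_of y" and ?y = "arc_rev \<Y> y"
  obtain w' where w': "walk_word \<Y> ?v w' v" "w \<sim> w'" "nonbacktracking (node_path w')" using Cons by blast
  have uv: "?u \<in> verts (base \<Y>)" "?v \<in> verts (base \<Y>)" using Cons(1) by auto
  have dr: "dec ?u r \<in> carrier G" using dec_closed uv Cons by simp
  have ty: "t y \<in> carrier G" using t_closed[OF Cons(1)] .
  let ?g = "dec ?u r \<otimes> t y"
  have g: "?g \<in> carrier G" using dr ty by simp
  let ?n = "Elem ?u r # Arc y # w'"
  have n: "walk_word \<Y> ?u ?n v" using walk_word.Cons[OF Cons(1,2) w'(1)] .
  have wn: "Elem ?u r # Arc y # w \<sim> ?n"
    using word_eq.append[OF weq_refl w'(2), of "[Elem ?u r, Arc y]"] by simp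
  have nb: "nonbacktracking (map (act ?g) (node_path w'))"
    using nonbacktracking_map[OF inj_on_subset[OF act_inj[OF g]]] node_path_props[OF w'(1)] w'(3) by simp
  show ?case
  proof (cases "nonbacktracking (node_path ?n)")
    case True
    then show ?thesis using n wn by blast
  next
    case False
    from w'(1) show ?thesis
    proof (cases rule: walk_word.cases)
      case (Nil s)
      then show ?thesis using False by simp
    next
      case (Cons y' s w'')
      have y': "y' \<in> arcs (base \<Y>)" "tl_of y' = ?v" "walk_word \<Y> (hd_of y') w'' v" "w' = Elem ?v s # Arc y' # w''"
        "s \<in> carrier (VG ?v)" using Cons by auto
      have v': "hd_of y' \<in> verts (base \<Y>)" using y'(1) by auto
      have ds: "dec ?v s \<in> carrier G" using dec_closed uv y' by simp
      have ty': "t y' \<in> carrier G" using t_closed[OF y'(1)] .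
      obtain ps where ps: "node_path w'' = lift (hd_of y') # ps"
        using node_path_props[OF y'(3)] by (cases "node_path w''") auto
      have np: "node_path w' = lift ?v # map (act (dec ?v s \<otimes> t y')) (node_path w'')" using y'(4) by simp
      \<comment> \<open>The translated rest of the path has no backtracking, so the failure concerns
        the first three nodes.\<close>
      have eq: "lift ?u = act ?g (act (dec ?v s \<otimes> t y') (lift (hd_of y')))"
        using False nb np ps by simp
      then have "lift ?u = act (?g \<otimes> (dec ?v s \<otimes> t y')) (lift (hd_of y'))"
        using act_mult[OF g _ lift_in[OF v']] ds ty' by simp
      then have hd: "hd_of y' = ?u" using lift_inj[OF v' uv(1), of "?g \<otimes> (dec ?v s \<otimes> t y')"] g ds ty' by simp
      \<comment> \<open>Seen from \<open>lift ?v\<close>, the step along \<open>y'\<close> and the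
        reversed step of \<open>y\<close> end at the same node.\<close>
      have "act (dec ?v s) (act (t y') (lift ?u)) = act (inv ?g) (lift ?u)"
        using eq hd act_inv(1)[OF g, of "act (dec ?v s \<otimes> t y') (lift ?u)"] act_closed lift_in[OF uv(1)] ds ty'
          act_mult[OF ds ty' lift_in[OF uv(1)]] by simp
      also have "inv ?g = inv (t y) \<otimes> inv (dec ?u r)" using dr ty by (simp add: inv_mult_group)
      also have "act (inv (t y) \<otimes> inv (dec ?u r)) (lift ?u) = act (inv (t y)) (lift ?u)"
        using act_mult[OF _ _ lift_in[OF uv(1)], of "inv (t y)" "inv (dec ?u r)"] dr ty
          act_inv(1)[OF dr lift_in[OF uv(1)]] dec_fixes[OF uv(1) \<open>r \<in> carrier (VG ?u)\<close>] by simp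
      finally have st: "act (dec ?v s) (act (t y') (lift ?u)) = act (inv (t y)) (lift ?u)" .
      then have yy: "y' = ?y"
        using arc_unique[of y' ?y s] y' hd Cons.hyps(1) t_rev by simp
      then have "act (dec ?v s) (act (inv (t y)) (lift ?u)) = act (inv (t y)) (lift ?u)"
        using st t_rev Cons.hyps(1) by simp
      from edge_stab[OF Cons.hyps(1) y'(5) this] obtain a where a: "a \<in> carrier (edge_group \<Y> y)" "s = edge_emb \<Y> y a" by blast
      let ?b = "edge_emb \<Y> ?y a"
      have b: "?b \<in> carrier (VG ?u)" using emb_rev_closed Cons.hyps(1) a by simp
      have w2: "walk_word \<Y> ?u w'' v" using y'(3) hd by simp
      then obtain c w3 where c: "w'' = Elem ?u c # w3" "c \<in> carrier (VG ?u)" using walk_word_head by blast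
      let ?z = "Elem ?u (?b \<otimes>\<^bsub>VG ?u\<^esub> c) # w3"
      have z: "walk_word \<Y> ?u ?z v" "Elem ?u ?b # w'' \<sim> ?z" using walk_word_absorb[of ?u c w3 v ?b] w2 c b by auto
      let ?z' = "Elem ?u (r \<otimes>\<^bsub>VG ?u\<^esub> (?b \<otimes>\<^bsub>VG ?u\<^esub> c)) # w3"
      have z': "walk_word \<Y> ?u ?z' v" "Elem ?u r # ?z \<sim> ?z'" using walk_word_absorb[OF z(1) \<open>r \<in> carrier (VG ?u)\<close>] by auto
      have "?n \<sim> [Elem ?u r] @ (Elem ?u ?b # w'')"
        using weq_cong[OF word_eq.arc_conj[OF Cons.hyps(1) a(1)], of "[Elem ?u r]" w''] y'(4) yy a(2) by simp
      also have "[Elem ?u r] @ (Elem ?u ?b # w'') \<sim> [Elem ?u r] @ ?z" using word_eq.append[OF weq_refl z(2)] .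
      also have "[Elem ?u r] @ ?z \<sim> ?z'" using z'(2) by simp
      finally have "Elem ?u r # Arc y # w \<sim> ?z'" using wn word_eq.trans by blast
      moreover have "dec ?v s \<otimes> t y' \<in> carrier G" using ds ty' by simp
      then have "nonbacktracking (node_path w'')"
        using w'(3) np nonbacktracking_Cons nonbacktracking_map[OF inj_on_subset[OF act_inj]] node_path_props[OF y'(3)] by metis
      then have "nonbacktracking (node_path ?z')"
        using node_path_absorb[OF z(1) \<open>r \<in> carrier (VG ?u)\<close>] node_path_absorb[of ?u c w3 v ?b] w2 c b by simp
      ultimately show ?thesis using z'(1) by blast
    qed
  qed
qed

text \<open>The path of the reduced word is closed and has no backtracking, hence is a single node.
  The word is then one letter of the vertex group, on which \<open>dec\<close> is injective.\<close>

lemma walk_word_kernel: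
  assumes "walk_word \<Y> v w v" "ev w = \<one>"
  shows "w \<sim> []"
proof -
  obtain w' where w': "walk_word \<Y> v w' v" "w \<sim> w'" "nonbacktracking (node_path w')"
    using walk_word_reduce[OF assms(1)] by blast
  have v: "v \<in> verts (base \<Y>)" using walk_word_props[OF assms(1)] by simp
  have ev: "ev w' = \<one>" using word_eq_ev[OF w'(2)] walk_word_props[OF assms(1)] assms(2) by simp
  then have "hd (node_path w') = last (node_path w')"
    using node_path_props[OF w'(1)] act_one[OF lift_in[OF v]] by simp
  then have len: "length (node_path w') < 2"
    using adj_acyclic[of "node_path w'"] node_path_props[OF w'(1)] w'(3) by linarith
  from w'(1) show ?thesis
  proof (cases rule: walk_word.cases)
    case (Nil r)
    then have r: "w' = [Elem v r]" "r \<in> carrier (VG v)" by auto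
    then have "dec v r = \<one>" using ev dec_closed[OF v] by simp
    then have "dec v r = dec v \<one>\<^bsub>VG v\<^esub>" using dec_one[OF v] by simp
    then have "r = \<one>\<^bsub>VG v\<^esub>"
      using inj_onD[OF dec_inj[OF v]] r(2) group.is_monoid[OF VG_group[OF v], THEN monoid.one_closed] by blast
    then show ?thesis using word_eq.trans[OF w'(2)] word_eq.vertex_one[OF v] r(1) by simp
  next
    case (Cons y r w'')
    then show ?thesis using len node_path_props[of "hd_of y" w'' v] by (cases "node_path w''") auto
  qed
qed

lemma ev_inverse:
  assumes "walk_word \<Y> u w v" "walk_word \<Y> v w' u" "w @ w' \<sim> []"
  shows "ev w \<otimes> ev w' = \<one>"
  using word_eq_ev[OF assms(3)] ev_append walk_word_props[OF assms(1)] walk_word_props[OF assms(2)] by simp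

lemma walk_word_inj:
  assumes "walk_word \<Y> v w v" "walk_word \<Y> v x v" "ev w = ev x"
  shows "w \<sim> x"
proof -
  obtain x' where x': "walk_word \<Y> v x' v" "x @ x' \<sim> []" using walk_word_inverse[OF assms(2)] by blast
  \<comment> \<open>\<open>walk_word_inverse\<close> yields right inverses only; \<open>x''\<close>
    is needed to cancel \<open>x'\<close> again.\<close>
  obtain x'' where x'': "walk_word \<Y> v x'' v" "x' @ x'' \<sim> []" using walk_word_inverse[OF x'(1)] by blast
  obtain z where z: "walk_word \<Y> v z v" "w @ x' \<sim> z" using walk_word_append[OF assms(1) x'(1)] by blast
  have L: "w \<in> lists (letters \<Y>)" "x' \<in> lists (letters \<Y>)" using walk_word_props assms(1) x'(1) by blast+
  then have "ev z = ev w \<otimes> ev x'" using word_eq_ev[OF z(2)] ev_append[OF L] by auto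
  then have "ev z = \<one>" using ev_inverse[OF assms(2) x'] assms(3) by simp
  then have wx': "w @ x' \<sim> []" using walk_word_kernel[OF z(1)] word_eq.trans[OF z(2)] by blast
  have "w \<sim> w @ x' @ x''" using word_eq.append[OF weq_refl word_eq.sym[OF x''(2)], of w] by simp
  also have "w @ x' @ x'' \<sim> x''" using word_eq.append[OF wx' weq_refl, of x''] by simp
  also have "x'' \<sim> x @ x' @ x''" using word_eq.append[OF word_eq.sym[OF x'(2)] weq_refl, of x''] by simp
  also have "x @ x' @ x'' \<sim> x" using word_eq.append[OF weq_refl x''(2), of x] by simp
  finally show ?thesis .
qed

text \<open>Path lifting: \<open>g\<close> accumulates the value of the prefix read so far, so it is
  kept arbitrary in the induction.\<close>

lemma walk_word_to:
  assumes "(x, z) \<in> A\<^sup>*" "z \<in> N"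
  shows "\<forall>u \<in> verts (base \<Y>). \<forall>g \<in> carrier G. x = act g (lift u) \<longrightarrow>
    (\<exists>w v. walk_word \<Y> u w v \<and> z = act (g \<otimes> ev w) (lift v))"
  using assms
proof (induction rule: converse_rtrancl_induct)
  case base
  show ?case
  proof (intro ballI impI)
    fix u g assume u: "u \<in> verts (base \<Y>)" "g \<in> carrier G" "z = act g (lift u)"
    have "walk_word \<Y> u [Elem u \<one>\<^bsub>VG u\<^esub>] u"
      using walk_word.Nil[OF u(1) group.is_monoid[OF VG_group[OF u(1)], THEN monoid.one_closed]] .
    then show "\<exists>w v. walk_word \<Y> u w v \<and> z = act (g \<otimes> ev w) (lift v)"
      using u dec_one by (intro exI[of _ "[Elem u \<one>\<^bsub>VG u\<^esub>]"] exI[of _ u]) simp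
  qed
next
  case (step x x1)
  show ?case
  proof (intro ballI impI)
    fix u g assume u: "u \<in> verts (base \<Y>)" and g: "g \<in> carrier G" and x: "x = act g (lift u)"
    have N: "x \<in> N" "x1 \<in> N" using step(1) adj_sub by auto
    have "(lift u, act (inv g) x1) \<in> A"
      using adj_act[OF _ step(1), of "inv g"] g x act_inv(1)[OF g lift_in[OF u]] by simp
    from arc_ex[OF u this] obtain y a where y: "y \<in> arcs (base \<Y>)" "a \<in> carrier (VG u)" "tl_of y = u"
      "act (inv g) x1 = act (dec u a) (act (t y) (lift (hd_of y)))" by blast
    have v: "hd_of y \<in> verts (base \<Y>)" using y(1) by auto
    have c: "dec u a \<in> carrier G" "t y \<in> carrier G" using dec_closed[OF u y(2)] t_closed[OF y(1)] by auto
    let ?g = "g \<otimes> (dec u a \<otimes> t y)"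
    have "act (inv g) x1 = act (dec u a \<otimes> t y) (lift (hd_of y))" using y(4) act_mult[OF c lift_in[OF v]] by simp
    then have "x1 = act g (act (dec u a \<otimes> t y) (lift (hd_of y)))" using act_inv(2)[OF g N(2)] by simp
    also have "\<dots> = act ?g (lift (hd_of y))" using act_mult[OF g _ lift_in[OF v]] c by simp
    finally have "x1 = act ?g (lift (hd_of y))" .
    moreover have gc: "?g \<in> carrier G" using g c by simp
    ultimately obtain w v' where w: "walk_word \<Y> (hd_of y) w v'" "z = act (?g \<otimes> ev w) (lift v')"
      using step.IH step.prems v by blast
    have "walk_word \<Y> u (Elem u a # Arc y # w) v'" using walk_word.Cons[OF y(1) _ w(1), of a] y by simp
    moreover have "?g \<otimes> ev w = g \<otimes> ev (Elem u a # Arc y # w)"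
      using g c ev_closed[OF walk_word_props(3)[OF w(1)]] by (simp add: m_assoc)
    ultimately show "\<exists>w v. walk_word \<Y> u w v \<and> z = act (g \<otimes> ev w) (lift v)" using w(2) by metis
  qed
qed

text \<open>A tree walk from \<open>lift v\<close> to its translate gives a word whose value agrees
  with \<open>g\<close> up to the stabilizer of \<open>lift v\<close>; one more letter corrects the
  difference.\<close>

lemma walk_word_surj:
  assumes v: "v \<in> verts (base \<Y>)" and g: "g \<in> carrier G"
  shows "\<exists>w. walk_word \<Y> v w v \<and> ev w = g"
proof -
  have "(lift v, act g (lift v)) \<in> A\<^sup>*" using adj_conn lift_in[OF v] act_closed[OF g] by blast
  from walk_word_to[OF this] obtain w v' where w: "walk_word \<Y> v w v'" "act g (lift v) = act (\<one> \<otimes> ev w) (lift v')"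
    using v act_one[OF lift_in[OF v]] act_closed[OF g lift_in[OF v]] by (metis one_closed)
  have e: "ev w \<in> carrier G" and v': "v' \<in> verts (base \<Y>)" using ev_closed walk_word_props[OF w(1)] by blast+
  have eq: "act (inv (ev w) \<otimes> g) (lift v) = lift v'"
    using w(2) act_mult[of "inv (ev w)" g "lift v"] e g lift_in v v' act_inv(1)[OF e] by simp
  then have vv: "v' = v" using lift_inj[OF v v', of "inv (ev w) \<otimes> g"] e g by simp
  have "inv (ev w) \<otimes> g \<in> dec v ` carrier (VG v)"
    unfolding dec_image[OF v] using eq vv e g by simp
  then obtain s where s: "s \<in> carrier (VG v)" "dec v s = inv (ev w) \<otimes> g" by (elim imageE) simp
  have s': "walk_word \<Y> v [Elem v s] v" using walk_word.Nil[OF v s(1)] .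
  obtain w' where w': "walk_word \<Y> v w' v" "w @ [Elem v s] \<sim> w'"
    using walk_word_append[OF _ s', of v w] w(1) vv by blast
  have L: "w \<in> lists (letters \<Y>)" "[Elem v s] \<in> lists (letters \<Y>)" using walk_word_props[OF w(1)] walk_word_props[OF s'] by blast+
  then have "ev w' = ev (w @ [Elem v s])" using word_eq_ev[OF w'(2)] by simp
  also have "\<dots> = ev w \<otimes> (inv (ev w) \<otimes> g)" using ev_append[OF L] s e g by simp
  also have "\<dots> = g" using e g by (simp add: m_assoc[symmetric])
  finally show ?thesis using w'(1) by blast
qed

section \<open>The isomorphism with the fundamental group\<close>

lemma word_class_eq: "w \<sim> w' \<Longrightarrow> word_class \<Y> w = word_class \<Y> w'"
  unfolding word_class_def by (auto intro: word_eq.trans word_eq.sym)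

lemma word_class_eqD: "word_class \<Y> w = word_class \<Y> w' \<Longrightarrow> w \<sim> w'"
  unfolding word_class_def using word_eq.refl by blast

lemma word_class_mult:
  "(\<Union>w \<in> word_class \<Y> a. \<Union>x \<in> word_class \<Y> b. word_class \<Y> (w @ x)) = word_class \<Y> (a @ b)"
proof -
  have "word_class \<Y> (w @ x) = word_class \<Y> (a @ b)" if "w \<in> word_class \<Y> a" "x \<in> word_class \<Y> b" for w x
    using that word_class_eq word_eq.append word_eq.sym unfolding word_class_def mem_Collect_eq by metis
  moreover have "a \<in> word_class \<Y> a" "b \<in> word_class \<Y> b" using word_eq.refl by (auto simp: word_class_def)
  ultimately show ?thesis by blast
qed

theorem iso_fundamental_group:
  assumes v: "v \<in> verts (base \<Y>)"
  shows "G \<cong> fundamental_group \<Y> v"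
proof -
  \<comment> \<open>The isomorphism is the inverse of evaluation; by injectivity of evaluation the
    class does not depend on the word picked.\<close>
  define word where "word g = (SOME w. walk_word \<Y> v w v \<and> ev w = g)" for g
  have word: "walk_word \<Y> v (word g) v" "ev (word g) = g" if "g \<in> carrier G" for g
    using someI_ex[OF walk_word_surj[OF v that]] by (auto simp: word_def)
  define \<Theta> where "\<Theta> g = word_class \<Y> (word g)" for g
  have eqI: "word_class \<Y> w = \<Theta> g" if "walk_word \<Y> v w v" "ev w = g" "g \<in> carrier G" for w g
    unfolding \<Theta>_def
    by (rule word_class_eq, rule walk_word_inj[OF that(1) word(1)[OF that(3)]]) (simp add: word(2)[OF that(3)] that(2))
  have hom: "\<Theta> (g \<otimes> h) = \<Theta> g \<otimes>\<^bsub>fundamental_group \<Y> v\<^esub> \<Theta> h" if g: "g \<in> carrier G" and h: "h \<in> carrier G" for g h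
  proof -
    obtain w where w: "walk_word \<Y> v w v" "word g @ word h \<sim> w" using walk_word_append[OF word(1)[OF g] word(1)[OF h]] by blast
    have L: "word g \<in> lists (letters \<Y>)" "word h \<in> lists (letters \<Y>)"
      using walk_word_props(3)[OF word(1)] g h by blast+
    then have "ev w = g \<otimes> h"
      using word_eq_ev[OF w(2)] ev_append[OF L] word(2)[OF g] word(2)[OF h] append_in_lists_conv by metis
    then have "\<Theta> (g \<otimes> h) = word_class \<Y> (word g @ word h)" using eqI[OF w(1)] g h word_class_eq[OF w(2)] by simp
    then show ?thesis
      by (simp add: fundamental_group_def word_group_def \<Theta>_def word_class_mult)
  qed
  have "bij_betw \<Theta> (carrier G) (carrier (fundamental_group \<Y> v))"
  proof (rule bij_betwI')
    fix g h assume g: "g \<in> carrier G" and h: "h \<in> carrier G"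
    show "\<Theta> g = \<Theta> h \<longleftrightarrow> g = h"
    proof
      assume "\<Theta> g = \<Theta> h"
      then have "word g \<sim> word h" by (intro word_class_eqD) (simp add: \<Theta>_def)
      then show "g = h" using word_eq_ev walk_word_props(3)[OF word(1)[OF g]] word(2) g h by metis
    qed simp
  next
    fix g assume "g \<in> carrier G"
    then show "\<Theta> g \<in> carrier (fundamental_group \<Y> v)" using word(1) by (auto simp: fundamental_group_def \<Theta>_def)
  next
    fix X assume "X \<in> carrier (fundamental_group \<Y> v)"
    then obtain w where w: "walk_word \<Y> v w v" "X = word_class \<Y> w" by (auto simp: fundamental_group_def)
    then show "\<exists>g \<in> carrier G. X = \<Theta> g" using eqI[OF w(1)] ev_closed walk_word_props[OF w(1)] by metis
  qed
  moreover from this have "\<Theta> \<in> hom G (fundamental_group \<Y> v)"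
    using hom by (auto simp: hom_def bij_betw_def)
  ultimately show ?thesis by (auto simp: is_iso_def iso_def)
qed

end

section \<open>The quotient graph of groups\<close>

lemma (in wf_digraph) rtrancl_reachable:
  assumes "(u, v) \<in> (arcs_ends G)\<^sup>*" "u \<in> verts G"
  shows "u \<rightarrow>\<^sup>* v"
  using assms(1)
proof (induction rule: rtrancl_induct)
  case (step y z)
  then show ?case by (blast intro: reachable_adj_trans)
qed (use assms in simp)

lemma (in wf_digraph) connectedI_rtrancl:
  assumes "verts G \<noteq> {}" "\<And>u v. u \<in> verts G \<Longrightarrow> v \<in> verts G \<Longrightarrow> (u, v) \<in> (arcs_ends G)\<^sup>*"
  shows "connected G"
  unfolding connected_def
proof (rule strongly_connectedI)
  fix u v assume "u \<in> verts (with_proj (mk_symmetric G))" "v \<in> verts (with_proj (mk_symmetric G))"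
  then have "u \<in> verts G" "v \<in> verts G" by (simp_all add: mk_symmetric_def)
  then show "u \<rightarrow>\<^sup>*\<^bsub>mk_symmetric G\<^esub> v" using assms(2) rtrancl_reachable reachable_mk_symmetricI by blast
qed (use assms in \<open>simp add: mk_symmetric_def\<close>)

text \<open>The condition that defines the choice for \<open>x\<close> is equivalent to the one for
  \<open>act g x\<close>, so the choice operator returns the same element on a whole orbit.\<close>

lemma (in group) orbit_representatives:
  fixes act :: "'a \<Rightarrow> 'x \<Rightarrow> 'x"
  assumes closed: "\<And>g x. \<lbrakk>g \<in> carrier G; x \<in> X\<rbrakk> \<Longrightarrow> act g x \<in> X"
    and one: "\<And>x. x \<in> X \<Longrightarrow> act \<one> x = x"
    and mult: "\<And>g h x. \<lbrakk>g \<in> carrier G; h \<in> carrier G; x \<in> X\<rbrakk> \<Longrightarrow> act (g \<otimes> h) x = act g (act h x)"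
    and F: "F \<subseteq> X" "\<forall>x \<in> X. \<exists>f \<in> F. \<exists>g \<in> carrier G. act g f = x"
  shows "\<exists>r. r ` X \<subseteq> F \<and> (\<forall>x \<in> X. \<exists>g \<in> carrier G. act g (r x) = x) \<and> (\<forall>g \<in> carrier G. \<forall>x \<in> X. r (act g x) = r x)"
proof -
  define r where "r x = (SOME f. f \<in> F \<and> (\<exists>g \<in> carrier G. act g f = x))" for x
  have r: "r x \<in> F \<and> (\<exists>g \<in> carrier G. act g (r x) = x)" if "x \<in> X" for x
    unfolding r_def by (rule someI_ex) (use F(2) that in blast)
  have orb: "(\<exists>h \<in> carrier G. act h f = act g x) \<longleftrightarrow> (\<exists>h \<in> carrier G. act h f = x)" if "g \<in> carrier G" "x \<in> X" "f \<in> F" for f g x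
  proof
    assume "\<exists>h \<in> carrier G. act h f = act g x"
    then obtain h where h: "h \<in> carrier G" "act h f = act g x" by blast
    then have "act (inv g \<otimes> h) f = x"
      using mult[of "inv g" h f] mult[of "inv g" g x] one that F by (auto simp: subset_iff)
    then show "\<exists>h \<in> carrier G. act h f = x" using h that by blast
  next
    assume "\<exists>h \<in> carrier G. act h f = x"
    then obtain h where h: "h \<in> carrier G" "act h f = x" by blast
    then have "act (g \<otimes> h) f = act g x" using mult[of g h f] that F by auto
    then show "\<exists>h \<in> carrier G. act h f = act g x" using h that by blast
  qed
  have "r (act g x) = r x" if "g \<in> carrier G" "x \<in> X" for g x
  proof -
    have "(f \<in> F \<and> (\<exists>h \<in> carrier G. act h f = act g x)) = (f \<in> F \<and> (\<exists>h \<in> carrier G. act h f = x))" for f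
      using orb[OF that] by (cases "f \<in> F") simp_all
    then show ?thesis unfolding r_def by simp
  qed
  then show ?thesis using r by (intro exI[of _ r]) blast
qed

text \<open>All arcs of \<open>Ap\<close> point out of the invariant class \<open>N0\<close>. Hence
  no group element inverts an edge, and an arc and its reverse lie in different orbits.\<close>

locale tree_action = group G
  for G :: "('g, 'm) monoid_scheme" (structure) +
  fixes N :: "'x set" and N0 :: "'x set" and Ap :: "('x \<times> 'x) set" and act :: "'g \<Rightarrow> 'x \<Rightarrow> 'x"
  assumes act_closed: "\<lbrakk>g \<in> carrier G; x \<in> N\<rbrakk> \<Longrightarrow> act g x \<in> N"
    and act_one: "x \<in> N \<Longrightarrow> act \<one> x = x"
    and act_mult: "\<lbrakk>g \<in> carrier G; h \<in> carrier G; x \<in> N\<rbrakk> \<Longrightarrow> act (g \<otimes> h) x = act g (act h x)"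
    and nonempty: "N \<noteq> {}"
    and adj_sub: "Ap \<subseteq> N \<times> N"
    and bipartite: "(x, z) \<in> Ap \<Longrightarrow> x \<in> N0 \<and> z \<notin> N0"
    and act_N0: "\<lbrakk>g \<in> carrier G; x \<in> N0\<rbrakk> \<Longrightarrow> act g x \<in> N0"
    and adj_act: "\<lbrakk>g \<in> carrier G; (x, z) \<in> Ap\<rbrakk> \<Longrightarrow> (act g x, act g z) \<in> Ap"
    and adj_conn: "\<lbrakk>x \<in> N; z \<in> N\<rbrakk> \<Longrightarrow> (x, z) \<in> (Ap \<union> Ap\<inverse>)\<^sup>*"
    and adj_acyclic: "\<lbrakk>successively (\<lambda>x z. (x, z) \<in> Ap \<union> Ap\<inverse>) xs; nonbacktracking xs; length xs \<ge> 2\<rbrakk> \<Longrightarrow> hd xs \<noteq> last xs"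
    and finite_stab: "x \<in> N \<Longrightarrow> finite {g \<in> carrier G. act g x = x}"
    and nodes_cofinite: "\<exists>F \<subseteq> N. finite F \<and> (\<forall>x \<in> N. \<exists>f \<in> F. \<exists>g \<in> carrier G. act g f = x)"
    and arcs_cofinite: "\<exists>F \<subseteq> Ap. finite F \<and> (\<forall>e \<in> Ap. \<exists>f \<in> F. \<exists>g \<in> carrier G. map_prod (act g) (act g) f = e)"
begin

definition stab :: "'x \<Rightarrow> 'g set" where
  "stab x = {g \<in> carrier G. act g x = x}"

lemma act_inv: "g \<in> carrier G \<Longrightarrow> x \<in> N \<Longrightarrow> act (inv g) (act g x) = x"
  "g \<in> carrier G \<Longrightarrow> x \<in> N \<Longrightarrow> act g (act (inv g) x) = x"
  using act_mult[of "inv g" g x] act_mult[of g "inv g" x] act_one by auto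

lemma subgroup_stab: "x \<in> N \<Longrightarrow> subgroup (stab x) G"
  using act_one act_mult act_inv(1)[of _ x] by (intro subgroupI) (auto simp: stab_def, metis)

end

text \<open>
  The data from which the quotient graph of groups is built: \<open>rep\<close> picks a node from each node
  orbit, \<open>P\<close> contains one arc from each orbit of arcs, always starting at a chosen node, and
  \<open>\<tau> p\<close> moves a chosen node to the end of \<open>p\<close>. The injections \<open>\<nu>\<close>, \<open>\<pi>\<close> and \<open>enc\<close> encode nodes,
  oriented arcs and group elements as natural numbers.
\<close>

locale quotient_data = tree_action G N N0 Ap act
  for G :: "('g, 'm) monoid_scheme" (structure) and N N0 :: "'x set" and Ap act +
  fixes rep :: "'x \<Rightarrow> 'x" and P :: "('x \<times> 'x) set" and \<tau> :: "'x \<times> 'x \<Rightarrow> 'g"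
    and \<nu> :: "'x \<Rightarrow> nat" and \<pi> :: "('x \<times> 'x) \<times> bool \<Rightarrow> nat" and enc :: "'g \<Rightarrow> nat"
  assumes finite_rep: "finite (rep ` N)"
    and rep_in: "x \<in> N \<Longrightarrow> rep x \<in> N"
    and rep_orbit: "x \<in> N \<Longrightarrow> \<exists>g \<in> carrier G. act g (rep x) = x"
    and rep_act: "\<lbrakk>g \<in> carrier G; x \<in> N\<rbrakk> \<Longrightarrow> rep (act g x) = rep x"
    and finite_P: "finite P"
    and P_sub: "P \<subseteq> Ap"
    and P_tail: "p \<in> P \<Longrightarrow> fst p \<in> rep ` N"
    and P_ex: "e \<in> Ap \<Longrightarrow> \<exists>p \<in> P. \<exists>g \<in> carrier G. map_prod (act g) (act g) p = e"
    and P_unique: "\<lbrakk>p \<in> P; p' \<in> P; g \<in> carrier G; map_prod (act g) (act g) p = p'\<rbrakk> \<Longrightarrow> p = p'"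
    and \<tau>_closed: "p \<in> P \<Longrightarrow> \<tau> p \<in> carrier G"
    and \<tau>_act: "p \<in> P \<Longrightarrow> act (\<tau> p) (rep (snd p)) = snd p"
    and \<nu>_inj: "inj_on \<nu> (rep ` N)"
    and \<pi>_inj: "inj_on \<pi> (P \<times> UNIV)"
    and enc_inj: "inj_on enc (\<Union>q \<in> rep ` N. stab q)"
begin

section \<open>Encoding by natural numbers\<close>

definition S where "S = (\<Union>q \<in> rep ` N. stab q)"
definition dec where "dec = inv_into S enc"
definition node where "node = inv_into (rep ` N) \<nu>"
definition arc_of where "arc_of = inv_into (P \<times> UNIV) \<pi>"

fun arc_tail :: "('x \<times> 'x) \<times> bool \<Rightarrow> 'x" where
  "arc_tail (p, b) = (if b then fst p else rep (snd p))"

fun arc_head :: "('x \<times> 'x) \<times> bool \<Rightarrow> 'x" where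
  "arc_head (p, b) = (if b then rep (snd p) else fst p)"

fun trans_elt :: "('x \<times> 'x) \<times> bool \<Rightarrow> 'g" where
  "trans_elt (p, b) = (if b then \<tau> p else inv (\<tau> p))"

text \<open>The group structure of \<open>B\<close> transported along \<open>enc\<close>, which is
  injective on the finite set \<open>S\<close> containing all groups that are encoded.\<close>

definition coded :: "'g set \<Rightarrow> nat monoid" where
  "coded B = \<lparr>carrier = enc ` B, mult = (\<lambda>a b. enc (dec a \<otimes> dec b)), one = enc \<one>\<rparr>"

text \<open>For direction \<open>True\<close> the head is the chosen node \<open>rep (snd p)\<close>
  instead of \<open>snd p\<close>, so the edge group has to be conjugated by
  \<open>\<tau> p\<close>; for \<open>False\<close> the head is \<open>fst p\<close> and the
  embedding is an inclusion. Off the arcs \<open>arc_rev\<close> is the identity, as bidirected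
  digraphs demand.\<close>

definition quot :: "(nat, nat, nat, nat) graph_of_groups" where
  "quot = \<lparr>
    base = \<lparr>verts = \<nu> ` rep ` N, arcs = \<pi> ` (P \<times> UNIV),
      tail = (\<lambda>e. \<nu> (arc_tail (arc_of e))), head = (\<lambda>e. \<nu> (arc_head (arc_of e)))\<rparr>,
    arc_rev = (\<lambda>e. if e \<in> \<pi> ` (P \<times> UNIV) then \<pi> (apsnd Not (arc_of e)) else e),
    vertex_group = (\<lambda>v. coded (stab (node v))),
    edge_group = (\<lambda>e. coded (stab (fst (fst (arc_of e))) \<inter> stab (snd (fst (arc_of e))))),
    edge_emb = (\<lambda>e a. if snd (arc_of e) then enc (inv (\<tau> (fst (arc_of e))) \<otimes> dec a \<otimes> \<tau> (fst (arc_of e))) else a)\<rparr>"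

lemma quot_simps [simp]:
  "verts (base quot) = \<nu> ` rep ` N" "arcs (base quot) = \<pi> ` (P \<times> UNIV)"
  "tail (base quot) e = \<nu> (arc_tail (arc_of e))" "head (base quot) e = \<nu> (arc_head (arc_of e))"
  "vertex_group quot v = coded (stab (node v))"
  "edge_group quot e = coded (stab (fst (fst (arc_of e))) \<inter> stab (snd (fst (arc_of e))))"
  by (simp_all add: quot_def)

lemma node_\<nu> [simp]: "q \<in> rep ` N \<Longrightarrow> node (\<nu> q) = q"
  using \<nu>_inj by (simp add: node_def)

lemma arc_of_\<pi> [simp]: "p \<in> P \<Longrightarrow> arc_of (\<pi> (p, b)) = (p, b)"
  using \<pi>_inj by (simp add: arc_of_def)

lemma dec_enc: "s \<in> S \<Longrightarrow> dec (enc s) = s"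
  using enc_inj by (simp add: dec_def S_def)

lemma arc_rev_\<pi> [simp]: "p \<in> P \<Longrightarrow> arc_rev quot (\<pi> (p, b)) = \<pi> (p, \<not> b)"
  by (simp add: quot_def)

lemma rep_rep: "q \<in> rep ` N \<Longrightarrow> rep q = q"
proof -
  assume "q \<in> rep ` N"
  then obtain x where x: "x \<in> N" "q = rep x" by blast
  then obtain g where "g \<in> carrier G" "act g q = x" using rep_orbit by blast
  then show "rep q = q" using rep_act[of g q] rep_in x by simp
qed

lemma rep_N: "q \<in> rep ` N \<Longrightarrow> q \<in> N"
  using rep_in by blast

lemma P_N: "p \<in> P \<Longrightarrow> fst p \<in> N" "p \<in> P \<Longrightarrow> snd p \<in> N"
  using P_sub adj_sub by auto

lemma arc_tail_rep: "p \<in> P \<Longrightarrow> arc_tail (p, b) \<in> rep ` N" and arc_head_rep: "p \<in> P \<Longrightarrow> arc_head (p, b) \<in> rep ` N"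
  using P_tail[of p] imageI[OF P_N(2)[of p], of rep] by simp_all

lemma stab_S: "q \<in> rep ` N \<Longrightarrow> stab q \<subseteq> S"
  by (auto simp: S_def)

lemma coded_group:
  assumes B: "subgroup B G" "B \<subseteq> S"
  shows "group (coded B)" and "dec \<in> hom (coded B) G" and "inj_on dec (carrier (coded B))"
    and "dec ` carrier (coded B) = B"
proof -
  have d: "dec (enc s) = s" if "s \<in> B" for s using dec_enc that B by blast
  have sub: "s \<in> carrier G" if "s \<in> B" for s using subgroup.subset[OF B(1)] that by blast
  have m: "a \<otimes> b \<in> B" if "a \<in> B" "b \<in> B" for a b using subgroup.m_closed[OF B(1)] that by blast
  have o: "\<one> \<in> B" using subgroup.one_closed[OF B(1)] .
  show "group (coded B)"
  proof (rule groupI)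
    fix x assume "x \<in> carrier (coded B)"
    then obtain s where s: "s \<in> B" "x = enc s" by (auto simp: coded_def)
    then show "\<exists>y \<in> carrier (coded B). y \<otimes>\<^bsub>coded B\<^esub> x = \<one>\<^bsub>coded B\<^esub>"
      using d sub subgroup.m_inv_closed[OF B(1) s(1)] by (intro bexI[of _ "enc (inv s)"]) (auto simp: coded_def)
  qed (auto simp: coded_def d m o sub m_assoc)
  show "dec \<in> hom (coded B) G" by (auto simp: hom_def coded_def d m sub)
  show "inj_on dec (carrier (coded B))" by (auto simp: inj_on_def coded_def d)
  show "dec ` carrier (coded B) = B" by (force simp: coded_def d)
qed

lemma edge_subgroup: "p \<in> P \<Longrightarrow> subgroup (stab (fst p) \<inter> stab (snd p)) G"
  using subgroup_stab P_N subgroups_Inter_pair by simp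

lemma edge_stab_S: "p \<in> P \<Longrightarrow> stab (fst p) \<inter> stab (snd p) \<subseteq> S"
  using stab_S[OF P_tail] by blast

lemma conj_stab:
  assumes p: "p \<in> P" and s: "s \<in> stab (snd p)"
  shows "inv (\<tau> p) \<otimes> s \<otimes> \<tau> p \<in> stab (rep (snd p))"
proof -
  have "act (inv (\<tau> p)) (snd p) = rep (snd p)"
    using act_inv(1)[OF \<tau>_closed[OF p] rep_in[OF P_N(2)[OF p]]] \<tau>_act[OF p] by simp
  then show ?thesis
    using s \<tau>_closed[OF p] \<tau>_act[OF p] rep_in[OF P_N(2)[OF p]] P_N(2)[OF p] by (simp add: stab_def act_mult)
qed

lemma conj_stab':
  assumes p: "p \<in> P" and s: "s \<in> stab (rep (snd p))"
  shows "\<tau> p \<otimes> s \<otimes> inv (\<tau> p) \<in> stab (snd p)"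
proof -
  have "act (inv (\<tau> p)) (snd p) = rep (snd p)"
    using act_inv(1)[OF \<tau>_closed[OF p] rep_in[OF P_N(2)[OF p]]] \<tau>_act[OF p] by simp
  then show ?thesis
    using s \<tau>_closed[OF p] \<tau>_act[OF p] rep_in[OF P_N(2)[OF p]] P_N(2)[OF p] by (simp add: stab_def act_mult)
qed

lemma edge_emb_\<pi>: "p \<in> P \<Longrightarrow> edge_emb quot (\<pi> (p, True)) a = enc (inv (\<tau> p) \<otimes> dec a \<otimes> \<tau> p)"
  "p \<in> P \<Longrightarrow> edge_emb quot (\<pi> (p, False)) a = a"
  by (simp_all add: quot_def)

lemma \<tau>_cancel:
  assumes "p \<in> P" "s \<in> carrier G"
  shows "\<tau> p \<otimes> (inv (\<tau> p) \<otimes> s \<otimes> \<tau> p) \<otimes> inv (\<tau> p) = s" "inv (\<tau> p) \<otimes> (\<tau> p \<otimes> s \<otimes> inv (\<tau> p)) \<otimes> \<tau> p = s"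
  using assms \<tau>_closed[OF assms(1)] by (simp_all add: m_assoc) (simp_all add: m_assoc[symmetric])

lemma base_wf: "wf_digraph (base quot)"
  by unfold_locales (use arc_tail_rep arc_head_rep in auto)

lemma base_reach:
  assumes "(x, z) \<in> (Ap \<union> Ap\<inverse>)\<^sup>*"
  shows "(\<nu> (rep x), \<nu> (rep z)) \<in> (arcs_ends (base quot))\<^sup>*"
  using assms
proof (induction rule: rtrancl_induct)
  case (step y z)
  have *: "(\<nu> (rep a), \<nu> (rep b)) \<in> arcs_ends (base quot) \<and> (\<nu> (rep b), \<nu> (rep a)) \<in> arcs_ends (base quot)" if ab: "(a, b) \<in> Ap" for a b
  proof -
    obtain p g where p: "p \<in> P" "g \<in> carrier G" "map_prod (act g) (act g) p = (a, b)" using P_ex[OF ab] by blast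
    then have "a = act g (fst p)" "b = act g (snd p)" by (auto simp: map_prod_def split: prod.splits)
    then have r: "rep a = fst p" "rep b = rep (snd p)"
      using rep_act[OF p(2) P_N(1)[OF p(1)]] rep_act[OF p(2) P_N(2)[OF p(1)]] rep_rep[OF P_tail[OF p(1)]] by simp_all
    have "(\<nu> (rep a), \<nu> (rep b)) = arc_to_ends (base quot) (\<pi> (p, True))"
      "(\<nu> (rep b), \<nu> (rep a)) = arc_to_ends (base quot) (\<pi> (p, False))"
      using r p(1) by (simp_all add: arc_to_ends_def)
    then show ?thesis using p(1) by (auto simp: arcs_ends_def)
  qed
  then have "(\<nu> (rep y), \<nu> (rep z)) \<in> arcs_ends (base quot)" using step(2) by blast
  then show ?case using step.IH by (rule rtrancl_into_rtrancl[rotated])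
qed simp

lemma finite_S: "finite S"
  unfolding S_def stab_def by (rule finite_UN_I[OF finite_rep finite_stab[OF rep_N]])

lemma finite_graph_of_finite_groups_quot: "finite_graph_of_finite_groups quot"
proof -
  interpret wf_digraph "base quot" by (rule base_wf)
  have "bidirected_digraph (base quot) (arc_rev quot)"
  proof (rule bidirected_digraphI)
    fix e assume "e \<notin> arcs (base quot)"
    then show "arc_rev quot e = e" by (auto simp: quot_def)
  next
    fix e assume "e \<in> arcs (base quot)"
    then obtain p b where e: "p \<in> P" "e = \<pi> (p, b)" by auto
    then show "arc_rev quot e \<noteq> e" using inj_onD[OF \<pi>_inj, of "(p, b)" "(p, \<not> b)"] by auto
    show "arc_rev quot (arc_rev quot e) = e" using e by simp
    show "tail (base quot) (arc_rev quot e) = head (base quot) e" using e by simp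
  qed
  moreover have "connected (base quot)"
  proof (rule connectedI_rtrancl)
    fix u v assume "u \<in> verts (base quot)" "v \<in> verts (base quot)"
    then obtain x z where "x \<in> N" "z \<in> N" "u = \<nu> (rep x)" "v = \<nu> (rep z)" by auto
    then show "(u, v) \<in> (arcs_ends (base quot))\<^sup>*" using base_reach[OF adj_conn] by simp
  qed (use nonempty in simp)
  moreover have vg: "group (vertex_group quot v) \<and> finite (carrier (vertex_group quot v))" if vV: "v \<in> verts (base quot)" for v
  proof -
    obtain q where q: "q \<in> rep ` N" "v = \<nu> q" using vV by auto
    then have "subgroup (stab q) G" "stab q \<subseteq> S" using subgroup_stab[OF rep_N] stab_S by auto
    then show ?thesis using coded_group(1)[of "stab q"] q finite_subset[OF _ finite_S, of "stab q"] by (simp add: coded_def)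
  qed
  moreover have "group (edge_group quot e) \<and> edge_group quot (arc_rev quot e) = edge_group quot e \<and>
      edge_emb quot e \<in> mon (edge_group quot e) (vertex_group quot (head (base quot) e))" if eA: "e \<in> arcs (base quot)" for e
  proof -
    obtain p b where e: "p \<in> P" "e = \<pi> (p, b)" using eA by auto
    let ?B = "stab (fst p) \<inter> stab (snd p)"
    have B: "subgroup ?B G" "?B \<subseteq> S" using edge_subgroup e edge_stab_S by auto
    have d: "dec (enc s) = s" if "s \<in> ?B" for s using dec_enc B(2) that by blast
    have Bc: "s \<in> carrier G" if "s \<in> ?B" for s using that by (auto simp: stab_def)
    have "edge_emb quot e \<in> mon (coded ?B) (coded (stab (arc_head (p, b))))"
    proof (cases b)
      case True
      have c: "inv (\<tau> p) \<otimes> s \<otimes> \<tau> p \<in> stab (rep (snd p))" "dec (enc (inv (\<tau> p) \<otimes> s \<otimes> \<tau> p)) = inv (\<tau> p) \<otimes> s \<otimes> \<tau> p" if "s \<in> ?B" for s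
        using conj_stab[OF e(1), of s] that dec_enc stab_S[of "rep (snd p)"] P_N[OF e(1)] by blast+
      have hom: "(inv (\<tau> p) \<otimes> s \<otimes> \<tau> p) \<otimes> (inv (\<tau> p) \<otimes> s' \<otimes> \<tau> p) = inv (\<tau> p) \<otimes> (s \<otimes> s') \<otimes> \<tau> p" if "s \<in> carrier G" "s' \<in> carrier G" for s s'
      proof -
        have "\<tau> p \<otimes> (inv (\<tau> p) \<otimes> (s' \<otimes> \<tau> p)) = s' \<otimes> \<tau> p"
          using \<tau>_closed[OF e(1)] that by (simp add: m_assoc[symmetric])
        then show ?thesis using \<tau>_closed[OF e(1)] that by (simp add: m_assoc)
      qed
      have inj: "s = s'" if "enc (inv (\<tau> p) \<otimes> s \<otimes> \<tau> p) = enc (inv (\<tau> p) \<otimes> s' \<otimes> \<tau> p)" "s \<in> ?B" "s' \<in> ?B" for s s'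
        using c(2)[OF that(2)] c(2)[OF that(3)] that(1) \<tau>_cancel(1)[OF e(1) Bc[OF that(2)]] \<tau>_cancel(1)[OF e(1) Bc[OF that(3)]] by metis
      have E: "edge_emb quot e a = enc (inv (\<tau> p) \<otimes> dec a \<otimes> \<tau> p)" for a
        using edge_emb_\<pi>(1)[OF e(1)] e True by simp
      have "inj_on (edge_emb quot e) (enc ` ?B)"
      proof (rule inj_onI)
        fix a a' assume "a \<in> enc ` ?B" "a' \<in> enc ` ?B" "edge_emb quot e a = edge_emb quot e a'"
        then obtain s s' where "s \<in> ?B" "s' \<in> ?B" "a = enc s" "a' = enc s'" by blast
        then show "a = a'" using inj[of s s'] \<open>edge_emb quot e a = edge_emb quot e a'\<close> unfolding E by (simp add: d)
      qed
      moreover have "edge_emb quot e \<in> hom (coded ?B) (coded (stab (rep (snd p))))"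
        unfolding hom_def
      proof (intro CollectI conjI funcsetI ballI)
        fix a assume "a \<in> carrier (coded ?B)"
        then obtain s where "s \<in> ?B" "a = enc s" by (auto simp: coded_def)
        then show "edge_emb quot e a \<in> carrier (coded (stab (rep (snd p))))" using c(1)[of s] d[of s] unfolding E by (simp add: coded_def)
      next
        fix a a' assume "a \<in> carrier (coded ?B)" "a' \<in> carrier (coded ?B)"
        then obtain s s' where s: "s \<in> ?B" "s' \<in> ?B" "a = enc s" "a' = enc s'" unfolding coded_def by auto
        have "s \<otimes> s' \<in> ?B" using subgroup.m_closed[OF B(1)] s by blast
        then show "edge_emb quot e (a \<otimes>\<^bsub>coded ?B\<^esub> a') = edge_emb quot e a \<otimes>\<^bsub>coded (stab (rep (snd p)))\<^esub> edge_emb quot e a'"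
          unfolding E using s c(2)[of s] c(2)[of s'] hom[OF Bc Bc, of s s'] by (simp add: coded_def d)
      qed
      ultimately show ?thesis using True by (simp add: mon_def coded_def)
    next
      case False
      have E: "edge_emb quot e a = a" for a
        using edge_emb_\<pi>(2)[OF e(1)] e False by simp
      show ?thesis using False by (auto simp: mon_def hom_def coded_def E inj_on_def d subgroup.m_closed[OF B(1)])
    qed
    then show ?thesis
      using e coded_group(1)[OF B] node_\<nu>[OF P_tail[OF e(1)]] node_\<nu>[OF imageI[OF P_N(2)[OF e(1)], of rep]]
      by (cases b) simp_all
  qed
  moreover have "fin_digraph (base quot)"
    using finite_rep finite_P by (intro fin_digraphI) auto
  ultimately show ?thesis
    by (intro finite_graph_of_finite_groups.intro graph_of_groups.intro graph_of_groups_axioms.intro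
        finite_graph_of_finite_groups_axioms.intro) auto
qed

lemma bass_serre_quot:
  "bass_serre quot G N (Ap \<union> Ap\<inverse>) act node (\<lambda>_. dec) (\<lambda>e. trans_elt (arc_of e))"
proof -
  interpret finite_graph_of_finite_groups quot by (rule finite_graph_of_finite_groups_quot)
  have te: "trans_elt (p, b) \<in> carrier G" if "p \<in> P" for p b using \<tau>_closed[OF that] by simp
  have sB: "dec ` carrier (coded (stab q)) = stab q" "inj_on dec (carrier (coded (stab q)))" "dec \<in> hom (coded (stab q)) G"
    if "q \<in> rep ` N" for q using coded_group[OF subgroup_stab[OF rep_N[OF that]] stab_S[OF that]] by auto
  have sE: "\<exists>s \<in> stab q. a = enc s \<and> dec a = s" if "a \<in> carrier (coded (stab q))" "q \<in> rep ` N" for a q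
    using that stab_S[OF that(2)] dec_enc by (auto simp: coded_def)
  have inv_\<tau>: "act (inv (\<tau> p)) (snd p) = rep (snd p)" if "p \<in> P" for p
    using act_inv(1)[OF \<tau>_closed[OF that] rep_in[OF P_N(2)[OF that]]] \<tau>_act[OF that] by simp
  have N0_rep: "rep x \<in> N0 \<longleftrightarrow> x \<in> N0" if x: "x \<in> N" for x
  proof -
    obtain g where g: "g \<in> carrier G" "act g (rep x) = x" using rep_orbit[OF x] by blast
    then have "act (inv g) x = rep x" using act_inv(1)[OF g(1) rep_in[OF x]] by simp
    then show ?thesis using g act_N0[of g "rep x"] act_N0[of "inv g" x] by auto
  qed
  show ?thesis
  proof (unfold_locales, goal_cases)
    case (1 g x) then show ?case by (rule act_closed)
  next
    case (2 x) then show ?case by (rule act_one)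
  next
    case (3 g h x) then show ?case by (rule act_mult)
  next
    case 4 then show ?case using adj_sub by blast
  next
    case (5 g x z) then show ?case using adj_act by blast
  next
    case (6 x z) then show ?case by (rule adj_conn)
  next
    case (7 xs) then show ?case using adj_acyclic by blast
  next
    case (8 v) then show ?case using rep_N by auto
  next
    case (9 v w g)
    then obtain q q' where q: "q \<in> rep ` N" "q' \<in> rep ` N" "v = \<nu> q" "w = \<nu> q'" by auto
    then have "rep q' = rep q" using 9(4) rep_act[OF 9(3) rep_N[OF q(1)]] by simp
    then show ?case using q rep_rep[OF q(1)] rep_rep[OF q(2)] by simp
  next
    case (10 v) then show ?case using sB(3) by auto
  next
    case (11 v) then show ?case using sB(2) by auto
  next
    case (12 v)
    then obtain q where q: "q \<in> rep ` N" "v = \<nu> q" by auto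
    then show ?case using sB(1)[OF q(1)] by (simp add: stab_def)
  next
    case (13 y) then show ?case using te by auto
  next
    case (14 y) then show ?case using \<tau>_closed by auto
  next
    case (15 y)
    then obtain p b where y: "p \<in> P" "y = \<pi> (p, b)" by auto
    have pA: "(fst p, snd p) \<in> Ap" using P_sub y(1) by auto
    show ?case
    proof (cases b)
      case True
      then show ?thesis using y pA P_tail \<tau>_act P_N by simp
    next
      case False
      have "(act (inv (\<tau> p)) (fst p), rep (snd p)) \<in> Ap"
        using adj_act[OF _ pA, of "inv (\<tau> p)"] \<tau>_closed[OF y(1)] inv_\<tau>[OF y(1)] by simp
      then show ?thesis using y False P_tail P_N by simp
    qed
  next
    case (16 y c)
    then obtain p b where y: "p \<in> P" "y = \<pi> (p, b)" by auto
    then obtain s where s: "s \<in> stab (fst p) \<inter> stab (snd p)" "c = enc s" using 16 by (auto simp: coded_def)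
    have d: "dec c = s" using s dec_enc edge_stab_S[OF y(1)] by blast
    have "dec (enc (inv (\<tau> p) \<otimes> s \<otimes> \<tau> p)) = inv (\<tau> p) \<otimes> s \<otimes> \<tau> p"
      using conj_stab[OF y(1), of s] s dec_enc stab_S[of "rep (snd p)"] P_N[OF y(1)] by blast
    moreover have "s \<in> carrier G" using s by (simp add: stab_def)
    ultimately show ?case using y d \<tau>_cancel(1)[OF y(1)] \<tau>_closed[OF y(1)] by (cases b) (simp_all add: edge_emb_\<pi>)
  next
    case (17 y s)
    then obtain p b where y: "p \<in> P" "y = \<pi> (p, b)" by auto
    obtain h where h: "h \<in> stab (arc_head (p, b))" "s = enc h" "dec s = h"
      using sE[of s "arc_head (p, b)"] 17(2) y arc_head_rep[OF y(1), of b] by auto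
    have hc: "h \<in> carrier G" using h by (simp add: stab_def)
    have "act h (act (inv (trans_elt (p, b))) (arc_tail (p, b))) = act (inv (trans_elt (p, b))) (arc_tail (p, b))"
      using 17(3) y h(3) arc_tail_rep[OF y(1), of b] by simp
    then have fx: "act h (if b then act (inv (\<tau> p)) (fst p) else snd p) = (if b then act (inv (\<tau> p)) (fst p) else snd p)"
      using \<tau>_act[OF y(1)] \<tau>_closed[OF y(1)] by (simp split: if_splits)
    show ?case
    proof (cases b)
      case True
      \<comment> \<open>Moved by \<open>\<tau> p\<close>, the stabilizer of the head becomes that of
        \<open>snd p\<close>, inside which the edge group is defined.\<close>
      let ?k = "\<tau> p \<otimes> h \<otimes> inv (\<tau> p)"
      have "act ?k (fst p) = act (\<tau> p) (act h (act (inv (\<tau> p)) (fst p)))"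
        using \<tau>_closed[OF y(1)] hc P_N[OF y(1)] act_closed by (simp add: act_mult)
      also have "\<dots> = fst p" using fx True act_inv(2)[OF \<tau>_closed[OF y(1)] P_N(1)[OF y(1)]] by simp
      finally have "?k \<in> stab (fst p) \<inter> stab (snd p)"
        using conj_stab'[OF y(1), of h] h(1) True by (simp add: stab_def)
      moreover from this have "edge_emb quot y (enc ?k) = s"
        using dec_enc edge_stab_S[OF y(1)] \<tau>_cancel(2)[OF y(1) hc] h(2) y True by (auto simp: edge_emb_\<pi>)
      ultimately show ?thesis using y by (intro bexI[of _ "enc ?k"]) (auto simp: coded_def)
    next
      case False
      then have "h \<in> stab (fst p) \<inter> stab (snd p)" using fx h(1) hc by (simp add: stab_def)
      then show ?thesis using y False h(2) by (intro bexI[of _ s]) (auto simp: coded_def edge_emb_\<pi>)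
    qed
  next
    case (18 v x)
    then obtain q where q: "q \<in> rep ` N" "v = \<nu> q" by auto
    \<comment> \<open>The two orientations of the tree arc at \<open>q\<close> lead to arcs with
      direction \<open>True\<close> and \<open>False\<close>.\<close>
    have qx: "(q, x) \<in> Ap \<or> (x, q) \<in> Ap" using 18 q by auto
    then show ?case
    proof
      assume "(q, x) \<in> Ap"
      from P_ex[OF this] obtain p g where p: "p \<in> P" "g \<in> carrier G" "act g (fst p) = q" "act g (snd p) = x"
        by (auto simp: map_prod_def split: prod.splits)
      have fq: "fst p = q" using rep_act[OF p(2) P_N(1)[OF p(1)]] p(3) rep_rep[OF q(1)] rep_rep[OF P_tail[OF p(1)]] by simp
      then have g: "g \<in> stab q" using p by (simp add: stab_def)
      have "dec (enc g) = g" using dec_enc stab_S[OF q(1)] g by blast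
      then show ?thesis
        using p fq q g \<tau>_act[OF p(1)] P_N[OF p(1)]
        by (intro bexI[of _ "\<pi> (p, True)"] bexI[of _ "enc g"]) (auto simp: coded_def)
    next
      assume "(x, q) \<in> Ap"
      from P_ex[OF this] obtain p g where p: "p \<in> P" "g \<in> carrier G" "act g (fst p) = x" "act g (snd p) = q"
        by (auto simp: map_prod_def split: prod.splits)
      have rq: "rep (snd p) = q" using rep_act[OF p(2) P_N(2)[OF p(1)]] p(4) rep_rep[OF q(1)] by simp
      \<comment> \<open>\<open>g\<close> takes \<open>snd p\<close>, which is only in the orbit of
        \<open>q\<close>, to \<open>q\<close>; precomposing with \<open>\<tau> p\<close> gives an
        element of the stabilizer.\<close>
      let ?k = "g \<otimes> \<tau> p"
      have kc: "?k \<in> carrier G" using p(2) \<tau>_closed[OF p(1)] by simp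
      have "act ?k q = q" using act_mult[OF p(2) \<tau>_closed[OF p(1)] rep_N[OF q(1)]] \<tau>_act[OF p(1)] rq p(4) by simp
      then have k: "?k \<in> stab q" using kc by (simp add: stab_def)
      have "dec (enc ?k) = ?k" using dec_enc stab_S[OF q(1)] k by blast
      moreover have "act ?k (act (inv (\<tau> p)) (fst p)) = x"
        using act_mult[OF p(2) \<tau>_closed[OF p(1)] act_closed] act_inv(2)[OF \<tau>_closed[OF p(1)] P_N(1)[OF p(1)]] \<tau>_closed[OF p(1)] P_N(1)[OF p(1)] p(3) by simp
      ultimately show ?thesis
        using p rq q k P_tail[OF p(1)]
        by (intro bexI[of _ "\<pi> (p, False)"] bexI[of _ "enc ?k"]) (auto simp: coded_def)
    qed
  next
    case (19 y y' a)
    then obtain p b p' b' where y: "p \<in> P" "y = \<pi> (p, b)" "p' \<in> P" "y' = \<pi> (p', b')" by auto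
    have tl: "arc_tail (p, b) = arc_tail (p', b')"
      using 19(3) y inj_onD[OF \<nu>_inj _ arc_tail_rep[OF y(1)] arc_tail_rep[OF y(3)]] by simp
    obtain h where h: "h \<in> stab (arc_tail (p, b))" "dec a = h"
      using sE[of a "arc_tail (p, b)"] 19(4) y arc_tail_rep[OF y(1), of b] by auto
    have hc: "h \<in> carrier G" using h by (simp add: stab_def)
    have eq: "act h (act (trans_elt (p, b)) (arc_head (p, b))) = act (trans_elt (p', b')) (arc_head (p', b'))"
      using 19(5) y h(2) arc_head_rep[OF y(1), of b] arc_head_rep[OF y(3), of b'] by simp
    \<comment> \<open>Arcs of opposite directions have tails in different classes of the
      bipartition.\<close>
    have bb: "b = b'"
    proof (rule ccontr)
      assume "b \<noteq> b'"
      moreover have "fst p \<in> N0" "snd p \<notin> N0" "fst p' \<in> N0" "snd p' \<notin> N0"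
        using bipartite P_sub y by (metis prod.collapse subsetD)+
      moreover from this have "rep (snd p) \<notin> N0" "rep (snd p') \<notin> N0"
        using N0_rep[OF P_N(2)[OF y(1)]] N0_rep[OF P_N(2)[OF y(3)]] by auto
      ultimately show False using tl by (auto split: if_splits)
    qed
    show ?case
    proof (cases b)
      case True
      have "act h (fst p) = fst p'" using h tl bb True by (simp add: stab_def)
      moreover have "act h (snd p) = snd p'" using eq bb True \<tau>_act y by simp
      ultimately have "map_prod (act h) (act h) p = p'" by (simp add: map_prod_def split_beta prod_eq_iff)
      then have "p = p'" by (rule P_unique[OF y(1,3) hc])
      then show ?thesis using y bb by simp
    next
      case False
      \<comment> \<open>The arcs are based at \<open>rep (snd p)\<close> here; \<open>?k\<close> is
        \<open>h\<close> rewritten as a map from \<open>p\<close> to \<open>p'\<close>.\<close>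
      let ?k = "\<tau> p' \<otimes> h \<otimes> inv (\<tau> p)"
      have c: "\<tau> p \<in> carrier G" "\<tau> p' \<in> carrier G" using \<tau>_closed y by auto
      have k: "act ?k x = act (\<tau> p') (act h (act (inv (\<tau> p)) x))" if "x \<in> N" for x
        using c hc that act_closed by (simp add: act_mult)
      have "act ?k (fst p) = fst p'"
        using k[OF P_N(1)[OF y(1)]] eq bb False act_inv(2)[OF c(2) P_N(1)[OF y(3)]] by simp
      moreover have "act ?k (snd p) = snd p'"
        using k[OF P_N(2)[OF y(1)]] inv_\<tau>[OF y(1)] h(1) tl bb False \<tau>_act[OF y(3)] by (simp add: stab_def)
      ultimately have "map_prod (act ?k) (act ?k) p = p'" by (simp add: map_prod_def split_beta prod_eq_iff)
      moreover have "?k \<in> carrier G" using c hc by simp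
      ultimately have "p = p'" using P_unique[OF y(1,3)] by blast
      then show ?thesis using y bb by simp
    qed
  qed
qed

end

section \<open>Choice of representatives for node and arc orbits\<close>

theorem (in tree_action) exists_graph_of_groups:
  "\<exists>(\<Y> :: (nat, nat, nat, nat) graph_of_groups) v.
     finite_graph_of_finite_groups \<Y> \<and> v \<in> verts (base \<Y>) \<and> G \<cong> fundamental_group \<Y> v"
proof -
  obtain F where F: "F \<subseteq> N" "finite F" "\<forall>x \<in> N. \<exists>f \<in> F. \<exists>g \<in> carrier G. act g f = x"
    using nodes_cofinite by blast
  obtain r where r: "r ` N \<subseteq> F" "\<forall>x \<in> N. \<exists>g \<in> carrier G. act g (r x) = x" "\<forall>g \<in> carrier G. \<forall>x \<in> N. r (act g x) = r x"
    using orbit_representatives[OF act_closed act_one act_mult F(1,3)] by blast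
  obtain F1 where F1: "F1 \<subseteq> Ap" "finite F1" "\<forall>e \<in> Ap. \<exists>f \<in> F1. \<exists>g \<in> carrier G. map_prod (act g) (act g) f = e"
    using arcs_cofinite by blast
  have "\<forall>x \<in> N. \<exists>g. g \<in> carrier G \<and> act g x = r x"
  proof
    fix x assume x: "x \<in> N"
    then obtain g where g: "g \<in> carrier G" "act g (r x) = x" using r(2) by blast
    then have "act (inv g) x = r x" using act_inv(1)[of g "r x"] r(1) F(1) x by auto
    then show "\<exists>g. g \<in> carrier G \<and> act g x = r x" using g by blast
  qed
  then obtain c where c: "\<forall>x \<in> N. c x \<in> carrier G \<and> act (c x) x = r x" by metis
  \<comment> \<open>Each arc is moved so that its tail becomes the chosen node of its orbit.\<close>
  define F2 where "F2 = (\<lambda>f. map_prod (act (c (fst f))) (act (c (fst f))) f) ` F1"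
  have AN: "fst e \<in> N \<and> snd e \<in> N" if "e \<in> Ap" for e using that adj_sub by auto
  have mp: "map_prod (act g) (act g) e = (act g (fst e), act g (snd e))" for g e by (cases e) simp
  have mp_closed: "map_prod (act g) (act g) e \<in> Ap" if "g \<in> carrier G" "e \<in> Ap" for g e
    using adj_act[OF that(1), of "fst e" "snd e"] that(2) by (simp add: mp)
  have mp_one: "map_prod (act \<one>) (act \<one>) e = e" if "e \<in> Ap" for e
    using AN[OF that] act_one by (simp add: mp)
  have mp_mult: "map_prod (act (g \<otimes> h)) (act (g \<otimes> h)) e = map_prod (act g) (act g) (map_prod (act h) (act h) e)"
    if "g \<in> carrier G" "h \<in> carrier G" "e \<in> Ap" for g h e
    using AN[OF that(3)] act_mult that by (simp add: mp)
  have "map_prod (act (c (fst f))) (act (c (fst f))) f \<in> Ap" if f: "f \<in> F1" for f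
  proof -
    have fA: "f \<in> Ap" using f F1(1) by blast
    then show ?thesis using mp_closed[OF conjunct1[OF bspec[OF c conjunct1[OF AN[OF fA]]]] fA] by simp
  qed
  then have F2: "F2 \<subseteq> Ap" "finite F2" using F1(2) unfolding F2_def by auto
  have F2_tail: "\<forall>f \<in> F2. fst f \<in> r ` N"
    using F1(1) AN c unfolding F2_def by (auto simp: mp)
  have F2_ex: "\<forall>e \<in> Ap. \<exists>f \<in> F2. \<exists>g \<in> carrier G. map_prod (act g) (act g) f = e"
  proof
    fix e assume "e \<in> Ap"
    then obtain f g where f: "f \<in> F1" "g \<in> carrier G" "map_prod (act g) (act g) f = e" using bspec[OF F1(3)] by blast
    let ?c = "c (fst f)"
    have fA: "f \<in> Ap" using f(1) F1(1) by blast
    then have cf: "?c \<in> carrier G" "f \<in> Ap" using bspec[OF c conjunct1[OF AN[OF fA]]] by simp_all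
    have "map_prod (act (inv ?c)) (act (inv ?c)) (map_prod (act ?c) (act ?c) f) = f"
      using mp_mult[of "inv ?c" ?c f] cf mp_one by simp
    then have "map_prod (act (g \<otimes> inv ?c)) (act (g \<otimes> inv ?c)) (map_prod (act ?c) (act ?c) f) = e"
      using mp_mult[of g "inv ?c" "map_prod (act ?c) (act ?c) f"] mp_closed cf f by simp
    then show "\<exists>f \<in> F2. \<exists>g \<in> carrier G. map_prod (act g) (act g) f = e"
      using f cf unfolding F2_def by blast
  qed
  obtain ra where ra: "ra ` Ap \<subseteq> F2" "\<forall>e \<in> Ap. \<exists>g \<in> carrier G. map_prod (act g) (act g) (ra e) = e"
    "\<forall>g \<in> carrier G. \<forall>e \<in> Ap. ra (map_prod (act g) (act g) e) = ra e"
    using orbit_representatives[of Ap "\<lambda>g. map_prod (act g) (act g)", OF mp_closed mp_one mp_mult F2(1) F2_ex] by blast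
  \<comment> \<open>Several elements of \<open>F2\<close> may share an orbit; \<open>ra\<close>
    keeps one of them, still with a chosen node as tail.\<close>
  define P where "P = ra ` Ap"
  have P: "P \<subseteq> Ap" "finite P" using ra(1) F2 finite_subset unfolding P_def by auto
  have ra_P: "ra p = p" if pP: "p \<in> P" for p
  proof -
    obtain e where e: "e \<in> Ap" "p = ra e" using pP by (auto simp: P_def)
    then obtain g where g: "g \<in> carrier G" "map_prod (act g) (act g) p = e" using ra(2) by blast
    then have "ra e = ra p" using bspec[OF bspec[OF ra(3) g(1)], of p] P(1) pP by auto
    then show ?thesis using e by simp
  qed
  have "\<forall>p \<in> P. \<exists>g. g \<in> carrier G \<and> act g (r (snd p)) = snd p" using r(2) AN P(1) by blast
  then obtain \<tau> where \<tau>: "\<forall>p \<in> P. \<tau> p \<in> carrier G \<and> act (\<tau> p) (r (snd p)) = snd p" by metis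
  have fin_r: "finite (r ` N)" using r(1) F(2) finite_subset by blast
  obtain \<nu> :: "'x \<Rightarrow> nat" where \<nu>: "inj_on \<nu> (r ` N)" using finite_imp_inj_to_nat_seg[OF fin_r] by blast
  have "finite (P \<times> (UNIV :: bool set))" using P(2) by simp
  from finite_imp_inj_to_nat_seg[OF this]
  obtain \<pi> :: "('x \<times> 'x) \<times> bool \<Rightarrow> nat" where \<pi>: "inj_on \<pi> (P \<times> UNIV)" by blast
  have rN: "r x \<in> N" if "x \<in> N" for x using that r(1) F(1) by blast
  have "finite (\<Union>q \<in> r ` N. stab q)" 
    unfolding stab_def by (rule finite_UN_I[OF fin_r finite_stab]) (use rN in auto)
  from finite_imp_inj_to_nat_seg[OF this]
  obtain enc :: "'g \<Rightarrow> nat" where enc: "inj_on enc (\<Union>q \<in> r ` N. stab q)" by blast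
  interpret quotient_data G N N0 Ap act r P \<tau> \<nu> \<pi> enc
  proof (unfold_locales, goal_cases)
    case (7 p) then show ?case using F2_tail ra(1) by (auto simp: P_def)
  next
    case (8 e)
    then show ?case using bspec[OF ra(2) 8] unfolding P_def by blast
  next
    case (9 p p' g)
    then have "ra (map_prod (act g) (act g) p) = ra p" using ra(3) P(1) by blast
    then show ?case using ra_P[OF 9(1)] ra_P[OF 9(2)] 9(4) by simp
  qed (use fin_r rN r P \<tau> \<nu> \<pi> enc in auto)
  interpret bass_serre quot G N "Ap \<union> Ap\<inverse>" act node "\<lambda>_. dec" "\<lambda>e. trans_elt (arc_of e)"
    by (rule bass_serre_quot)
  obtain x where x: "x \<in> N" using nonempty by blast
  then have "\<nu> (r x) \<in> verts (base quot)" by simp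
  then show ?thesis using finite_graph_of_finite_groups_quot iso_fundamental_group by blast
qed

section \<open>The action on the tree of essential cuts\<close>

context proper_action
begin

lemma tree_nodes_Pow: "x \<in> tree_nodes \<Longrightarrow> x \<subseteq> Pow V"
  using orientation_Pow essential_sub by (auto simp: tree_nodes_def side_def)

text \<open>An orientation that is not the tip of any cut agrees with \<open>point v\<close>, since
  a disagreement would yield a minimal cut. So at most one node exists besides tips and
  midpoints.\<close>

lemma tree_nodes_cofinite:
  "\<exists>F \<subseteq> tree_nodes. finite F \<and> (\<forall>x \<in> tree_nodes. \<exists>f \<in> F. \<exists>g \<in> carrier G. act_node g f = x)"
proof -
  obtain E0 where E0: "E0 \<subseteq> essential k" "finite E0" "\<forall>C \<in> essential k. \<exists>D \<in> E0. \<exists>g \<in> carrier G. act_set g D = C"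
    using cuts_cofinite by blast
  obtain v where v: "v \<in> V" using nonempty by blast
  define F where "F = insert (point v) (tip ` E0 \<union> side ` E0)"
  have E0E: "D \<in> essential k" if "D \<in> E0" for D using that E0(1) by blast
  have "\<exists>f \<in> F. \<exists>g \<in> carrier G. act_node g f = x" if x: "x \<in> tree_nodes" for x
  proof (cases "\<exists>C \<in> essential k. x = tip C \<or> x = side C")
    case True
    then obtain C where C: "C \<in> essential k" "x = tip C \<or> x = side C" by blast
    obtain D g where D: "D \<in> E0" "g \<in> carrier G" "act_set g D = C" using bspec[OF E0(3) C(1)] by blast
    then have "act_node g (tip D) = tip C" "act_node g (side D) = side C"
      using tip_act[OF D(2) E0E[OF D(1)]] side_act[OF D(2) E0E[OF D(1)]] by simp_all
    then show ?thesis using C(2) D unfolding F_def by blast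
  next
    case False
    then have o: "orientation x" using x by (auto simp: tree_nodes_def)
    have "x \<subseteq> point v"
    proof
      fix C assume C: "C \<in> x"
      show "C \<in> point v"
      proof (rule ccontr)
        assume "C \<notin> point v"
        from exists_flippable[OF o orientation_point[OF v] C this] obtain D where "D \<in> x" "x = tip D" by blast
        then show False using False orientationD(1)[OF o] by blast
      qed
    qed
    then have "x = point v" using orientation_subset_eq[OF o orientation_point[OF v]] by blast
    then show ?thesis using act_node_one[OF orientation_Pow[OF o]] unfolding F_def by blast
  qed
  moreover have "F \<subseteq> tree_nodes"
    using orientation_point[OF v] orientation_tip E0E by (auto simp: F_def tree_nodes_def)
  moreover have "finite F" using E0(2) by (simp add: F_def)
  ultimately show ?thesis by (intro exI[of _ F] conjI ballI)
qed

lemma tree_action_nodes: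
  assumes bal: "\<And>W. finite W \<Longrightarrow> W \<subseteq> V \<Longrightarrow> W \<noteq> {} \<Longrightarrow>
      \<exists>X \<subseteq> V. finite X \<and> card X \<le> m \<and> finite (bd X) \<and> card (bd X) \<le> k \<and>
        (\<forall>A. A \<subseteq> V - X \<longrightarrow> conn A \<longrightarrow> 2 * card (A \<inter> W) \<le> card W)"
  shows "tree_action G tree_nodes (Collect orientation) tree_arcs act_node"
proof (unfold_locales, goal_cases)
  case (1 g x)
  show ?case
  proof (cases "orientation x")
    case True
    then show ?thesis using orientation_act[OF 1(1)] by (simp add: tree_nodes_def)
  next
    case False
    then obtain C where C: "C \<in> essential k" "x = side C" using 1(2) by (auto simp: tree_nodes_def)
    then show ?thesis using side_act[OF 1(1) C(1), symmetric] essential_act[OF 1(1) C(1)] by (simp add: tree_nodes_def)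
  qed
next
  case (2 x)
  then show ?case by (rule act_node_one[OF tree_nodes_Pow])
next
  case (3 g h x)
  then show ?case using act_node_mult[OF 3(1,2) tree_nodes_Pow[OF 3(3)]] by simp
next
  case 4
  obtain v where "v \<in> V" using nonempty by blast
  then show ?case using orientation_point by (auto simp: tree_nodes_def)
next
  case 5
  show ?case using orientation_tip by (auto simp: tree_arcs_def tree_nodes_def)
next
  case (6 x z)
  then show ?case using orientation_tip side_not_orientation by (auto simp: tree_arcs_def)
next
  case (7 g x)
  then show ?case using orientation_act by simp
next
  case (8 g x z)
  then obtain C where C: "C \<in> essential k" "x = tip C" "z = side C" by (auto simp: tree_arcs_def)
  then show ?case using tree_arcI[OF essential_act[OF 8(1) C(1)]] tip_act[OF 8(1) C(1)] side_act[OF 8(1) C(1)] by simp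
next
  case (9 x z)
  then show ?case by (rule tree_connected)
next
  case (10 xs)
  then show ?case by (rule tree_acyclic)
next
  case (11 x)
  show ?case
  proof (cases "orientation x")
    case True
    interpret node_stabilizer V R G \<phi> k x by unfold_locales (rule True)
    show ?thesis using finite_H[OF bal] unfolding H_def .
  next
    case False
    then obtain C where C: "C \<in> essential k" "x = side C" using 11 by (auto simp: tree_nodes_def)
    have c: "C \<in> cuts k" "V - C \<in> cuts k" using C(1) essential_cuts essential_compl by blast+
    \<comment> \<open>An element fixing the midpoint fixes \<open>C\<close> or exchanges its
      sides.\<close>
    have "{g \<in> carrier G. act_node g x = x} \<subseteq> {g \<in> carrier G. act_set g C = C} \<union> {g \<in> carrier G. act_set g C = V - C}"
      unfolding C(2) side_def by blast
    then show ?thesis using finite_cut_movers[OF c(1) c(1)] finite_cut_movers[OF c(1) c(2)] finite_subset by blast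
  qed
next
  case 12
  show ?case by (rule tree_nodes_cofinite)
next
  case 13
  obtain E0 where E0: "E0 \<subseteq> essential k" "finite E0" "\<forall>C \<in> essential k. \<exists>D \<in> E0. \<exists>g \<in> carrier G. act_set g D = C"
    using cuts_cofinite by blast
  define F where "F = (\<lambda>C. (tip C, side C)) ` E0"
  have "\<exists>f \<in> F. \<exists>g \<in> carrier G. map_prod (act_node g) (act_node g) f = e" if e: "e \<in> tree_arcs" for e
  proof -
    obtain C where C: "C \<in> essential k" "e = (tip C, side C)" using e by (auto simp: tree_arcs_def)
    obtain D g where D: "D \<in> E0" "g \<in> carrier G" "act_set g D = C" using bspec[OF E0(3) C(1)] by blast
    have DE: "D \<in> essential k" using D(1) E0(1) by blast
    have "map_prod (act_node g) (act_node g) (tip D, side D) = e"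
      using tip_act[OF D(2) DE] side_act[OF D(2) DE] D(3) C(2) by simp
    then show ?thesis using D unfolding F_def by blast
  qed
  moreover have "F \<subseteq> tree_arcs" "finite F" using E0(1,2) by (auto simp: F_def tree_arcs_def)
  ultimately show ?case by (intro exI[of _ F] conjI ballI)
qed

end

section \<open>Balanced bags\<close>

context pair_bidirected_digraph
begin

definition dist :: "'a \<Rightarrow> 'a \<Rightarrow> nat" where
  "dist s u = (LEAST n. \<exists>p. awalk s p u \<and> length p = n)"

text \<open>Two nodes other than \<open>t\<close> are related if they lie in the same branch at
  \<open>t\<close>, that is, in one component after removal of \<open>t\<close>.\<close>

definition avoiding :: "'a \<Rightarrow> ('a \<times> 'a) set" where
  "avoiding t = (parcs G \<inter> (- {t}) \<times> (- {t}))\<^sup>*"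

lemma arc_verts: "(u, v) \<in> parcs G \<Longrightarrow> u \<in> pverts G" "(u, v) \<in> parcs G \<Longrightarrow> v \<in> pverts G"
  using arc_fst_in_verts[of "(u, v)"] arc_snd_in_verts[of "(u, v)"] by simp_all

lemma arc_symD: "(u, v) \<in> parcs G \<Longrightarrow> (v, u) \<in> parcs G"
  using pair_sym_arcs by (auto simp: symmetric_def sym_def)

lemma dist_le: "awalk s p u \<Longrightarrow> dist s u \<le> length p"
  unfolding dist_def by (rule Least_le) blast

lemma avoiding_sym: "(s, u) \<in> avoiding t \<Longrightarrow> (u, s) \<in> avoiding t"
proof -
  have "sym (parcs G \<inter> (- {t}) \<times> (- {t}))" using arc_symD by (auto simp: sym_def)
  then show "(s, u) \<in> avoiding t \<Longrightarrow> (u, s) \<in> avoiding t" unfolding avoiding_def by (meson sym_rtrancl symD)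
qed

lemma avoiding_trans: "(s, u) \<in> avoiding t \<Longrightarrow> (u, w) \<in> avoiding t \<Longrightarrow> (s, w) \<in> avoiding t"
  unfolding avoiding_def by (rule rtrancl_trans)

lemma awalk_avoiding: "awalk s p u \<Longrightarrow> t \<notin> set (awalk_verts s p) \<Longrightarrow> (s, u) \<in> avoiding t"
proof (induction p arbitrary: s)
  case Nil
  then show ?case by (simp add: avoiding_def awalk_Nil_iff)
next
  case (Cons e p)
  then have e: "e \<in> parcs G" "fst e = s" "awalk (snd e) p u" "t \<noteq> s" "t \<notin> set (awalk_verts (snd e) p)"
    by (auto simp: awalk_Cons_iff)
  have "snd e \<in> set (awalk_verts (snd e) p)" by (cases p) (use e(3) in \<open>auto simp: awalk_Cons_iff\<close>)
  then have "(s, snd e) \<in> parcs G \<inter> (- {t}) \<times> (- {t})" using e by auto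
  then show ?case using Cons.IH[OF e(3,5)] unfolding avoiding_def by (rule converse_rtrancl_into_rtrancl)
qed

lemma avoiding_awalk:
  assumes "(s, u) \<in> avoiding t" "s \<in> pverts G" "s \<noteq> t"
  shows "\<exists>p. awalk s p u \<and> t \<notin> set (awalk_verts s p)"
  using assms(1) unfolding avoiding_def
proof (induction rule: rtrancl_induct)
  case base
  then show ?case using assms by (intro exI[of _ "[]"]) (simp add: awalk_Nil_iff)
next
  case (step y z)
  then obtain p where p: "awalk s p y" "t \<notin> set (awalk_verts s p)" by blast
  have yz: "awalk y [(y, z)] z" using step(2) arc_verts by (auto simp: awalk_Cons_iff awalk_Nil_iff)
  have w: "awalk s (p @ [(y, z)]) z" using awalk_appendI[OF p(1) yz] .
  moreover have "t \<notin> set (awalk_verts s (p @ [(y, z)]))"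
    using set_awalk_verts_append[OF p(1) yz] p(2) step(2) by auto
  ultimately show ?case by blast
qed

text \<open>A path from \<open>a\<close> to \<open>b\<close> avoiding \<open>t\<close> closes up
  through \<open>t\<close> to a cycle, of length at least three if \<open>a\<close> and
  \<open>b\<close> differ. So a branch of a tree at \<open>t\<close> is entered through one
  neighbour only.\<close>

lemma tree_unique_neighbour:
  assumes tree: "\<not> (\<exists>p. cycle p \<and> 3 \<le> length p)"
    and a: "(t, a) \<in> parcs G" and b: "(t, b) \<in> parcs G" and ab: "(a, b) \<in> avoiding t"
  shows "a = b"
proof (rule ccontr)
  assume ne: "a \<noteq> b"
  have V: "a \<in> pverts G" "t \<in> pverts G" "a \<noteq> t" using a no_loops[of "(t, a)"] arc_verts by auto
  obtain p where p: "awalk a p b" "t \<notin> set (awalk_verts a p)" using avoiding_awalk[OF ab V(1,3)] by blast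
  define q where "q = awalk_to_apath p"
  have q: "apath a q b" using apath_awalk_to_apath[OF p(1)] by (simp add: q_def)
  have qw: "awalk a q b" "distinct (awalk_verts a q)" using q by (auto simp: apath_def)
  have "set q \<subseteq> set p" using awalk_to_apath_subset[OF p(1)] by (simp add: q_def)
  then have "set (awalk_verts a q) \<subseteq> set (awalk_verts a p)"
    using set_awalk_verts[OF qw(1)] set_awalk_verts[OF p(1)] by auto
  then have tq: "t \<notin> set (awalk_verts a q)" using p(2) by blast
  have bt: "(b, t) \<in> parcs G" using b by (rule arc_symD)
  let ?c = "(t, a) # q @ [(b, t)]"
  have w: "awalk a (q @ [(b, t)]) t"
    by (rule awalk_appendI[OF qw(1)]) (use bt V arc_verts in \<open>auto simp: awalk_Cons_iff awalk_Nil_iff\<close>)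
  moreover have "awalk t [(t, a)] a" using a V by (simp add: awalk_Cons_iff awalk_Nil_iff)
  ultimately have "awalk t ?c t" using awalk_appendI[of t "[(t, a)]" a "q @ [(b, t)]" t] by simp
  moreover have "awalk_verts a (q @ [(b, t)]) = awalk_verts a q @ [t]"
    using awalk_verts_append[OF w] qw(1) by (simp add: awalk_verts_conv awalk_def)
  then have "distinct (tl (awalk_verts t ?c))" using qw(2) tq by simp
  ultimately have "cycle ?c" unfolding cycle_def by blast
  moreover have "q \<noteq> []" using qw(1) ne by (auto simp: awalk_Nil_iff)
  then have "3 \<le> length ?c" by (cases q) auto
  ultimately show False using tree by blast
qed

end

lemma connected_rtrancl:
  assumes "pair_bidirected_digraph \<Gamma>" "connected (with_proj \<Gamma>)"
  shows "pverts \<Gamma> \<noteq> {}" "\<And>u v. u \<in> pverts \<Gamma> \<Longrightarrow> v \<in> pverts \<Gamma> \<Longrightarrow> \<exists>p. pre_digraph.awalk (with_proj \<Gamma>) u p v"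
    "\<And>u v. u \<in> pverts \<Gamma> \<Longrightarrow> v \<in> pverts \<Gamma> \<Longrightarrow> (u, v) \<in> (parcs \<Gamma>)\<^sup>*"
proof -
  interpret pair_bidirected_digraph \<Gamma> by (rule assms)
  have "strongly_connected (with_proj \<Gamma>)"
    using symmetric_connected_imp_strongly_connected[OF sym_arcs assms(2)] .
  then have *: "pverts \<Gamma> \<noteq> {}" "\<And>u v. u \<in> pverts \<Gamma> \<Longrightarrow> v \<in> pverts \<Gamma> \<Longrightarrow> u \<rightarrow>\<^sup>*\<^bsub>with_proj \<Gamma>\<^esub> v"
    by (auto simp: strongly_connected_def)
  show "pverts \<Gamma> \<noteq> {}" by (rule *(1))
  fix u v assume "u \<in> pverts \<Gamma>" "v \<in> pverts \<Gamma>"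
  then have r: "u \<rightarrow>\<^sup>*\<^bsub>with_proj \<Gamma>\<^esub> v" by (rule *(2))
  then show "\<exists>p. awalk u p v" using reachable_awalk by blast
  show "(u, v) \<in> (parcs \<Gamma>)\<^sup>*" using reachable_rtranclI[OF r] by simp
qed

text \<open>The bag at a median of the nodes whose bags contain the points of \<open>W\<close> is balanced.\<close>

lemma balanced_bag:
  assumes td: "tree_decomposition \<Gamma> T X" and W: "finite W" "W \<subseteq> pverts \<Gamma>"
  shows "\<exists>t \<in> pverts T. \<forall>A. A \<subseteq> pverts \<Gamma> - X t \<longrightarrow>
    (\<forall>x \<in> A. \<forall>y \<in> A. (x, y) \<in> (parcs \<Gamma> \<inter> A \<times> A)\<^sup>*) \<longrightarrow> 2 * card (A \<inter> W) \<le> card W"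
proof -
  have ut: "undirected_tree T" using td by (simp add: tree_decomposition_def)
  interpret T: pair_bidirected_digraph T using ut by (simp add: undirected_tree_def)
  have bd: "pair_bidirected_digraph T" by unfold_locales
  have conn: "connected (with_proj T)" and tree: "\<not> (\<exists>p. T.cycle p \<and> 3 \<le> length p)"
    using ut by (simp_all add: undirected_tree_def)
  note walks = connected_rtrancl(2)[OF bd conn]
  have geo: "\<exists>p. geodesic T s p u \<and> length p = T.dist s u" if su: "s \<in> pverts T" "u \<in> pverts T" for s u
  proof -
    have "\<exists>n p. T.awalk s p u \<and> length p = n" using walks[OF su] by blast
    then have "\<exists>p. T.awalk s p u \<and> length p = T.dist s u" unfolding T.dist_def by (rule LeastI_ex)
    then show ?thesis using T.dist_le unfolding geodesic_def by metis
  qed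
  have bag: "\<exists>t \<in> pverts T. w \<in> X t" if "w \<in> pverts \<Gamma>" for w
    using td that by (simp add: tree_decomposition_def)
  have bag2: "\<exists>t \<in> pverts T. u \<in> X t \<and> w \<in> X t" if "(u, w) \<in> parcs \<Gamma>" for u w
    using td that by (auto simp: tree_decomposition_def)
  have inter: "X u \<inter> X s \<subseteq> X r" if "s \<in> pverts T" "u \<in> pverts T" "geodesic T s p u" "r \<in> set (T.awalk_verts s p)" for s u p r
    using td that unfolding tree_decomposition_def awalk_verts_with_proj_eq by blast
  have branch: "(s, u) \<in> T.avoiding t" if su: "s \<in> pverts T" "u \<in> pverts T" "w \<in> X s" "w \<in> X u" "w \<notin> X t" for s u w t
  proof -
    obtain p where p: "geodesic T s p u" using geo su(1,2) by blast
    then have "t \<notin> set (T.awalk_verts s p)" using inter[OF su(1,2) p] su(3-5) by blast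
    then show ?thesis using p T.awalk_avoiding unfolding geodesic_def by blast
  qed
  have toward: "\<exists>a. (t, a) \<in> parcs T \<and> T.dist a s + 1 \<le> T.dist t s \<and> (a, s) \<in> T.avoiding t"
    if ts: "t \<in> pverts T" "s \<in> pverts T" "s \<noteq> t" for t s
  proof -
    obtain p where p: "T.awalk t p s" "length p = T.dist t s" using geo ts(1,2) unfolding geodesic_def by blast
    then obtain e p' where e: "p = e # p'" using ts(3) by (cases p) (auto simp: T.awalk_Nil_iff)
    then obtain a where a: "e = (t, a)" "(t, a) \<in> parcs T" "T.awalk a p' s"
      using p(1) by (cases e) (auto simp: T.awalk_Cons_iff)
    have "T.dist a s + 1 \<le> T.dist t s" using T.dist_le[OF a(3)] p(2) e by simp
    moreover have "t \<notin> set (T.awalk_verts a p')"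
    proof
      assume "t \<in> set (T.awalk_verts a p')"
      then obtain q r where "p' = q @ r" "T.awalk t r s" using T.awalk_decomp[OF a(3)] by blast
      then show False using T.dist_le[of t r s] p(2) e by simp
    qed
    ultimately show ?thesis using a(2) T.awalk_avoiding[OF a(3)] by blast
  qed
  have near: "T.dist a s \<le> T.dist t s + 1" if ta: "(t, a) \<in> parcs T" "s \<in> pverts T" for t a s
  proof -
    have V: "t \<in> pverts T" "a \<in> pverts T" using ta(1) T.arc_verts by auto
    obtain p where p: "T.awalk t p s" "length p = T.dist t s" using geo[OF V(1) ta(2)] unfolding geodesic_def by blast
    have "(a, t) \<in> parcs T" using ta(1) by (rule T.arc_symD)
    then have "T.awalk a ((a, t) # p) s" using p(1) V by (simp add: T.awalk_Cons_iff)
    then show ?thesis using T.dist_le[of a "(a, t) # p" s] p(2) by simp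
  qed
  have "\<forall>w \<in> W. \<exists>t. t \<in> pverts T \<and> w \<in> X t" using bag W(2) by blast
  then obtain f where f: "\<forall>w \<in> W. f w \<in> pverts T \<and> w \<in> X (f w)" by metis
  \<comment> \<open>The median is a node with the least sum of distances to one chosen node
    \<open>f w\<close> for each point \<open>w\<close>.\<close>
  define S where "S t = (\<Sum>w\<in>W. T.dist t (f w))" for t
  obtain t0 where "t0 \<in> pverts T" using connected_rtrancl(1)[OF bd conn] by blast
  from ex_has_least_nat[of "\<lambda>t. t \<in> pverts T", OF this, of S]
  obtain t where t: "t \<in> pverts T" "\<forall>s. s \<in> pverts T \<longrightarrow> S t \<le> S s" by blast
  have "2 * card (A \<inter> W) \<le> card W" if A: "A \<subseteq> pverts \<Gamma> - X t" "\<forall>x \<in> A. \<forall>y \<in> A. (x, y) \<in> (parcs \<Gamma> \<inter> A \<times> A)\<^sup>*" for A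
  proof (cases "A \<inter> W = {}")
    case False
    then obtain w0 where w0: "w0 \<in> A" "w0 \<in> W" by blast
    \<comment> \<open>Bags that meet the connected set \<open>A\<close> lie in one branch at
      \<open>t\<close>: the ends of an edge share a bag, and \<open>X t\<close> contains no point of
      \<open>A\<close>.\<close>
    have same: "\<forall>u. u \<in> pverts T \<longrightarrow> y \<in> X u \<longrightarrow> (s, u) \<in> T.avoiding t"
      if "(x, y) \<in> (parcs \<Gamma> \<inter> A \<times> A)\<^sup>*" "x \<in> A" "s \<in> pverts T" "x \<in> X s" for x y s
      using that(1)
    proof (induction rule: rtrancl_induct)
      case base
      then show ?case using branch[of s _ x t] that A(1) by blast
    next
      case (step y z)
      then obtain r where r: "r \<in> pverts T" "y \<in> X r" "z \<in> X r" using bag2 by blast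
      then show ?case using step branch[of r _ z t] A(1) T.avoiding_trans by blast
    qed
    have ft: "f w \<noteq> t" if "w \<in> A" "w \<in> W" for w using f that A(1) by auto
    obtain a where a: "(t, a) \<in> parcs T" "(a, f w0) \<in> T.avoiding t"
      using toward[OF t(1), of "f w0"] ft[OF w0] f w0(2) by blast
    \<comment> \<open>All points of \<open>A\<close> lie behind the same neighbour \<open>a\<close>.
      The step from \<open>t\<close> to \<open>a\<close> brings them closer by at least one and
      moves the others away by at most one, so minimality at \<open>t\<close> bounds their
      number.\<close>
    have closer: "T.dist a (f w) + 1 \<le> T.dist t (f w)" if w: "w \<in> A" "w \<in> W" for w
    proof -
      obtain b where b: "(t, b) \<in> parcs T" "T.dist b (f w) + 1 \<le> T.dist t (f w)" "(b, f w) \<in> T.avoiding t"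
        using toward[OF t(1), of "f w"] ft[OF w] f w(2) by blast
      have "(f w0, f w) \<in> T.avoiding t" using same[of w0 w "f w0"] A(2) w0 w f by blast
      then have "(a, b) \<in> T.avoiding t" using a(2) b(3) T.avoiding_trans T.avoiding_sym by blast
      then show ?thesis using T.tree_unique_neighbour[OF tree a(1) b(1)] b(2) by simp
    qed
    have split: "(\<Sum>w\<in>W. h w) = (\<Sum>w\<in>A \<inter> W. h w) + (\<Sum>w\<in>W - A. h w)" for h :: "_ \<Rightarrow> nat"
      using sum.Int_Diff[OF W(1), of h A] by (simp add: Int_commute)
    have "(\<Sum>w\<in>A \<inter> W. T.dist a (f w)) + card (A \<inter> W) = (\<Sum>w\<in>A \<inter> W. T.dist a (f w) + 1)"
      unfolding sum.distrib by simp
    also have "\<dots> \<le> (\<Sum>w\<in>A \<inter> W. T.dist t (f w))" using closer by (intro sum_mono) auto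
    finally have 1: "(\<Sum>w\<in>A \<inter> W. T.dist a (f w)) + card (A \<inter> W) \<le> (\<Sum>w\<in>A \<inter> W. T.dist t (f w))" .
    have "(\<Sum>w\<in>W - A. T.dist a (f w)) \<le> (\<Sum>w\<in>W - A. T.dist t (f w) + 1)" using near[OF a(1)] f by (intro sum_mono) auto
    also have "\<dots> = (\<Sum>w\<in>W - A. T.dist t (f w)) + card (W - A)" unfolding sum.distrib by simp
    finally have 2: "(\<Sum>w\<in>W - A. T.dist a (f w)) \<le> (\<Sum>w\<in>W - A. T.dist t (f w)) + card (W - A)" .
    have "S t \<le> S a" using t(2) a(1) T.arc_verts by auto
    then have "card (A \<inter> W) \<le> card (W - A)" using 1 2 unfolding S_def split by linarith
    moreover have "card W = card (A \<inter> W) + card (W - A)" using card_Int_Diff[OF W(1), of A] by (simp add: Int_commute)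
    ultimately show ?thesis by simp
  qed simp
  then show ?thesis using t(1) by blast
qed

section \<open>Degree and boundary bounds for the given action\<close>

theorem corollary5p10:
  fixes G :: "('g, 'm) monoid_scheme"
    and \<Gamma> :: "'v pair_pre_digraph"
    and \<phi> :: "'g \<Rightarrow> 'v \<Rightarrow> 'v"
  assumes "graph_action G \<Gamma> \<phi>"
    and "connected (with_proj \<Gamma>)"
    and "locally_finite \<Gamma>"
    and "finite_treewidth TYPE('t) \<Gamma>"
    and "fin_digraph (quotient_graph G \<Gamma> \<phi>)"
    and "\<And>v. v \<in> pverts \<Gamma> \<Longrightarrow> finite (stabilizer G \<phi> v)"
  shows "\<exists>(\<Y> :: (nat, nat, nat, nat) graph_of_groups) v.
           finite_graph_of_finite_groups \<Y> \<and> v \<in> verts (base \<Y>) \<and>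
           G \<cong> fundamental_group \<Y> v"
proof -
  interpret act: graph_action G \<Gamma> \<phi> by (rule assms(1))
  let ?V = "pverts \<Gamma>" and ?R = "parcs \<Gamma>"
  have bd: "pair_bidirected_digraph \<Gamma>" by unfold_locales
  interpret conn_graph ?V ?R
  proof
    show "?R \<subseteq> ?V \<times> ?V" using act.arc_verts by auto
    show "sym ?R" using act.arc_symD by (auto simp: sym_def)
    show "finite (?R `` {v})" if "v \<in> ?V" for v
      using assms(3) that unfolding locally_finite_def Image_singleton by blast
  qed (use connected_rtrancl[OF bd assms(2)] in auto)
  have adj: "(\<phi> g u, \<phi> g v) \<in> ?R \<longleftrightarrow> (u, v) \<in> ?R" if "g \<in> carrier G" "u \<in> ?V" "v \<in> ?V" for g u v
    using act.adjacency_preserving that by blast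
  have "finite (orbits G ?V \<phi>)"
    using fin_digraph.finite_verts[OF assms(5)] by (simp add: quotient_graph_def)
  define r where "r Q = (SOME p. p \<in> ?V \<and> orbit G \<phi> p = Q)" for Q
  define P where "P = r ` orbits G ?V \<phi>"
  have r: "r (orbit G \<phi> v) \<in> ?V \<and> orbit G \<phi> (r (orbit G \<phi> v)) = orbit G \<phi> v" if "v \<in> ?V" for v
    unfolding r_def by (rule someI_ex) (use that in blast)
  have P: "P \<subseteq> ?V" "finite P"
    using r \<open>finite (orbits G ?V \<phi>)\<close> by (auto simp: P_def orbits_def)
  have P_ex: "\<exists>p \<in> P. \<exists>g \<in> carrier G. \<phi> g p = v" if v: "v \<in> ?V" for v
  proof -
    have "v \<in> orbit G \<phi> (r (orbit G \<phi> v))" using r[OF v] act.orbit_refl[OF v] by simp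
    moreover have "r (orbit G \<phi> v) \<in> P" using v by (auto simp: P_def orbits_def)
    moreover have "\<exists>g \<in> carrier G. \<phi> g y = x" if "x \<in> orbit G \<phi> y" for x y
      using that by (auto simp: orbit_def)
    ultimately show ?thesis by blast
  qed
  \<comment> \<open>Degrees are constant on orbits, so the sum over representatives bounds them
    all.\<close>
  define d where "d = (\<Sum>p\<in>P. card (?R `` {p}))"
  have deg: "card (?R `` {v}) \<le> d" if v: "v \<in> ?V" for v
  proof -
    obtain p g where p: "p \<in> P" "g \<in> carrier G" "\<phi> g p = v" using P_ex[OF v] by blast
    then have pV: "p \<in> ?V" using P by blast
    have "?R `` {v} \<subseteq> \<phi> g ` (?R `` {p})"
    proof
      fix w assume "w \<in> ?R `` {v}"
      then have w: "(v, w) \<in> ?R" "w \<in> ?V" using arcs_subset by auto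
      then obtain z where "z \<in> ?V" "\<phi> g z = w" using act.bij_prop1[OF p(2)] by blast
      then show "w \<in> \<phi> g ` (?R `` {p})" using adj[OF p(2) pV] w p(3) by auto
    qed
    then have "card (?R `` {v}) \<le> card (?R `` {p})"
      using finite_nbrs[OF pV] by (meson card_image_le card_mono finite_imageI le_trans)
    also have "\<dots> \<le> d" 
      unfolding d_def using member_le_sum[of p P "\<lambda>p. card (?R `` {p})"] p(1) P(2) by simp
    finally show ?thesis .
  qed
  obtain w and T :: "'t pair_pre_digraph" and X where T: "tree_decomposition \<Gamma> T X"
    "\<forall>t \<in> pverts T. finite (X t) \<and> card (X t) \<le> w + 1"
    using assms(4) unfolding finite_treewidth_def by blast
  \<comment> \<open>Each vertex of a bag contributes at most \<open>d\<close> boundary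
    edges.\<close>
  define k where "k = (w + 1) * d"
  have bdX: "finite (bd Z)" "card (bd Z) \<le> k" if Z: "Z \<subseteq> ?V" "finite Z" "card Z \<le> w + 1" for Z
  proof -
    have sub: "bd Z \<subseteq> (\<Union>z\<in>Z. Pair z ` (?R `` {z}))" by (auto simp: bd_def)
    have fin: "finite (\<Union>z\<in>Z. Pair z ` (?R `` {z}))" using Z finite_nbrs by (intro finite_UN_I) auto
    show "finite (bd Z)" using sub fin by (rule finite_subset)
    have "card (bd Z) \<le> (\<Sum>z\<in>Z. card (Pair z ` (?R `` {z})))"
      using card_mono[OF fin sub] card_UN_le[OF Z(2)] le_trans by blast
    also have "\<dots> \<le> (\<Sum>z\<in>Z. d)"
      using deg Z(1) by (intro sum_mono) (auto simp: card_image inj_on_def)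
    also have "\<dots> \<le> k" unfolding k_def sum_constant using Z(3) by (simp only: mult_le_mono1 of_nat_id)
    finally show "card (bd Z) \<le> k" .
  qed
  interpret proper_action ?V ?R G \<phi> k
  proof
    show "\<exists>P \<subseteq> ?V. finite P \<and> (\<forall>v \<in> ?V. \<exists>p \<in> P. \<exists>g \<in> carrier G. \<phi> g p = v)" using P P_ex by blast
  qed (use adj assms(6) in auto)
  have "\<exists>Z \<subseteq> ?V. finite Z \<and> card Z \<le> w + 1 \<and> finite (bd Z) \<and> card (bd Z) \<le> k \<and>
      (\<forall>A. A \<subseteq> ?V - Z \<longrightarrow> conn A \<longrightarrow> 2 * card (A \<inter> W) \<le> card W)"
    if W: "finite W" "W \<subseteq> ?V" for W
  proof -
    obtain t where t: "t \<in> pverts T" "\<forall>A. A \<subseteq> ?V - X t \<longrightarrow> conn A \<longrightarrow> 2 * card (A \<inter> W) \<le> card W"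
      using balanced_bag[OF T(1) W] unfolding conn_def by blast
    have "X t \<subseteq> ?V" using T(1) t(1) by (simp add: tree_decomposition_def)
    then show ?thesis using t T(2) bdX[of "X t"] by (intro exI[of _ "X t"]) blast
  qed
  then interpret tree_action G tree_nodes "Collect orientation" tree_arcs act_node
    by (intro tree_action_nodes) blast
  show ?thesis by (rule exists_graph_of_groups)
qed

end
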